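(* Let $\Omega\subseteq\mathbb{C}^n$ be a domain, let $\mathcal{H}\in B_1^*(\Omega)$, and let $l$ be a positive integer. Let $\Theta:\Omega\to\mathcal{B}(\mathbb{C}^l,\mathbb{C}^{l+1})$ be such that $\Theta\in\mathcal{M}(\mathcal{H})\otimes\mathcal{B}(\mathbb{C}^l,\mathbb{C}^{l+1})$ and $\Theta$ has a left inverse $\Psi\in\mathcal{M}(\mathcal{H})\otimes\mathcal{B}(\mathbb{C}^{l+1},\mathbb{C}^l)$. Let $\mathcal{H}_\Theta=(\mathcal{H}\otimes\mathbb{C}^{l+1})/M_\Theta(\mathcal{H}\otimes\mathbb{C}^l)$ be the quotient Hilbert module. Then: (1) $\mathcal{H}_\Theta\in B_1^*(\Omega)$; (2) $L_\Theta(w)=\mathbb{C}^{l+1}/\Theta(w)\mathbb{C}^l$ defines a hermitian holomorphic line bundle $L_\Theta=\coprod_{w\in\Omega}L_\Theta(w)$ over $\Omega$ such that $E^*_{\mathcal{H}_\Theta}\cong E^*_{\mathcal{H}}\otimes L^*_\Theta$, where $L_\Theta^*$ is the hermitian anti-holomorphic line bundle dual to $L_\Theta$; (3) $\mathcal{K}_{E^*_{\mathcal{H}_\Theta}}-\mathcal{K}_{E^*_{\mathcal{H}}}=\mathcal{K}_{L^*_\Theta}$ as two-forms on $\Omega$.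
   Context: A Hilbert module over $\mathbb{C}[z_1,\dots,z_n]$ is a Hilbert space $\mathcal{H}$ with commuting bounded operators $M_{z_1},\dots,M_{z_n}$ on it, acting by $p\cdot h=p(M_{z_1},\dots,M_{z_n})h$. A domain is a connected open set. For a positive integer $m$, $B_m^*(\Omega)$ is the set of Hilbert modules $\mathcal{H}$ over $\mathbb{C}[z_1,\dots,z_n]$ such that: (i) for every $w\in\Omega$ the column operator $(M_z-wI_{\mathcal{H}})^*:\mathcal{H}\to\mathcal{H}^n$, $h\mapsto (M_{z_1}-w_1I)^*h\oplus\cdots\oplus(M_{z_n}-w_nI)^*h$, has closed range; (ii) $\dim\ker(M_z-wI_{\mathcal{H}})^*=\dim\bigcap_{i=1}^n\ker(M_{z_i}-w_iI)^*=m$ for every $w\in\Omega$; (iii) the closed linear span of $\bigcup_{w\in\Omega}\ker(M_z-wI_{\mathcal{H}})^*$ is $\mathcal{H}$. For such $\mathcal{H}$, $E^*_{\mathcal{H}}$ is the rank $m$ hermitian anti-holomorphic vector bundle over $\Omega$ with fibre $E^*_{\mathcal{H}}(w)=\ker(M_z-wI_{\mathcal{H}})^*\subseteq\mathcal{H}$ and inner product inherited from $\mathcal{H}$. $\mathcal{M}(\mathcal{H})$ is the multiplier algebra: functions $\varphi:\Omega\to\mathbb{C}$ for which pointwise multiplication defines a bounded operator $M_\varphi$ on $\mathcal{H}$ (elements of $\mathcal{H}$ being regarded, locally, as functions on $\Omega$ via evaluation against $E_{\mathcal{H}}^*(w)$); equivalently there is a bounded $M_\varphi$ on $\mathcal{H}$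 with $M_\varphi^*k=\overline{\varphi(w)}k$ for all $w\in\Omega$, $k\in E^*_{\mathcal{H}}(w)$. An element $\Theta=[\theta_{i,j}]$ of $\mathcal{M}(\mathcal{H})\otimes\mathcal{B}(\mathbb{C}^p,\mathbb{C}^q)$ is a $q\times p$ matrix of multipliers, and $M_\Theta:\mathcal{H}\otimes\mathbb{C}^p\to\mathcal{H}\otimes\mathbb{C}^q$ is the corresponding matrix of operators $[M_{\theta_{i,j}}]$, a module map. $\Psi$ is a left inverse of $\Theta$ if $\Psi(w)\Theta(w)=I$ for all $w\in\Omega$ (so $M_\Theta$ has closed range). The quotient carries the quotient norm and induced module action; it is identified with the orthogonal complement of $\operatorname{ran}M_\Theta$ with the compressed action. $L_\Theta$ carries the quotient hermitian metric. Its dual hermitian anti-holomorphic bundle $L^*_\Theta$ is identified with the anti-holomorphic subbundle of $\Omega\times\mathbb{C}^{l+1}$ with fibre $(\operatorname{ran}\Theta(w))^\perp=\ker\Theta(w)^*$ and inherited inner product. $\cong$ denotes equivalence of hermitian anti-holomorphic vector bundles: an anti-holomorphic bundle isomorphism that is isometric on each fibre. For a hermitian anti-holomorphic line bundle $E$ with local non-vanishing anti-holomorphic section $s$, the curvature two-form of the Chern connection is $\mathcal{K}_E(w)=-\sum_{i,j=1}^n\frac{\partial^2}{\partial w_i\partial\bar w_j}\log\|s(w)\|^2\,dw_i\wedge d\bar w_j$. *)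

theory Defs
  imports "HOL-Analysis.Analysis"
begin

section \<open>Complex Hilbert spaces\<close>

class complex_inner = real_inner +
  fixes scaleC :: "complex \<Rightarrow> 'a \<Rightarrow> 'a"  (infixr "*\<^sub>C" 75)
    and cinner :: "'a \<Rightarrow> 'a \<Rightarrow> complex"
  assumes scaleR_scaleC: "r *\<^sub>R x = complex_of_real r *\<^sub>C x"
    and scaleC_add_right: "c *\<^sub>C (x + y) = c *\<^sub>C x + c *\<^sub>C y"
    and scaleC_add_left: "(c + d) *\<^sub>C x = c *\<^sub>C x + d *\<^sub>C x"
    and scaleC_scaleC: "c *\<^sub>C (d *\<^sub>C x) = (c * d) *\<^sub>C x"
    and cinner_commute: "cinner x y = cnj (cinner y x)"
    and cinner_add_left: "cinner (x + y) z = cinner x z + cinner y z"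
    and cinner_scaleC_left: "cinner (c *\<^sub>C x) y = c * cinner x y"
    and inner_eq_Re_cinner: "inner x y = Re (cinner x y)"

class chilbert_space = complex_inner + complete_space

lemma scaleC_one [simp]: "1 *\<^sub>C x = (x :: 'a :: complex_inner)"
  using scaleR_scaleC[of 1 x] by simp

global_interpretation cvec: vector_space "scaleC :: complex \<Rightarrow> 'a \<Rightarrow> 'a :: complex_inner"
  by unfold_locales (auto simp: scaleC_add_right scaleC_add_left scaleC_scaleC)

instantiation complex :: chilbert_space
begin

definition "scaleC_complex (c :: complex) (x :: complex) = c * x"
definition "cinner_complex (x :: complex) (y :: complex) = x * cnj y"

instance
  by standard
    (auto simp: scaleC_complex_def cinner_complex_def algebra_simps scaleR_conv_of_real
      inner_complex_def)

end

instantiation vec :: (complex_inner, finite) complex_inner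
begin

definition "scaleC_vec (c :: complex) (x :: 'a ^ 'b) = (\<chi> i. c *\<^sub>C (x $ i))"
definition "cinner_vec (x :: 'a ^ 'b) (y :: 'a ^ 'b) = (\<Sum>i\<in>UNIV. cinner (x $ i) (y $ i))"

instance
proof
  fix r :: real and c d :: complex and x y z :: "'a ^ 'b"
  show "r *\<^sub>R x = complex_of_real r *\<^sub>C x"
    by (simp add: vec_eq_iff scaleC_vec_def scaleR_scaleC)
  show "c *\<^sub>C (x + y) = c *\<^sub>C x + c *\<^sub>C y"
    by (simp add: vec_eq_iff scaleC_vec_def scaleC_add_right)
  show "(c + d) *\<^sub>C x = c *\<^sub>C x + d *\<^sub>C x"
    by (simp add: vec_eq_iff scaleC_vec_def scaleC_add_left)
  show "c *\<^sub>C (d *\<^sub>C x) = (c * d) *\<^sub>C x"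
    by (simp add: vec_eq_iff scaleC_vec_def scaleC_scaleC)
  show "cinner x y = cnj (cinner y x)"
    unfolding cinner_vec_def cnj_sum by (rule sum.cong[OF refl]) (rule cinner_commute)
  show "cinner (x + y) z = cinner x z + cinner y z"
    by (simp add: cinner_vec_def cinner_add_left sum.distrib)
  show "cinner (c *\<^sub>C x) y = c * cinner x y"
    by (simp add: cinner_vec_def scaleC_vec_def cinner_scaleC_left sum_distrib_left)
  show "inner x y = Re (cinner x y)"
    by (simp add: cinner_vec_def inner_vec_def inner_eq_Re_cinner)
qed

end

instance vec :: (chilbert_space, finite) chilbert_space ..

definition orth :: "'a::complex_inner set \<Rightarrow> 'a set \<Rightarrow> 'a set" where
  "orth S A = {x \<in> S. \<forall>a\<in>A. cinner x a = 0}"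

text \<open>
  In the next three definitions \<open>S\<close> is meant to be a closed subspace; then \<open>proj_on S x\<close> exists, and
  so does \<open>adjoint_on S T y\<close> for \<open>y \<in> S\<close> and \<open>T\<close> bounded on \<open>S\<close>.
\<close>

definition proj_on :: "'a::complex_inner set \<Rightarrow> 'a \<Rightarrow> 'a" where
  "proj_on S x = (THE y. y \<in> S \<and> (\<forall>z\<in>S. cinner (x - y) z = 0))"

definition bounded_op_on :: "'a::complex_inner set \<Rightarrow> ('a \<Rightarrow> 'a) \<Rightarrow> bool" where
  "bounded_op_on S T \<longleftrightarrow>
     (\<forall>x\<in>S. T x \<in> S) \<and>
     (\<forall>x\<in>S. \<forall>y\<in>S. T (x + y) = T x + T y) \<and>
     (\<forall>c. \<forall>x\<in>S. T (c *\<^sub>C x) = c *\<^sub>C T x) \<and>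
     (\<exists>K. \<forall>x\<in>S. norm (T x) \<le> K * norm x)"

definition adjoint_on :: "'a::complex_inner set \<Rightarrow> ('a \<Rightarrow> 'a) \<Rightarrow> 'a \<Rightarrow> 'a" where
  "adjoint_on S T y = (THE z. z \<in> S \<and> (\<forall>x\<in>S. cinner (T x) y = cinner x z))"


section \<open>Hilbert modules\<close>

text \<open>
  A Hilbert module over \<open>\<complex>[z\<^sub>1, \<dots>, z\<^sub>n]\<close> is given by the operators of multiplication by the
  coordinates. The Hilbert space is a closed subspace of an ambient Hilbert space (a type), so
  that submodules and quotient modules are objects of the same kind. The values of the operators
  off the subspace are irrelevant.
\<close>

record ('n, 'a) hilbert_mod =
  hspace :: "'a set"
  hact :: "'n \<Rightarrow> 'a \<Rightarrow> 'a"

definition hilbert_module :: "('n, 'a::chilbert_space) hilbert_mod \<Rightarrow> bool" where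
  "hilbert_module H \<longleftrightarrow>
     cvec.subspace (hspace H) \<and> closed (hspace H) \<and>
     (\<forall>i. bounded_op_on (hspace H) (hact H i)) \<and>
     (\<forall>i j. \<forall>x\<in>hspace H. hact H i (hact H j x) = hact H j (hact H i x))"

text \<open>The column operator \<open>(M\<^sub>z - w I)\<^sup>*\<close>, for a point \<open>w\<close>.\<close>

definition adj_column ::
    "('n::finite, 'a::chilbert_space) hilbert_mod \<Rightarrow> complex^'n \<Rightarrow> 'a \<Rightarrow> 'a^'n" where
  "adj_column H w h = (\<chi> i. adjoint_on (hspace H) (\<lambda>x. hact H i x - (w $ i) *\<^sub>C x) h)"

definition joint_ker ::
    "('n::finite, 'a::chilbert_space) hilbert_mod \<Rightarrow> complex^'n \<Rightarrow> 'a set" where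
  "joint_ker H w = {h \<in> hspace H. adj_column H w h = 0}"

text \<open>\<open>cvec.dim\<close> is 0 on infinite-dimensional spaces, so \<open>0 < m\<close> forces finite dimension.\<close>

definition B_star ::
    "nat \<Rightarrow> (complex^'n::finite) set \<Rightarrow> ('n, 'a::chilbert_space) hilbert_mod set" where
  "B_star m \<Omega> = {H. hilbert_module H \<and> 0 < m \<and>
     (\<forall>w\<in>\<Omega>. closed (adj_column H w ` hspace H)) \<and>
     (\<forall>w\<in>\<Omega>. cvec.dim (joint_ker H w) = m) \<and>
     closure (cvec.span (\<Union>w\<in>\<Omega>. joint_ker H w)) = hspace H}"

text \<open>\<open>H \<otimes> \<complex>\<^sup>p\<close>, realized as \<open>p\<close>-tuples of elements of \<open>H\<close>.\<close>

definition tensor_module ::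
    "('n, 'a) hilbert_mod \<Rightarrow> ('n, 'a^'p::finite) hilbert_mod" where
  "tensor_module H = \<lparr>hspace = {f. \<forall>r. f $ r \<in> hspace H},
     hact = (\<lambda>i f. \<chi> r. hact H i (f $ r))\<rparr>"

text \<open>
  The quotient of \<open>K\<close> by a closed submodule \<open>R\<close>, identified with the orthogonal complement of
  \<open>R\<close> in \<open>K\<close>; the induced action becomes the compression.
\<close>

definition quotient_module ::
    "('n, 'a::chilbert_space) hilbert_mod \<Rightarrow> 'a set \<Rightarrow> ('n, 'a) hilbert_mod" where
  "quotient_module K R = \<lparr>hspace = orth (hspace K) R,
     hact = (\<lambda>i f. proj_on (orth (hspace K) R) (hact K i f))\<rparr>"


section \<open>Multipliers\<close>

text \<open>
  \<open>T\<close> is multiplication by \<open>\<phi>\<close>, elements \<open>h\<close> of \<open>H\<close> being regarded as functions through the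
  pairings with \<open>k \<in> joint_ker H w\<close>. For \<open>H\<close> in \<open>B_star m \<Omega>\<close> it is unique on \<open>H\<close>.
\<close>

definition is_mult_op ::
    "(complex^'n::finite) set \<Rightarrow> ('n, 'a::chilbert_space) hilbert_mod \<Rightarrow>
     (complex^'n \<Rightarrow> complex) \<Rightarrow> ('a \<Rightarrow> 'a) \<Rightarrow> bool" where
  "is_mult_op \<Omega> H \<phi> T \<longleftrightarrow> bounded_op_on (hspace H) T \<and>
     (\<forall>w\<in>\<Omega>. \<forall>k\<in>joint_ker H w. adjoint_on (hspace H) T k = cnj (\<phi> w) *\<^sub>C k)"

definition multiplier ::
    "(complex^'n::finite) set \<Rightarrow> ('n, 'a::chilbert_space) hilbert_mod \<Rightarrow>
     (complex^'n \<Rightarrow> complex) set" where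
  "multiplier \<Omega> H = {\<phi>. \<exists>T. is_mult_op \<Omega> H \<phi> T}"

definition mult_op ::
    "(complex^'n::finite) set \<Rightarrow> ('n, 'a::chilbert_space) hilbert_mod \<Rightarrow>
     (complex^'n \<Rightarrow> complex) \<Rightarrow> 'a \<Rightarrow> 'a" where
  "mult_op \<Omega> H \<phi> = (SOME T. is_mult_op \<Omega> H \<phi> T)"

definition multiplier_matrix ::
    "(complex^'n::finite) set \<Rightarrow> ('n, 'a::chilbert_space) hilbert_mod \<Rightarrow>
     (complex^'n \<Rightarrow> complex^'p^'q) set" where
  "multiplier_matrix \<Omega> H = {\<Theta>. \<forall>i j. (\<lambda>w. \<Theta> w $ i $ j) \<in> multiplier \<Omega> H}"

definition mult_matrix_op ::
    "(complex^'n::finite) set \<Rightarrow> ('n, 'a::chilbert_space) hilbert_mod \<Rightarrow>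
     (complex^'n \<Rightarrow> complex^'p::finite^'q::finite) \<Rightarrow> 'a^'p \<Rightarrow> 'a^'q" where
  "mult_matrix_op \<Omega> H \<Theta> f =
     (\<chi> i. \<Sum>j\<in>UNIV. mult_op \<Omega> H (\<lambda>w. \<Theta> w $ i $ j) (f $ j))"

definition H_Theta ::
    "(complex^'n::finite) set \<Rightarrow> ('n, 'a::chilbert_space) hilbert_mod \<Rightarrow>
     (complex^'n \<Rightarrow> complex^'p::finite^'q::finite) \<Rightarrow> ('n, 'a^'q) hilbert_mod" where
  "H_Theta \<Omega> H \<Theta> = quotient_module (tensor_module H)
     (mult_matrix_op \<Omega> H \<Theta> ` hspace (tensor_module H))"


section \<open>Regularity of functions of several complex variables\<close>

text \<open>Used for open \<open>U\<close> only.\<close>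

definition hol_on ::
    "(complex^'n::finite) set \<Rightarrow> (complex^'n \<Rightarrow> 'b::complex_inner) \<Rightarrow> bool" where
  "hol_on U f \<longleftrightarrow> (\<forall>w\<in>U. \<exists>D. (f has_derivative D) (at w) \<and>
     (\<forall>c v. D (c *\<^sub>C v) = c *\<^sub>C D v))"

definition antihol_on ::
    "(complex^'n::finite) set \<Rightarrow> (complex^'n \<Rightarrow> 'b::complex_inner) \<Rightarrow> bool" where
  "antihol_on U f \<longleftrightarrow> (\<forall>w\<in>U. \<exists>D. (f has_derivative D) (at w) \<and>
     (\<forall>c v. D (c *\<^sub>C v) = cnj c *\<^sub>C D v))"

primrec Ck_on ::
    "nat \<Rightarrow> (complex^'n::finite) set \<Rightarrow> (complex^'n \<Rightarrow> 'b::real_normed_vector) \<Rightarrow> bool" where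
  "Ck_on 0 U f \<longleftrightarrow> continuous_on U f"
| "Ck_on (Suc k) U f \<longleftrightarrow> (\<forall>w\<in>U. f differentiable (at w)) \<and>
     (\<forall>v. Ck_on k U (\<lambda>w. frechet_derivative f (at w) v))"

definition smooth_on ::
    "(complex^'n::finite) set \<Rightarrow> (complex^'n \<Rightarrow> 'b::real_normed_vector) \<Rightarrow> bool" where
  "smooth_on U f \<longleftrightarrow> (\<forall>k. Ck_on k U f)"

text \<open>The Wirtinger derivatives \<open>\<partial>/\<partial>w\<^sub>i\<close> and \<open>\<partial>/\<partial>w\<^sub>i\<close>-bar.\<close>

definition wirtinger :: "'n \<Rightarrow> (complex^'n::finite \<Rightarrow> complex) \<Rightarrow> complex^'n \<Rightarrow> complex" where
  "wirtinger i f w = (frechet_derivative f (at w) (axis i 1)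
     - \<i> * frechet_derivative f (at w) (axis i \<i>)) / 2"

definition wirtinger_bar :: "'n \<Rightarrow> (complex^'n::finite \<Rightarrow> complex) \<Rightarrow> complex^'n \<Rightarrow> complex" where
  "wirtinger_bar i f w = (frechet_derivative f (at w) (axis i 1)
     + \<i> * frechet_derivative f (at w) (axis i \<i>)) / 2"


section \<open>Hermitian line bundles\<close>

text \<open>The fibres include quotient spaces, hence the explicit carriers and operations.\<close>

record 'v herm_space =
  hcarrier :: "'v set"
  hzero :: "'v"
  hadd :: "'v \<Rightarrow> 'v \<Rightarrow> 'v"
  hscale :: "complex \<Rightarrow> 'v \<Rightarrow> 'v"
  hinner :: "'v \<Rightarrow> 'v \<Rightarrow> complex"

definition herm_vector_space :: "'v herm_space \<Rightarrow> bool" where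
  "herm_vector_space V \<longleftrightarrow>
     hzero V \<in> hcarrier V \<and>
     (\<forall>x\<in>hcarrier V. \<forall>y\<in>hcarrier V. hadd V x y \<in> hcarrier V) \<and>
     (\<forall>c. \<forall>x\<in>hcarrier V. hscale V c x \<in> hcarrier V) \<and>
     (\<forall>x\<in>hcarrier V. \<forall>y\<in>hcarrier V. \<forall>z\<in>hcarrier V.
        hadd V (hadd V x y) z = hadd V x (hadd V y z)) \<and>
     (\<forall>x\<in>hcarrier V. \<forall>y\<in>hcarrier V. hadd V x y = hadd V y x) \<and>
     (\<forall>x\<in>hcarrier V. hadd V (hzero V) x = x) \<and>
     (\<forall>x\<in>hcarrier V. \<exists>y\<in>hcarrier V. hadd V x y = hzero V) \<and>
     (\<forall>c. \<forall>x\<in>hcarrier V. \<forall>y\<in>hcarrier V.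
        hscale V c (hadd V x y) = hadd V (hscale V c x) (hscale V c y)) \<and>
     (\<forall>c d. \<forall>x\<in>hcarrier V. hscale V (c + d) x = hadd V (hscale V c x) (hscale V d x)) \<and>
     (\<forall>c d. \<forall>x\<in>hcarrier V. hscale V c (hscale V d x) = hscale V (c * d) x) \<and>
     (\<forall>x\<in>hcarrier V. hscale V 1 x = x) \<and>
     (\<forall>x\<in>hcarrier V. \<forall>y\<in>hcarrier V. hinner V x y = cnj (hinner V y x)) \<and>
     (\<forall>x\<in>hcarrier V. \<forall>y\<in>hcarrier V. \<forall>z\<in>hcarrier V.
        hinner V (hadd V x y) z = hinner V x z + hinner V y z) \<and>
     (\<forall>c. \<forall>x\<in>hcarrier V. \<forall>y\<in>hcarrier V. hinner V (hscale V c x) y = c * hinner V x y) \<and>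
     (\<forall>x\<in>hcarrier V. x \<noteq> hzero V \<longrightarrow> 0 < Re (hinner V x x))"

definition one_dimensional :: "'v herm_space \<Rightarrow> bool" where
  "one_dimensional V \<longleftrightarrow> (\<exists>e\<in>hcarrier V. e \<noteq> hzero V \<and> (\<forall>x\<in>hcarrier V. \<exists>c. x = hscale V c e))"

text \<open>
  A hermitian line bundle: its fibres, and an atlas of local frames \<open>(U, s)\<close> that gives the
  holomorphic or anti-holomorphic structure. The values of \<open>s\<close> off \<open>U\<close> are irrelevant.
\<close>

record ('n, 'v) line_bundle =
  fibre :: "complex^'n \<Rightarrow> 'v herm_space"
  frames :: "((complex^'n) set \<times> (complex^'n \<Rightarrow> 'v)) set"

definition sq_norm :: "('n::finite, 'v) line_bundle \<Rightarrow> (complex^'n \<Rightarrow> 'v) \<Rightarrow> complex^'n \<Rightarrow> real" where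
  "sq_norm E s w = Re (hinner (fibre E w) (s w) (s w))"

definition herm_line_bundle ::
    "((complex^'n::finite) set \<Rightarrow> (complex^'n \<Rightarrow> complex) \<Rightarrow> bool) \<Rightarrow> (complex^'n) set \<Rightarrow>
     ('n, 'v) line_bundle \<Rightarrow> bool" where
  "herm_line_bundle hol \<Omega> E \<longleftrightarrow>
     (\<forall>w\<in>\<Omega>. herm_vector_space (fibre E w) \<and> one_dimensional (fibre E w)) \<and>
     (\<forall>(U, s)\<in>frames E. open U \<and> U \<subseteq> \<Omega> \<and>
        (\<forall>w\<in>U. s w \<in> hcarrier (fibre E w) \<and> s w \<noteq> hzero (fibre E w))) \<and>
     (\<forall>w\<in>\<Omega>. \<exists>(U, s)\<in>frames E. w \<in> U) \<and>
     (\<forall>(U, s)\<in>frames E. \<forall>(V, t)\<in>frames E.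
        \<exists>g. hol (U \<inter> V) g \<and> (\<forall>w\<in>U \<inter> V. s w = hscale (fibre E w) (g w) (t w))) \<and>
     (\<forall>(U, s)\<in>frames E. smooth_on U (sq_norm E s))"

definition herm_hol_line_bundle ::
    "(complex^'n::finite) set \<Rightarrow> ('n, 'v) line_bundle \<Rightarrow> bool" where
  "herm_hol_line_bundle = herm_line_bundle hol_on"

definition herm_antihol_line_bundle ::
    "(complex^'n::finite) set \<Rightarrow> ('n, 'v) line_bundle \<Rightarrow> bool" where
  "herm_antihol_line_bundle = herm_line_bundle antihol_on"

text \<open>
  The inverse of \<open>\<Phi>\<close> is anti-holomorphic automatically, its local coefficient being \<open>1/g\<close>.
\<close>

definition antihol_bundle_equiv ::
    "(complex^'n::finite) set \<Rightarrow> ('n, 'v) line_bundle \<Rightarrow> ('n, 'u) line_bundle \<Rightarrow> bool" where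
  "antihol_bundle_equiv \<Omega> E F \<longleftrightarrow>
     herm_antihol_line_bundle \<Omega> E \<and> herm_antihol_line_bundle \<Omega> F \<and>
     (\<exists>\<Phi>. (\<forall>w\<in>\<Omega>.
          bij_betw (\<Phi> w) (hcarrier (fibre E w)) (hcarrier (fibre F w)) \<and>
          (\<forall>x\<in>hcarrier (fibre E w). \<forall>y\<in>hcarrier (fibre E w).
             \<Phi> w (hadd (fibre E w) x y) = hadd (fibre F w) (\<Phi> w x) (\<Phi> w y)) \<and>
          (\<forall>c. \<forall>x\<in>hcarrier (fibre E w).
             \<Phi> w (hscale (fibre E w) c x) = hscale (fibre F w) c (\<Phi> w x)) \<and>
          (\<forall>x\<in>hcarrier (fibre E w). \<forall>y\<in>hcarrier (fibre E w).
             hinner (fibre F w) (\<Phi> w x) (\<Phi> w y) = hinner (fibre E w) x y)) \<and>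
        (\<forall>(U, s)\<in>frames E. \<forall>(V, t)\<in>frames F. \<exists>g. antihol_on (U \<inter> V) g \<and>
          (\<forall>w\<in>U \<inter> V. \<Phi> w (s w) = hscale (fibre F w) (g w) (t w))))"

text \<open>
  The curvature two-form at \<open>w\<close>, evaluated on the tangent vectors \<open>u\<close>, \<open>v\<close>; the last factor is
  \<open>dw\<^sub>i \<and> d\<close>\<open>w\<^sub>j\<close>-bar. For a (anti-)holomorphic line bundle the value does not depend on the
  chosen frame.
\<close>

definition curvature ::
    "('n::finite, 'v) line_bundle \<Rightarrow> complex^'n \<Rightarrow> complex^'n \<Rightarrow> complex^'n \<Rightarrow> complex" where
  "curvature E w u v = (let s = (SOME s. \<exists>U. (U, s) \<in> frames E \<and> w \<in> U) in
     - (\<Sum>i\<in>UNIV. \<Sum>j\<in>UNIV.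
          wirtinger i (wirtinger_bar j (\<lambda>z. complex_of_real (ln (sq_norm E s z)))) w
          * (u $ i * cnj (v $ j) - v $ i * cnj (u $ j))))"

text \<open>
  Anti-holomorphic subbundles of trivial bundles, with the inherited inner product; frames are all
  the local non-vanishing anti-holomorphic sections.
\<close>

definition sub_space :: "'a::complex_inner set \<Rightarrow> 'a herm_space" where
  "sub_space S = \<lparr>hcarrier = S, hzero = 0, hadd = (+), hscale = (*\<^sub>C), hinner = cinner\<rparr>"

definition antihol_subbundle ::
    "(complex^'n::finite) set \<Rightarrow> (complex^'n \<Rightarrow> 'a::chilbert_space set) \<Rightarrow>
     ('n, 'a) line_bundle" where
  "antihol_subbundle \<Omega> S = \<lparr>fibre = (\<lambda>w. sub_space (S w)),
     frames = {(U, s). open U \<and> U \<subseteq> \<Omega> \<and> antihol_on U s \<and> (\<forall>w\<in>U. s w \<in> S w \<and> s w \<noteq> 0)}\<rparr>"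

definition E_star ::
    "(complex^'n::finite) set \<Rightarrow> ('n, 'a::chilbert_space) hilbert_mod \<Rightarrow> ('n, 'a) line_bundle" where
  "E_star \<Omega> H = antihol_subbundle \<Omega> (joint_ker H)"

text \<open>
  The tensor product of subbundles of \<open>\<Omega> \<times> H\<close> and \<open>\<Omega> \<times> \<complex>\<^sup>q\<close> is a subbundle of
  \<open>\<Omega> \<times> (H \<otimes> \<complex>\<^sup>q)\<close>.
\<close>

definition tensor :: "'a::complex_inner \<Rightarrow> complex^'q::finite \<Rightarrow> 'a^'q" where
  "tensor h v = (\<chi> r. (v $ r) *\<^sub>C h)"

lemma cinner_right: "cinner x (c *\<^sub>C y) = cnj c * cinner (x::'a::complex_inner) y"
  by (metis cinner_commute cinner_scaleC_left complex_cnj_cnj complex_cnj_mult)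

lemma cinner_tensor: "cinner (tensor h v) (tensor k u) = cinner h k * cinner v u"
  by (simp add: tensor_def cinner_vec_def cinner_scaleC_left cinner_right
      cinner_complex_def sum_distrib_left mult_ac)

definition tensor_bundle ::
    "(complex^'n::finite) set \<Rightarrow> ('n, 'a::chilbert_space) line_bundle \<Rightarrow>
     ('n, complex^'q::finite) line_bundle \<Rightarrow> ('n, 'a^'q) line_bundle" where
  "tensor_bundle \<Omega> E F = antihol_subbundle \<Omega> (\<lambda>w. cvec.span
     {tensor h v | h v. h \<in> hcarrier (fibre E w) \<and> v \<in> hcarrier (fibre F w)})"


section \<open>The bundle of cokernels and its dual\<close>

text \<open>
  The quotient of \<open>\<complex>\<^sup>q\<close> by a subspace \<open>R\<close>, as a space of cosets. The quotient norm of a coset is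
  its least norm, and the quotient inner product is that of the elements of least norm.
\<close>

definition coset :: "'a::complex_inner set \<Rightarrow> 'a \<Rightarrow> 'a set" where
  "coset R v = (\<lambda>r. v + r) ` R"

definition least_elem :: "'a::complex_inner set \<Rightarrow> 'a" where
  "least_elem A = (THE a. a \<in> A \<and> (\<forall>b\<in>A. norm a \<le> norm b))"

definition quotient_space :: "(complex^'q::finite) set \<Rightarrow> (complex^'q) set herm_space" where
  "quotient_space R = \<lparr>hcarrier = range (coset R), hzero = R,
     hadd = (\<lambda>A B. {a + b | a b. a \<in> A \<and> b \<in> B}),
     hscale = (\<lambda>c A. {c *\<^sub>C a + r | a r. a \<in> A \<and> r \<in> R}),
     hinner = (\<lambda>A B. cinner (least_elem A) (least_elem B))\<rparr>"

text \<open>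
  The holomorphic structure is that of a quotient bundle: the frames are the images of the
  holomorphic maps into \<open>\<complex>\<^sup>q\<close> that nowhere vanish in the quotient.
\<close>

definition L_Theta ::
    "(complex^'n::finite) set \<Rightarrow> (complex^'n \<Rightarrow> complex^'l::finite^'q::finite) \<Rightarrow>
     ('n, (complex^'q) set) line_bundle" where
  "L_Theta \<Omega> \<Theta> = \<lparr>fibre = (\<lambda>w. quotient_space (range ((*v) (\<Theta> w)))),
     frames = {(U, \<lambda>w. coset (range ((*v) (\<Theta> w))) (s w)) | U s.
       open U \<and> U \<subseteq> \<Omega> \<and> hol_on U s \<and> (\<forall>w\<in>U. s w \<notin> range ((*v) (\<Theta> w)))}\<rparr>"

text \<open>The dual, with \<open>(\<complex>\<^sup>q / ran \<Theta>(w))\<^sup>*\<close> identified with the orthogonal complement of \<open>ran \<Theta>(w)\<close>.\<close>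

definition L_Theta_star ::
    "(complex^'n::finite) set \<Rightarrow> (complex^'n \<Rightarrow> complex^'l::finite^'q::finite) \<Rightarrow>
     ('n, complex^'q) line_bundle" where
  "L_Theta_star \<Omega> \<Theta> = antihol_subbundle \<Omega> (\<lambda>w. orth UNIV (range ((*v) (\<Theta> w))))"

end

theory Submission
  imports Defs "HOL-Complex_Analysis.Cauchy_Integral_Formula"
begin

text \<open>
  By definition the quotient module is the orthogonal complement \<open>N\<close> of the range of \<open>M\<^sub>\<Theta>\<close>. Since
  \<open>M\<^sub>\<Psi> M\<^sub>\<Theta> = 1\<close>, that range is the kernel of the bounded idempotent module map \<open>Q = 1 - M\<^sub>\<Theta> M\<^sub>\<Psi>\<close>,
  and the adjoint \<open>J\<close> of \<open>Q\<close> projects onto \<open>N\<close> and commutes with the adjoints of the coordinate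
  multiplications. On \<open>N\<close> the adjoint of the compressed action is the restricted adjoint action, so
  applying \<open>J\<close> transfers from \<open>H \<otimes> \<complex>\<^sup>q\<close> to \<open>N\<close> both the closedness of the ranges of the column
  operators and the density of the joint eigenvectors (\<open>closed_spanning_quotient\<close>). The joint
  eigenspace of \<open>N\<close> at \<open>w\<close> consists of the joint eigenvectors \<open>k \<otimes> v\<close> of \<open>H \<otimes> \<complex>\<^sup>q\<close> that lie in
  \<open>N\<close>, which means that \<open>v\<close> is orthogonal to the range of \<open>\<Theta>(w)\<close> (\<open>joint_ker_H_Theta\<close>). As \<open>\<Theta>(w)\<close>
  is left invertible of corank one, such \<open>v\<close> form a line (\<open>orth_range_line\<close>). Hence the
  eigenspaces of the quotient module are one-dimensional and are equal, as subspaces of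
  \<open>H \<otimes> \<complex>\<^sup>q\<close>, to the fibres of the tensor product bundle.

  The analytic part is to make these families of lines into bundles. A local section of the joint
  eigenspaces of \<open>H\<close> is antiholomorphic because the column operator at a point is bounded below off
  its kernel (\<open>closed_range_bounded_below\<close>, an open mapping theorem); the derivative of the section is
  found by solving a linear equation, whose right hand side lies in the range because the range is
  closed (\<open>eigenvector_antihol_at\<close>). It follows that multipliers are holomorphic, and the idempotents
  \<open>1 - \<Psi>\<^sup>* \<Theta>\<^sup>*\<close> provide antiholomorphic sections of the complements of the ranges of \<open>\<Theta>(w)\<close>.
  That all frames have smooth norms is the regularity of antiholomorphic maps into Hilbert spaces,
  a consequence of Cauchy's formula (\<open>antihol_on_directional_derivative\<close>).

  For the curvature, a frame of the quotient module is \<open>g\<close> times the tensor product of frames of the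
  two factors with \<open>g\<close> antiholomorphic, so the logarithms of the squared norms are additive up to
  \<open>log |g|\<^sup>2\<close>, which the mixed derivatives annihilate (\<open>curvature_tensor\<close>).
\<close>

section \<open>Complex inner products\<close>

lemma cinner_add_right: "cinner x (y + z) = cinner x y + cinner x (z::'a::complex_inner)"
  by (metis cinner_add_left cinner_commute complex_cnj_add)

lemma cinner_zero_left [simp]: "cinner 0 (x::'a::complex_inner) = 0"
  using cinner_add_left[of 0 0 x] by simp

lemma cinner_zero_right [simp]: "cinner (x::'a::complex_inner) 0 = 0"
  using cinner_add_right[of x 0 0] by simp

lemma cinner_diff_left: "cinner (x - y) z = cinner x z - cinner y (z::'a::complex_inner)"
  using cinner_add_left[of "x - y" y z] by simp

lemma cinner_diff_right: "cinner x (y - z) = cinner x y - cinner x (z::'a::complex_inner)"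
  using cinner_add_right[of x "y - z" z] by simp

lemma cinner_sum_left: "cinner (\<Sum>i\<in>I. f i) (z::'a::complex_inner) = (\<Sum>i\<in>I. cinner (f i) z)"
  by (induction I rule: infinite_finite_induct) (auto simp: cinner_add_left)

lemma cinner_sum_right: "cinner (z::'a::complex_inner) (\<Sum>i\<in>I. f i) = (\<Sum>i\<in>I. cinner z (f i))"
  by (induction I rule: infinite_finite_induct) (auto simp: cinner_add_right)

lemma cinner_self: "cinner x x = complex_of_real ((norm (x::'a::complex_inner))\<^sup>2)"
proof -
  have "Im (cinner x x) = 0"
    using cinner_commute[of x x] by (metis cnj.simps(2) equal_neg_zero)
  then show ?thesis
    by (simp add: complex_eq_iff power2_norm_eq_inner inner_eq_Re_cinner)
qed

lemma cinner_self_eq_0 [simp]: "cinner x x = 0 \<longleftrightarrow> x = (0::'a::complex_inner)"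
  by (simp add: cinner_self)

lemma cinner_eq_0_sym: "cinner x y = 0 \<longleftrightarrow> cinner y (x::'a::complex_inner) = 0"
  by (metis cinner_commute complex_cnj_zero_iff)

lemma norm_scaleC: "norm (c *\<^sub>C x) = cmod c * norm (x::'a::complex_inner)"
proof -
  have "cinner (c *\<^sub>C x) (c *\<^sub>C x) = complex_of_real ((cmod c * norm x)\<^sup>2)"
    by (simp only: cinner_scaleC_left cinner_right cinner_self[of x])
      (simp add: power_mult_distrib complex_norm_square del: of_real_power)
  then have "(norm (c *\<^sub>C x))\<^sup>2 = (cmod c * norm x)\<^sup>2"
    unfolding cinner_self of_real_eq_iff .
  then show ?thesis by (simp add: power2_eq_iff_nonneg)
qed

lemma scaleC_eq_0 [simp]: "c *\<^sub>C x = 0 \<longleftrightarrow> c = 0 \<or> x = (0::'a::complex_inner)"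
  by (metis mult_eq_0_iff norm_eq_zero norm_scaleC)

text \<open>
  Rotating the first argument by a phase makes the complex inner product real, so the bound
  follows from the real inequality.
\<close>

lemma Cauchy_Schwarz_cinner: "cmod (cinner x y) \<le> norm x * norm (y::'a::complex_inner)"
proof (cases "cinner x y = 0")
  case False
  define c where "c = cnj (sgn (cinner x y))"
  have c: "cmod c = 1" using False by (simp add: c_def norm_sgn)
  have "c * cinner x y = complex_of_real (cmod (cinner x y))"
    using False complex_norm_square[of "cinner x y"]
    by (simp add: c_def sgn_eq field_simps power2_eq_square)
  then have "cmod (cinner x y) = inner (c *\<^sub>C x) y"
    by (simp add: inner_eq_Re_cinner cinner_scaleC_left)
  also have "\<dots> \<le> norm (c *\<^sub>C x) * norm y" by (rule norm_cauchy_schwarz)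
  finally show ?thesis by (simp add: norm_scaleC c)
qed simp

lemma bounded_bilinear_scaleC: "bounded_bilinear ((*\<^sub>C) :: complex \<Rightarrow> 'a \<Rightarrow> 'a::complex_inner)"
proof
  fix a a' :: complex and b b' :: 'a and r :: real
  show "(a + a') *\<^sub>C b = a *\<^sub>C b + a' *\<^sub>C b" by (rule scaleC_add_left)
  show "a *\<^sub>C (b + b') = a *\<^sub>C b + a *\<^sub>C b'" by (rule scaleC_add_right)
  show "(r *\<^sub>R a) *\<^sub>C b = r *\<^sub>R a *\<^sub>C b"
    by (simp add: scaleR_scaleC[of r "a *\<^sub>C b"] scaleC_scaleC scaleR_conv_of_real)
  show "a *\<^sub>C r *\<^sub>R b = r *\<^sub>R a *\<^sub>C b"
    by (simp add: scaleR_scaleC scaleC_scaleC mult.commute)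
  show "\<exists>K. \<forall>a b. norm (a *\<^sub>C b :: 'a) \<le> norm a * norm b * K"
    by (rule exI[of _ 1]) (simp add: norm_scaleC)
qed

lemma bounded_bilinear_cinner: "bounded_bilinear (cinner :: 'a::complex_inner \<Rightarrow> 'a \<Rightarrow> complex)"
proof
  fix a a' b b' :: 'a and r :: real
  show "cinner (a + a') b = cinner a b + cinner a' b" by (rule cinner_add_left)
  show "cinner a (b + b') = cinner a b + cinner a b'" by (rule cinner_add_right)
  show "cinner (r *\<^sub>R a) b = r *\<^sub>R cinner a b"
    by (simp add: scaleR_scaleC cinner_scaleC_left scaleC_complex_def)
  show "cinner a (r *\<^sub>R b) = r *\<^sub>R cinner a b"
    by (simp add: scaleR_scaleC cinner_right scaleC_complex_def)
  show "\<exists>K. \<forall>a b. norm (cinner (a::'a) b) \<le> norm a * norm b * K"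
    by (rule exI[of _ 1]) (simp add: Cauchy_Schwarz_cinner)
qed

lemmas continuous_on_cinner [continuous_intros] =
  bounded_bilinear.continuous_on[OF bounded_bilinear_cinner]
lemmas continuous_on_scaleC [continuous_intros] =
  bounded_bilinear.continuous_on[OF bounded_bilinear_scaleC]

lemma csubspace_orth: "cvec.subspace S \<Longrightarrow> cvec.subspace (orth S A)"
  by (auto simp: orth_def cvec.subspace_def cinner_add_left cinner_scaleC_left)

lemma closed_orth: "closed S \<Longrightarrow> closed (orth S A)"
proof -
  assume "closed S"
  have "orth S A = S \<inter> (\<Inter>a\<in>A. {x. cinner x a = 0})" by (auto simp: orth_def)
  moreover have "closed {x. cinner x a = 0}" for a :: 'a
    by (intro closed_Collect_eq continuous_intros)
  ultimately show ?thesis using \<open>closed S\<close> by (simp add: closed_Int closed_INT)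
qed

lemma csubspace_closure:
  assumes "cvec.subspace (S :: 'a::complex_inner set)" shows "cvec.subspace (closure S)"
  unfolding cvec.subspace_def
proof (intro conjI ballI allI)
  show "0 \<in> closure S" using assms closure_subset cvec.subspace_0 by blast
next
  fix x y assume "x \<in> closure S" "y \<in> closure S"
  then obtain f g where f: "\<forall>n. f n \<in> S" "f \<longlonglongrightarrow> x" and g: "\<forall>n. g n \<in> S" "g \<longlonglongrightarrow> y"
    unfolding closure_sequential by blast
  have "(\<lambda>n. f n + g n) \<longlonglongrightarrow> x + y" using f g by (intro tendsto_intros)
  moreover have "f n + g n \<in> S" for n using assms f g cvec.subspace_add by blast
  ultimately show "x + y \<in> closure S"
    unfolding closure_sequential by (intro exI[of _ "\<lambda>n. f n + g n"]) simp
next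
  fix c and x assume "x \<in> closure S"
  then obtain f where f: "\<forall>n. f n \<in> S" "f \<longlonglongrightarrow> x"
    unfolding closure_sequential by blast
  have "(\<lambda>n. c *\<^sub>C f n) \<longlonglongrightarrow> c *\<^sub>C x" 
    using f by (intro bounded_bilinear.tendsto[OF bounded_bilinear_scaleC] tendsto_intros)
  moreover have "c *\<^sub>C f n \<in> S" for n using assms f cvec.subspace_scale by blast
  ultimately show "c *\<^sub>C x \<in> closure S"
    unfolding closure_sequential by (intro exI[of _ "\<lambda>n. c *\<^sub>C f n"]) simp
qed

section \<open>Projections, the Riesz representation and adjoints on a closed subspace\<close>

text \<open>
  A minimising sequence for the distance to the subspace is Cauchy by the parallelogram law,
  because midpoints of its members stay in the subspace.
\<close>

lemma nearest_point_exists: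
  fixes S :: "'a::chilbert_space set"
  assumes S: "cvec.subspace S" "closed S"
  shows "\<exists>y\<in>S. \<forall>z\<in>S. norm (x - y) \<le> norm (x - z)"
proof -
  have S0: "0 \<in> S" using S(1) cvec.subspace_0 by blast
  define d where "d = (INF z\<in>S. norm (x - z))"
  have bdd: "bdd_below ((\<lambda>z. norm (x - z)) ` S)" by (rule bdd_belowI[of _ 0]) auto
  have d_le: "d \<le> norm (x - z)" if "z \<in> S" for z
    unfolding d_def using bdd that by (rule cINF_lower)
  have d0: "0 \<le> d" unfolding d_def using S0 by (intro cINF_greatest) auto
  have "\<exists>y\<in>S. norm (x - y) < d + 1 / Suc n" for n
  proof -
    have "d < d + 1 / Suc n" by simp
    then show ?thesis unfolding d_def using cINF_less_iff[OF _ bdd] S0 by (metis empty_iff)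
  qed
  then obtain y where y: "\<And>n. y n \<in> S" "\<And>n. norm (x - y n) < d + 1 / Suc n" by metis
  have lim: "(\<lambda>n. norm (x - y n)) \<longlonglongrightarrow> d"
  proof (rule tendsto_sandwich)
    show "\<forall>\<^sub>F n in sequentially. d \<le> norm (x - y n)" using d_le y by auto
    show "\<forall>\<^sub>F n in sequentially. norm (x - y n) \<le> d + 1 / Suc n"
      using y(2) by (intro always_eventually allI less_imp_le)
    have "(\<lambda>n. d + 1 / Suc n) \<longlonglongrightarrow> d + 0" by (intro tendsto_intros lim_1_over_n[THEN LIMSEQ_Suc])
    then show "(\<lambda>n. d + 1 / Suc n) \<longlonglongrightarrow> d" by simp
  qed auto
  have par: "(norm (y m - y n))\<^sup>2 \<le> 2 * (norm (x - y m))\<^sup>2 + 2 * (norm (x - y n))\<^sup>2 - 4 * d\<^sup>2" for m n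
  proof -
    have mid: "(1/2) *\<^sub>R (y m + y n) \<in> S"
      using S(1) y(1) by (metis cvec.subspace_add cvec.subspace_scale scaleR_scaleC)
    have "(x - y m) + (x - y n) = 2 *\<^sub>R (x - (1/2) *\<^sub>R (y m + y n))"
      by (simp add: algebra_simps scaleR_2)
    then have "2 * d \<le> norm ((x - y m) + (x - y n))" using d_le[OF mid] by simp
    then have "(2 * d)\<^sup>2 \<le> (norm ((x - y m) + (x - y n)))\<^sup>2"
      using d0 by (intro power_mono) auto
    moreover have "(norm ((x - y m) + (x - y n)))\<^sup>2 + (norm ((x - y n) - (x - y m)))\<^sup>2
        = 2 * (norm (x - y m))\<^sup>2 + 2 * (norm (x - y n))\<^sup>2"
      by (simp add: power2_norm_eq_inner algebra_simps inner_commute)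
    ultimately show ?thesis by (simp add: power_mult_distrib)
  qed
  have "Cauchy y"
    unfolding Cauchy_def
  proof (intro allI impI)
    fix e :: real assume e: "0 < e"
    have "(\<lambda>n. (norm (x - y n))\<^sup>2) \<longlonglongrightarrow> d\<^sup>2" using lim by (intro tendsto_intros)
    then obtain N where N: "\<And>n. n \<ge> N \<Longrightarrow> \<bar>(norm (x - y n))\<^sup>2 - d\<^sup>2\<bar> < e\<^sup>2 / 4"
      using e LIMSEQ_D[of _ "d\<^sup>2" "e\<^sup>2 / 4"] by (metis real_norm_def zero_less_divide_iff zero_less_numeral zero_less_power)
    have "dist (y m) (y n) < e" if "m \<ge> N" "n \<ge> N" for m n
    proof -
      have "(norm (y m - y n))\<^sup>2 < e\<^sup>2" using par[of m n] N[OF that(1)] N[OF that(2)] by linarith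
      then show ?thesis using e by (simp add: dist_norm power_less_imp_less_base)
    qed
    then show "\<exists>M. \<forall>m\<ge>M. \<forall>n\<ge>M. dist (y m) (y n) < e" by blast
  qed
  then obtain z where z: "y \<longlonglongrightarrow> z" using Cauchy_convergent convergent_def by blast
  then have "z \<in> S" using S(2) y(1) closed_sequentially by blast
  moreover have "norm (x - z) = d"
    using z lim by (intro LIMSEQ_unique[of "\<lambda>n. norm (x - y n)"] tendsto_intros)
  ultimately show ?thesis using d_le by metis
qed

text \<open>
  Otherwise moving from \<open>y\<close> to the orthogonal projection of \<open>x\<close> on the complex line \<open>y + \<complex> z\<close> would
  reduce the distance.
\<close>

lemma nearest_point_orthogonal:
  fixes S :: "'a::complex_inner set"
  assumes S: "cvec.subspace S" and y: "y \<in> S" and min: "\<And>z. z \<in> S \<Longrightarrow> norm (x - y) \<le> norm (x - z)"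
    and z: "z \<in> S"
  shows "cinner (x - y) z = 0"
proof (cases "z = 0")
  case False
  define c where "c = cinner (x - y) z / cinner z z"
  have zz: "cinner z z \<noteq> 0" using False by simp
  have orth: "cinner (x - y - c *\<^sub>C z) (c *\<^sub>C z) = 0"
    using zz by (simp add: cinner_diff_left cinner_right cinner_scaleC_left c_def)
  have "x - y = (x - y - c *\<^sub>C z) + c *\<^sub>C z" by simp
  then have "(norm (x - y))\<^sup>2 = (norm (x - y - c *\<^sub>C z))\<^sup>2 + (norm (c *\<^sub>C z))\<^sup>2"
    using orth norm_add_Pythagorean[of "x - y - c *\<^sub>C z" "c *\<^sub>C z"]
    by (simp add: orthogonal_def inner_eq_Re_cinner)
  moreover have "norm (x - y) \<le> norm (x - (y + c *\<^sub>C z))"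
    using S y z by (intro min cvec.subspace_add cvec.subspace_scale)
  then have "(norm (x - y))\<^sup>2 \<le> (norm (x - y - c *\<^sub>C z))\<^sup>2" by (simp add: diff_diff_eq power_mono)
  ultimately have "c *\<^sub>C z = 0" by simp
  then show ?thesis using False by (simp add: c_def)
qed simp

lemma projection_exists:
  fixes S :: "'a::chilbert_space set"
  assumes "cvec.subspace S" "closed S"
  shows "\<exists>y\<in>S. \<forall>z\<in>S. cinner (x - y) z = 0"
  using nearest_point_exists[OF assms, of x] nearest_point_orthogonal[OF assms(1)] by metis

lemma projection_unique:
  fixes S :: "'a::complex_inner set"
  assumes "cvec.subspace S" "y \<in> S" "\<forall>z\<in>S. cinner (x - y) z = 0" "y' \<in> S" "\<forall>z\<in>S. cinner (x - y') z = 0"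
  shows "y = y'"
proof -
  have "y - y' \<in> S" using assms cvec.subspace_diff by blast
  then have "cinner (x - y' - (x - y)) (y - y') = 0" using assms by (simp add: cinner_diff_left)
  then show ?thesis by simp
qed

lemma proj_on_eqI:
  fixes S :: "'a::complex_inner set"
  assumes "cvec.subspace S" "y \<in> S" "\<And>z. z \<in> S \<Longrightarrow> cinner (x - y) z = 0"
  shows "proj_on S x = y"
  unfolding proj_on_def using assms projection_unique[OF assms(1)] by (intro the_equality) blast+

lemma proj_on:
  fixes S :: "'a::chilbert_space set"
  assumes "cvec.subspace S" "closed S"
  shows "proj_on S x \<in> S" and "z \<in> S \<Longrightarrow> cinner (proj_on S x) z = cinner x z"
proof -
  obtain y where y: "y \<in> S" "\<forall>z\<in>S. cinner (x - y) z = 0" using projection_exists[OF assms] by blast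
  then have "proj_on S x = y" using assms by (intro proj_on_eqI) auto
  then show "proj_on S x \<in> S" "z \<in> S \<Longrightarrow> cinner (proj_on S x) z = cinner x z"
    using y by (auto simp: cinner_diff_left)
qed

text \<open>
  The residual of a projection is orthogonal to the subspace. Together with \<open>closure_span_eq_iff\<close> this
  turns statements about dense spans into statements about orthogonality.
\<close>

lemma closed_subspace_eqI:
  fixes S :: "'a::chilbert_space set"
  assumes S: "cvec.subspace S" "closed S" and T: "cvec.subspace T" "S \<subseteq> T"
    and orth: "\<And>x. x \<in> T \<Longrightarrow> (\<And>z. z \<in> S \<Longrightarrow> cinner x z = 0) \<Longrightarrow> x = 0"
  shows "S = T"
proof
  show "T \<subseteq> S"
  proof
    fix x assume x: "x \<in> T"
    have "x - proj_on S x = 0"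
    proof (rule orth)
      show "x - proj_on S x \<in> T" using proj_on[OF S] T x by (metis cvec.subspace_diff subsetD)
      show "cinner (x - proj_on S x) z = 0" if "z \<in> S" for z
        using proj_on(2)[OF S that] by (simp add: cinner_diff_left)
    qed
    then show "x \<in> S" using proj_on(1)[OF S, of x] by simp
  qed
qed (rule T)

text \<open>
  The representing vector is found on the line orthogonal to the kernel of the functional.
\<close>

lemma Riesz_representation:
  fixes S :: "'a::chilbert_space set"
  assumes S: "cvec.subspace S" "closed S"
    and add: "\<And>x y. x \<in> S \<Longrightarrow> y \<in> S \<Longrightarrow> \<phi> (x + y) = \<phi> x + \<phi> y"
    and scale: "\<And>c x. x \<in> S \<Longrightarrow> \<phi> (c *\<^sub>C x) = c * \<phi> x"
    and bound: "\<And>x. x \<in> S \<Longrightarrow> cmod (\<phi> x) \<le> K * norm x"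
  shows "\<exists>z\<in>S. \<forall>x\<in>S. \<phi> x = cinner x z"
proof (cases "\<forall>x\<in>S. \<phi> x = 0")
  case True
  then show ?thesis using S cvec.subspace_0 by (intro bexI[of _ 0]) auto
next
  case False
  then obtain x0 where x0: "x0 \<in> S" "\<phi> x0 \<noteq> 0" by blast
  define N where "N = {x\<in>S. \<phi> x = 0}"
  have diff: "\<phi> (x - y) = \<phi> x - \<phi> y" if "x \<in> S" "y \<in> S" for x y
    using add[of "x - y" y] that S cvec.subspace_diff by fastforce
  have subN: "cvec.subspace N"
    using S(1) add scale scale[of 0 0] by (auto simp: N_def cvec.subspace_def)
  have clN: "closed N"
    unfolding closed_sequential_limits
  proof safe
    fix f l assume f: "\<forall>n. f n \<in> N" "f \<longlonglongrightarrow> l"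
    have l: "l \<in> S" using f S(2) closed_sequentially[of S f l] by (auto simp: N_def)
    have "(\<lambda>n. K * norm (f n - l)) \<longlonglongrightarrow> K * norm (l - l)" using f by (intro tendsto_intros)
    moreover have "cmod (\<phi> l) \<le> K * norm (f n - l)" for n
      using bound[of "l - f n"] diff[of l "f n"] f l S cvec.subspace_diff
      by (metis (mono_tags, lifting) N_def diff_zero mem_Collect_eq norm_minus_commute)
    ultimately have "cmod (\<phi> l) \<le> 0" by (intro LIMSEQ_le_const[of "\<lambda>n. K * norm (f n - l)"]) auto
    then show "l \<in> N" using l by (simp add: N_def)
  qed
  define u where "u = x0 - proj_on N x0"
  have pN: "proj_on N x0 \<in> S" "\<phi> (proj_on N x0) = 0"
    using proj_on(1)[OF subN clN, of x0] by (auto simp: N_def)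
  have u: "u \<in> S" "\<phi> u \<noteq> 0" using x0 pN S diff cvec.subspace_diff by (auto simp: u_def)
  have uN: "cinner x u = 0" if "x \<in> N" for x
    using proj_on(2)[OF subN clN that, of x0] cinner_eq_0_sym[of x u]
    by (simp add: u_def cinner_diff_left)
  have u0: "u \<noteq> 0" using u(2) scale[of 0 0] S cvec.subspace_0 by fastforce
  define z where "z = (cnj (\<phi> u) / cinner u u) *\<^sub>C u"
  have "\<phi> x = cinner x z" if x: "x \<in> S" for x
  proof -
    have cu: "(\<phi> x / \<phi> u) *\<^sub>C u \<in> S" using u S cvec.subspace_scale by blast
    then have "x - (\<phi> x / \<phi> u) *\<^sub>C u \<in> N"
      using x u diff scale S cvec.subspace_diff by (auto simp: N_def)
    then have "cinner x u = \<phi> x / \<phi> u * cinner u u"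
      using uN by (fastforce simp: cinner_diff_left cinner_scaleC_left)
    moreover have "cnj (cinner u u) = cinner u u" by (metis cinner_commute)
    ultimately show ?thesis using u u0 by (simp add: z_def cinner_right)
  qed
  moreover have "z \<in> S" using u S cvec.subspace_scale by (simp add: z_def)
  ultimately show ?thesis by blast
qed

lemma adjoint_on_eqI:
  fixes S :: "'a::complex_inner set"
  assumes "cvec.subspace S" "z \<in> S" "\<And>x. x \<in> S \<Longrightarrow> cinner (T x) y = cinner x z"
  shows "adjoint_on S T y = z"
  unfolding adjoint_on_def
proof (rule the_equality)
  fix z' assume z': "z' \<in> S \<and> (\<forall>x\<in>S. cinner (T x) y = cinner x z')"
  then have "z' - z \<in> S" using assms cvec.subspace_diff by blast
  then have "cinner (z' - z) (z' - z) = 0"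
    using z' assms(3) by (simp add: cinner_diff_right)
  then show "z' = z" by simp
qed (use assms in auto)

lemma adjoint_on:
  fixes S :: "'a::chilbert_space set"
  assumes "cvec.subspace S" "closed S" "bounded_op_on S T"
  shows "adjoint_on S T y \<in> S" and "x \<in> S \<Longrightarrow> cinner (T x) y = cinner x (adjoint_on S T y)"
proof -
  obtain K where K: "\<And>x. x \<in> S \<Longrightarrow> norm (T x) \<le> K * norm x"
    using assms(3) unfolding bounded_op_on_def by blast
  have "\<exists>z\<in>S. \<forall>x\<in>S. cinner (T x) y = cinner x z"
  proof (rule Riesz_representation[OF assms(1,2), where K = "K * norm y"])
    show "cmod (cinner (T x) y) \<le> K * norm y * norm x" if "x \<in> S" for x
      using Cauchy_Schwarz_cinner[of "T x" y] mult_right_mono[OF K[OF that] norm_ge_zero[of y]]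
      by (simp add: mult_ac)
  qed (use assms(3) in \<open>auto simp: bounded_op_on_def cinner_add_left cinner_scaleC_left\<close>)
  then obtain z where z: "z \<in> S" "\<forall>x\<in>S. cinner (T x) y = cinner x z" by blast
  then have "adjoint_on S T y = z" using assms by (intro adjoint_on_eqI) auto
  then show "adjoint_on S T y \<in> S" "x \<in> S \<Longrightarrow> cinner (T x) y = cinner x (adjoint_on S T y)"
    using z by auto
qed

lemma bounded_op_on_adjoint:
  fixes S :: "'a::chilbert_space set"
  assumes S: "cvec.subspace S" "closed S" and T: "bounded_op_on S T"
  shows "bounded_op_on S (adjoint_on S T)"
proof -
  note adj = adjoint_on[OF S T]
  obtain K where K: "\<And>x. x \<in> S \<Longrightarrow> norm (T x) \<le> K * norm x"
    using T unfolding bounded_op_on_def by blast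
  have add: "adjoint_on S T (x + y) = adjoint_on S T x + adjoint_on S T y" for x y
    using adj S by (intro adjoint_on_eqI) (auto simp: cinner_add_right cvec.subspace_add)
  have scale: "adjoint_on S T (c *\<^sub>C x) = c *\<^sub>C adjoint_on S T x" for c x
    using adj S by (intro adjoint_on_eqI) (auto simp: cinner_right cvec.subspace_scale)
  have bound: "norm (adjoint_on S T y) \<le> K * norm y" if y: "y \<in> S" for y
  proof (cases "adjoint_on S T y = 0")
    case True
    have "0 \<le> K * norm y"
      using K[OF y] norm_ge_zero order_trans by blast
    then show ?thesis using True by simp
  next
    case False
    let ?z = "adjoint_on S T y"
    have "(norm ?z)\<^sup>2 = cmod (cinner ?z ?z)" by (simp add: cinner_self norm_power)
    also have "\<dots> = cmod (cinner (T ?z) y)" using adj(2)[OF adj(1)] by simp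
    also have "\<dots> \<le> norm (T ?z) * norm y" by (rule Cauchy_Schwarz_cinner)
    also have "\<dots> \<le> (K * norm ?z) * norm y" by (intro mult_right_mono K adj) simp
    finally have "norm ?z * norm ?z \<le> (K * norm y) * norm ?z" by (simp add: power2_eq_square mult_ac)
    then show ?thesis using False by (subst (asm) mult_le_cancel_right) auto
  qed
  show ?thesis unfolding bounded_op_on_def using adj add scale bound by blast
qed

section \<open>Operators with closed range\<close>

text \<open>
  The uniform boundedness principle for vectors, by a gliding hump: if the set were unbounded,
  steps of length \<open>3\<^sup>-\<^sup>n\<close> along ever larger of its members, each with the sign that does not
  cancel, lead to a limit whose pairings with these members are unbounded.
\<close>

lemma weakly_bounded_imp_bounded:
  fixes R :: "'a::chilbert_space set"
  assumes R: "cvec.subspace R" "closed R" and Z: "Z \<subseteq> R"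
    and weak: "\<And>y. y \<in> R \<Longrightarrow> \<exists>M. \<forall>z\<in>Z. cmod (cinner y z) \<le> M"
  shows "\<exists>C. \<forall>z\<in>Z. norm z \<le> C"
proof (rule ccontr)
  assume "\<nexists>C. \<forall>z\<in>Z. norm z \<le> C"
  then have "\<exists>z\<in>Z. 2 * real n * 3 ^ n + 1 < norm z" for n by (meson not_le)
  then obtain z where z: "\<And>n. z n \<in> Z" "\<And>n. 2 * real n * 3 ^ n + 1 < norm (z n)" by metis
  have "\<exists>x. \<forall>n. x n \<in> R \<and> norm (x (Suc n) - x n) \<le> (1/3)^n \<and>
      (1/3)^n * norm (z n) \<le> cmod (cinner (x (Suc n)) (z n))"
  proof (rule dependent_nat_choice)
    show "\<exists>x. x \<in> R" using R cvec.subspace_0 by blast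
  next
    fix x :: 'a and n :: nat assume x: "x \<in> R"
    have zn: "norm (z n) > 0" using z(2)[of n] by (smt (verit) of_nat_0_le_iff zero_le_mult_iff zero_le_power)
    define u where "u = ((1/3)^n / norm (z n)) *\<^sub>R z n"
    have uR: "u \<in> R" using z(1) Z R by (auto simp: u_def scaleR_scaleC intro!: cvec.subspace_scale)
    have nu: "norm u = (1/3)^n" using zn by (simp add: u_def power_divide)
    have "cinner u (z n) = complex_of_real ((1/3)^n * norm (z n))"
      using zn by (simp add: u_def scaleR_scaleC cinner_scaleC_left cinner_self power2_eq_square)
    then have cu: "cmod (cinner u (z n)) = (1/3)^n * norm (z n)"
      by (simp only: norm_of_real) simp
    have "2 * cmod (cinner u (z n)) = cmod (cinner (x + u) (z n) - cinner (x - u) (z n))"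
      by (simp add: cinner_add_left cinner_diff_left norm_mult flip: mult_2)
    also have "\<dots> \<le> cmod (cinner (x + u) (z n)) + cmod (cinner (x - u) (z n))"
      by (rule norm_triangle_ineq4)
    finally have "cmod (cinner u (z n)) \<le> cmod (cinner (x + u) (z n)) \<or>
        cmod (cinner u (z n)) \<le> cmod (cinner (x - u) (z n))" by linarith
    then show "\<exists>y. y \<in> R \<and> norm (y - x) \<le> (1/3)^n \<and> (1/3)^n * norm (z n) \<le> cmod (cinner y (z n))"
    proof
      assume "cmod (cinner u (z n)) \<le> cmod (cinner (x + u) (z n))"
      then show ?thesis using x uR R nu cu by (intro exI[of _ "x + u"]) (auto intro: cvec.subspace_add)
    next
      assume "cmod (cinner u (z n)) \<le> cmod (cinner (x - u) (z n))"
      then show ?thesis using x uR R nu cu by (intro exI[of _ "x - u"]) (auto intro: cvec.subspace_diff)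
    qed
  qed
  then obtain x where x: "\<And>n. x n \<in> R" "\<And>n. norm (x (Suc n) - x n) \<le> (1/3)^n"
    "\<And>n. (1/3)^n * norm (z n) \<le> cmod (cinner (x (Suc n)) (z n))" by blast
  have tail: "norm (x m - x n) \<le> 3/2 * ((1/3)^n - (1/3)^m)" if "n \<le> m" for m n
    using that
  proof (induction m rule: dec_induct)
    case (step m)
    have "norm (x (Suc m) - x n) \<le> norm (x (Suc m) - x m) + norm (x m - x n)"
      using norm_triangle_ineq[of "x (Suc m) - x m" "x m - x n"] by simp
    then show ?case using step x(2)[of m] by simp
  qed simp
  have tail': "norm (x m - x n) \<le> 3/2 * (1/3)^n" if "n \<le> m" for m n
  proof -
    have "(0::real) \<le> (1/3)^m" by simp
    then show ?thesis using tail[OF that] by argo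
  qed
  have "Cauchy x"
    unfolding Cauchy_altdef2
  proof (intro allI impI)
    fix e :: real assume "0 < e"
    then obtain N where N: "(1/3::real)^N < e / (3/2)"
      using real_arch_pow_inv[of "e / (3/2)" "1/3"] by auto
    have "dist (x n) (x N) < e" if "n \<ge> N" for n
      using tail'[OF that] N by (simp add: dist_norm)
    then show "\<exists>N. \<forall>n\<ge>N. dist (x n) (x N) < e" by blast
  qed
  then obtain l where l: "x \<longlonglongrightarrow> l" using Cauchy_convergent convergent_def by blast
  then have lR: "l \<in> R" using R(2) x(1) closed_sequentially by blast
  have near: "norm (l - x n) \<le> 3/2 * (1/3)^n" for n
    by (rule LIMSEQ_le_const2[of "\<lambda>m. norm (x m - x n)"])
      (use l tail' in \<open>auto intro!: tendsto_intros\<close>)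
  obtain M where M: "\<forall>z\<in>Z. cmod (cinner l z) \<le> M" using weak[OF lR] by blast
  obtain n where n: "M < real n" using reals_Archimedean2 by blast
  have "cmod (cinner (l - x (Suc n)) (z n)) \<le> norm (l - x (Suc n)) * norm (z n)"
    by (rule Cauchy_Schwarz_cinner)
  also have "\<dots> \<le> (3/2 * (1/3)^(Suc n)) * norm (z n)" by (intro mult_right_mono near) simp
  finally have "cmod (cinner (l - x (Suc n)) (z n)) \<le> (1/3)^n * norm (z n) / 2" by simp
  moreover have "cmod (cinner (x (Suc n)) (z n)) \<le> cmod (cinner l (z n)) + cmod (cinner (l - x (Suc n)) (z n))"
    using norm_triangle_ineq4[of "cinner l (z n)" "cinner (l - x (Suc n)) (z n)"]
    by (simp add: cinner_diff_left)
  ultimately have "(1/3)^n * norm (z n) / 2 \<le> cmod (cinner l (z n))" using x(3)[of n] by linarith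
  moreover have "(1/3)^n * (2 * real n * 3^n) \<le> (1/3)^n * norm (z n)"
    using z(2)[of n] by (intro mult_left_mono) auto
  then have "real n \<le> (1/3)^n * norm (z n) / 2" by (simp add: power_divide)
  ultimately show False using M z(1)[of n] n by (smt (verit))
qed

text \<open>
  A form of the open mapping theorem. By uniform boundedness the adjoint \<open>A\<close> is bounded below on
  the range \<open>R\<close> of \<open>T\<close>, because the vectors of \<open>R\<close> that \<open>A\<close> maps into the unit ball pair
  boundedly with every element of \<open>R\<close>. The estimate passes to \<open>T\<close> on the image of \<open>A\<close>, which is
  dense in the complement of the kernel.
\<close>

lemma closed_range_bounded_below:
  fixes T :: "'a::chilbert_space \<Rightarrow> 'b::chilbert_space"
  assumes S: "cvec.subspace S" "closed S"
    and T_add: "\<And>x y. x \<in> S \<Longrightarrow> y \<in> S \<Longrightarrow> T (x + y) = T x + T y"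
    and T_scale: "\<And>c x. x \<in> S \<Longrightarrow> T (c *\<^sub>C x) = c *\<^sub>C T x"
    and T_bound: "\<And>x. x \<in> S \<Longrightarrow> norm (T x) \<le> K * norm x"
    and closed: "closed (T ` S)"
    and A_in: "\<And>z. z \<in> T ` S \<Longrightarrow> A z \<in> S"
    and A_adj: "\<And>z h. z \<in> T ` S \<Longrightarrow> h \<in> S \<Longrightarrow> cinner (T h) z = cinner h (A z)"
  obtains C where "C > 0"
    and "\<And>h. h \<in> S \<Longrightarrow> (\<And>k. k \<in> S \<Longrightarrow> T k = 0 \<Longrightarrow> cinner h k = 0) \<Longrightarrow> norm h \<le> C * norm (T h)"
proof -
  define R where "R = T ` S"
  have T_diff: "T (x - y) = T x - T y" if "x \<in> S" "y \<in> S" for x y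
    using T_add[of "x - y" y] that S cvec.subspace_diff by fastforce
  have R: "cvec.subspace R" unfolding cvec.subspace_def
  proof (intro conjI ballI allI)
    have "T 0 = 0" using T_scale[of 0 0] S(1) cvec.subspace_0 by fastforce
    then show "0 \<in> R" unfolding R_def using cvec.subspace_0[OF S(1)] by (intro image_eqI) auto
    fix x y c assume "x \<in> R" "y \<in> R"
    then obtain h k where h: "h \<in> S" "x = T h" and k: "k \<in> S" "y = T k" unfolding R_def by blast
    show "x + y \<in> R" unfolding R_def
      using h k T_add[of h k] cvec.subspace_add[OF S(1)] by (intro image_eqI[of _ _ "h + k"]) auto
    show "c *\<^sub>C x \<in> R" unfolding R_def
      using h T_scale[of h c] cvec.subspace_scale[OF S(1)] by (intro image_eqI[of _ _ "c *\<^sub>C h"]) auto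
  qed
  have A_unique: "u = A z" if "z \<in> R" "u \<in> S" "\<And>h. h \<in> S \<Longrightarrow> cinner (T h) z = cinner h u" for u z
  proof -
    have "u - A z \<in> S" using that(1,2) A_in cvec.subspace_diff[OF S(1)] unfolding R_def by blast
    then have "cinner (u - A z) (u - A z) = 0"
      using that(3)[of "u - A z"] A_adj[of z "u - A z"] that(1) by (simp add: R_def cinner_diff_right)
    then show ?thesis by simp
  qed
  have AR: "cvec.subspace (A ` R)" unfolding cvec.subspace_def
  proof (intro conjI ballI allI)
    show "0 \<in> A ` R" 
      using A_unique[of 0 0] cvec.subspace_0[OF R] cvec.subspace_0[OF S(1)] by (intro image_eqI[of _ _ 0]) auto
    fix x y c assume "x \<in> A ` R" "y \<in> A ` R"
    then obtain a b where a: "a \<in> R" "x = A a" and b: "b \<in> R" "y = A b" by blast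
    have xy: "x \<in> S" "y \<in> S" using A_in a b by (auto simp: R_def)
    have "x + y = A (a + b)"
      using a b xy R S A_adj
      by (intro A_unique) (auto simp: cinner_add_right R_def intro: cvec.subspace_add)
    then show "x + y \<in> A ` R" using a b R cvec.subspace_add by blast
    have "c *\<^sub>C x = A (c *\<^sub>C a)"
      using a xy R S A_adj
      by (intro A_unique) (auto simp: cinner_right R_def intro: cvec.subspace_scale)
    then show "c *\<^sub>C x \<in> A ` R" using a R cvec.subspace_scale by blast
  qed
  define Z where "Z = {z \<in> R. norm (A z) \<le> 1}"
  have "\<exists>C. \<forall>z\<in>Z. norm z \<le> C"
  proof (rule weakly_bounded_imp_bounded[OF R])
    show "closed R" using closed by (simp add: R_def)
    fix y assume "y \<in> R"
    then obtain h where h: "h \<in> S" "y = T h" by (auto simp: R_def)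
    have "cmod (cinner y z) \<le> norm h" if "z \<in> Z" for z
    proof -
      have "cmod (cinner y z) \<le> norm h * norm (A z)"
        using that A_adj h Cauchy_Schwarz_cinner[of h "A z"] by (auto simp: Z_def R_def)
      also have "\<dots> \<le> norm h * 1" using that by (intro mult_left_mono) (auto simp: Z_def)
      finally show ?thesis by simp
    qed
    then show "\<exists>M. \<forall>z\<in>Z. cmod (cinner y z) \<le> M" by blast
  qed (auto simp: Z_def)
  then obtain C0 where C0: "\<forall>z\<in>Z. norm z \<le> C0" by blast
  define C where "C = max C0 1"
  have C: "C > 0" "\<And>z. z \<in> Z \<Longrightarrow> norm z \<le> C" using C0 by (auto simp: C_def)
  have A_below: "norm z \<le> C * norm (A z)" if z: "z \<in> R" for z
  proof (cases "A z = 0")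
    case True
    obtain h where "h \<in> S" "z = T h" using z by (auto simp: R_def)
    then have "cinner z z = 0" using A_adj[of z h] z True by (simp add: R_def)
    then show ?thesis using C(1) by simp
  next
    case False
    define c where "c = complex_of_real (1 / norm (A z))"
    have cz: "c *\<^sub>C z \<in> R" using z R cvec.subspace_scale by blast
    have "c *\<^sub>C A z = A (c *\<^sub>C z)"
      using z cz A_in S A_adj
      by (intro A_unique) (auto simp: cinner_right R_def intro: cvec.subspace_scale)
    moreover have "norm (c *\<^sub>C A z) = 1" using False by (simp add: norm_scaleC c_def norm_divide)
    ultimately have "norm (c *\<^sub>C z) \<le> C" using cz by (intro C) (simp add: Z_def)
    then show ?thesis using False by (simp add: norm_scaleC c_def norm_divide field_simps)
  qed
  have T_below: "norm (A z) \<le> C * norm (T (A z))" if z: "z \<in> R" for z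
  proof (cases "A z = 0")
    case False
    have Az: "A z \<in> S" using z A_in by (simp add: R_def)
    have "norm (A z) * norm (A z) = cmod (cinner (A z) (A z))"
      by (simp add: cinner_self norm_power power2_eq_square norm_mult)
    also have "\<dots> = cmod (cinner (T (A z)) z)" using A_adj[of z "A z"] z Az by (simp add: R_def)
    also have "\<dots> \<le> norm (T (A z)) * norm z" by (rule Cauchy_Schwarz_cinner)
    also have "\<dots> \<le> norm (T (A z)) * (C * norm (A z))" by (intro mult_left_mono A_below z) simp
    finally have "norm (A z) * norm (A z) \<le> (C * norm (T (A z))) * norm (A z)" by (simp add: mult_ac)
    then show ?thesis using False by (subst (asm) mult_le_cancel_right) auto
  qed (use C in auto)
  show thesis
  proof (rule that[OF C(1)])
    fix h assume h: "h \<in> S" and ker: "\<And>k. k \<in> S \<Longrightarrow> T k = 0 \<Longrightarrow> cinner h k = 0"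
    define Y where "Y = closure (A ` R)"
    have Y: "cvec.subspace Y" "closed Y" using AR csubspace_closure by (auto simp: Y_def)
    have YS: "Y \<subseteq> S" unfolding Y_def using A_in S(2) by (intro closure_minimal) (auto simp: R_def)
    \<comment> \<open>The part of \<open>h\<close> orthogonal to the image of \<open>A\<close> lies in the kernel of \<open>T\<close>, so it vanishes.\<close>
    define d where "d = h - proj_on Y h"
    have pS: "proj_on Y h \<in> S" using proj_on(1)[OF Y] YS by blast
    have dS: "d \<in> S" using h pS S by (auto simp: d_def intro: cvec.subspace_diff)
    have dY: "cinner d y = 0" if "y \<in> Y" for y
      using proj_on(2)[OF Y that, of h] by (simp add: d_def cinner_diff_left)
    have "cinner (T d) (T d) = cinner d (A (T d))" using dS A_adj by blast
    also have "\<dots> = 0" using dS closure_subset[of "A ` R"] by (intro dY) (auto simp: Y_def R_def)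
    finally have "T d = 0" by simp
    then have "cinner h d = 0" using ker dS by blast
    then have "cinner d d = 0"
      using dY[OF proj_on(1)[OF Y], of h] cinner_eq_0_sym[of d "proj_on Y h"] 
      by (simp add: d_def cinner_diff_left)
    then have "h \<in> Y" using proj_on(1)[OF Y, of h] by (simp add: d_def)
    then obtain f where f: "\<And>n. f n \<in> A ` R" "f \<longlonglongrightarrow> h" unfolding Y_def closure_sequential by blast
    have fS: "f n \<in> S" for n using f(1)[of n] A_in by (auto simp: R_def)
    have "(\<lambda>n. T (f n)) \<longlonglongrightarrow> T h"
    proof (rule Lim_null_comparison[THEN Lim_null[THEN iffD2]])
      show "\<forall>\<^sub>F n in sequentially. norm (T (f n) - T h) \<le> K * norm (f n - h)"
        using T_bound T_diff fS h S by (metis (no_types, lifting) always_eventually cvec.subspace_diff)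
      have "(\<lambda>n. K * norm (f n - h)) \<longlonglongrightarrow> K * norm (h - h)" using f by (intro tendsto_intros)
      then show "(\<lambda>n. K * norm (f n - h)) \<longlonglongrightarrow> 0" by simp
    qed
    then have "(\<lambda>n. C * norm (T (f n))) \<longlonglongrightarrow> C * norm (T h)" by (intro tendsto_intros)
    moreover have "(\<lambda>n. norm (f n)) \<longlonglongrightarrow> norm h" using f by (intro tendsto_intros)
    moreover have "norm (f n) \<le> C * norm (T (f n))" for n using f(1)[of n] T_below by auto
    ultimately show "norm h \<le> C * norm (T h)" by (intro LIMSEQ_le[of "\<lambda>n. norm (f n)"]) auto
  qed
qed

section \<open>Antiholomorphic maps\<close>

text \<open>The pointwise form of \<open>antihol_on\<close>, so that sections can be compared near single points.\<close>

definition antihol_at :: "(complex^'n::finite \<Rightarrow> 'b::complex_inner) \<Rightarrow> complex^'n \<Rightarrow> bool" where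
  "antihol_at f w \<longleftrightarrow> (\<exists>D. (f has_derivative D) (at w) \<and> (\<forall>c v. D (c *\<^sub>C v) = cnj c *\<^sub>C D v))"

lemma antihol_on_iff: "antihol_on U f \<longleftrightarrow> (\<forall>w\<in>U. antihol_at f w)"
  by (simp add: antihol_on_def antihol_at_def)

lemma antihol_onI: "(\<And>w. w \<in> U \<Longrightarrow> antihol_at f w) \<Longrightarrow> antihol_on U f"
  by (simp add: antihol_on_iff)

lemma antihol_onD: "antihol_on U f \<Longrightarrow> w \<in> U \<Longrightarrow> antihol_at f w"
  by (simp add: antihol_on_iff)

lemma antihol_atI:
  "(f has_derivative D) (at w) \<Longrightarrow> (\<And>c v. D (c *\<^sub>C v) = cnj c *\<^sub>C D v) \<Longrightarrow> antihol_at f w"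
  by (auto simp: antihol_at_def)

lemma antihol_at_derivative:
  assumes "antihol_at f w"
  shows "(f has_derivative frechet_derivative f (at w)) (at w)"
    and "frechet_derivative f (at w) (c *\<^sub>C v) = cnj c *\<^sub>C frechet_derivative f (at w) v"
proof -
  obtain D where D: "(f has_derivative D) (at w)" "\<forall>c v. D (c *\<^sub>C v) = cnj c *\<^sub>C D v"
    using assms by (auto simp: antihol_at_def)
  then have "frechet_derivative f (at w) = D" by (metis frechet_derivative_at)
  then show "(f has_derivative frechet_derivative f (at w)) (at w)"
    "frechet_derivative f (at w) (c *\<^sub>C v) = cnj c *\<^sub>C frechet_derivative f (at w) v"
    using D by auto
qed

lemma antihol_at_continuous: "antihol_at f w \<Longrightarrow> isCont f w"
  by (auto simp: antihol_at_def intro: has_derivative_continuous)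

lemma antihol_on_continuous_on: "antihol_on U f \<Longrightarrow> continuous_on U f"
  by (simp add: antihol_on_iff antihol_at_continuous continuous_at_imp_continuous_on)

lemma antihol_at_cong:
  assumes "antihol_at f w" "open U" "w \<in> U" "\<And>z. z \<in> U \<Longrightarrow> g z = f z"
  shows "antihol_at g w"
  using assms has_derivative_transform_within_open[of f _ w UNIV U g]
  by (auto simp: antihol_at_def)

lemma antihol_at_const: "antihol_at (\<lambda>w. c) w"
  by (rule antihol_atI[of _ "\<lambda>_. 0"]) auto

lemma antihol_at_add: "antihol_at f w \<Longrightarrow> antihol_at g w \<Longrightarrow> antihol_at (\<lambda>w. f w + g w) w"
  unfolding antihol_at_def
  by (elim exE conjE, rule_tac x = "\<lambda>v. D v + Da v" in exI)
    (auto intro!: derivative_eq_intros simp: scaleC_add_right)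

lemma antihol_at_sum:
  "(\<And>i. i \<in> I \<Longrightarrow> antihol_at (f i) w) \<Longrightarrow> antihol_at (\<lambda>w. \<Sum>i\<in>I. f i w) w"
  by (induction I rule: infinite_finite_induct) (auto intro: antihol_at_const antihol_at_add)

lemma antihol_at_bounded_bilinear:
  assumes "bounded_bilinear B" and f: "antihol_at f w" and g: "antihol_at g w"
    and "\<And>c x y. B (c *\<^sub>C x) y = c *\<^sub>C B x y" "\<And>c x y. B x (c *\<^sub>C y) = c *\<^sub>C B x y"
  shows "antihol_at (\<lambda>w. B (f w) (g w)) w"
proof -
  from f obtain D where D: "(f has_derivative D) (at w)" "\<forall>c v. D (c *\<^sub>C v) = cnj c *\<^sub>C D v"
    by (auto simp: antihol_at_def)
  from g obtain E where E: "(g has_derivative E) (at w)" "\<forall>c v. E (c *\<^sub>C v) = cnj c *\<^sub>C E v"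
    by (auto simp: antihol_at_def)
  show ?thesis
    by (rule antihol_atI[OF bounded_bilinear.FDERIV[OF assms(1) D(1) E(1)]])
      (simp add: D(2) E(2) assms(4,5) scaleC_add_right)
qed

lemma antihol_at_scaleC:
  assumes "antihol_at f w" "antihol_at g w" shows "antihol_at (\<lambda>w. f w *\<^sub>C g w) w"
  by (rule antihol_at_bounded_bilinear[OF bounded_bilinear_scaleC assms])
    (simp_all add: scaleC_scaleC scaleC_complex_def mult_ac)

lemma antihol_at_mult:
  fixes f g :: "_ \<Rightarrow> complex"
  assumes "antihol_at f w" "antihol_at g w" shows "antihol_at (\<lambda>w. f w * g w) w"
  by (rule antihol_at_bounded_bilinear[OF bounded_bilinear_mult assms])
    (simp_all add: scaleC_complex_def)

lemma antihol_at_inverse: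
  fixes f :: "_ \<Rightarrow> complex"
  assumes "antihol_at f w" "f w \<noteq> 0" shows "antihol_at (\<lambda>w. inverse (f w)) w"
proof -
  from assms obtain D where D: "(f has_derivative D) (at w)" "\<forall>c v. D (c *\<^sub>C v) = cnj c *\<^sub>C D v"
    by (auto simp: antihol_at_def)
  show ?thesis
    by (rule antihol_atI[OF Deriv.has_derivative_inverse[OF assms(2) D(1)]])
      (simp add: D(2) scaleC_complex_def)
qed

lemma antihol_at_divide:
  fixes f g :: "_ \<Rightarrow> complex"
  assumes "antihol_at f w" "antihol_at g w" "g w \<noteq> 0" shows "antihol_at (\<lambda>w. f w / g w) w"
  unfolding divide_inverse using assms by (intro antihol_at_mult antihol_at_inverse)

lemma antihol_at_cinner_const:
  assumes "antihol_at f w" shows "antihol_at (\<lambda>w. cinner (f w) y) w"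
proof -
  from assms obtain D where D: "(f has_derivative D) (at w)" "\<forall>c v. D (c *\<^sub>C v) = cnj c *\<^sub>C D v"
    by (auto simp: antihol_at_def)
  show ?thesis
    by (rule antihol_atI[OF bounded_bilinear.FDERIV[OF bounded_bilinear_cinner D(1) has_derivative_const[of y]]])
      (simp add: D(2) scaleC_complex_def cinner_scaleC_left)
qed

lemma antihol_at_cinner_hol:
  assumes f: "antihol_at f w" and g: "hol_on U g" "w \<in> U"
  shows "antihol_at (\<lambda>w. cinner (f w) (g w)) w"
proof -
  from f obtain D where D: "(f has_derivative D) (at w)" "\<forall>c v. D (c *\<^sub>C v) = cnj c *\<^sub>C D v"
    by (auto simp: antihol_at_def)
  from g obtain E where E: "(g has_derivative E) (at w)" "\<forall>c v. E (c *\<^sub>C v) = c *\<^sub>C E v"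
    by (auto simp: hol_on_def)
  show ?thesis
    by (rule antihol_atI[OF bounded_bilinear.FDERIV[OF bounded_bilinear_cinner D(1) E(1)]])
      (simp add: D(2) E(2) scaleC_complex_def cinner_scaleC_left cinner_right distrib_left)
qed

lemma hol_on_cnj:
  assumes "antihol_on U f" shows "hol_on U (\<lambda>w. cnj (f w))"
  unfolding hol_on_def
proof
  fix w assume "w \<in> U"
  then obtain D where D: "(f has_derivative D) (at w)" "\<forall>c v. D (c *\<^sub>C v) = cnj c *\<^sub>C D v"
    using assms by (auto simp: antihol_on_def)
  have "((\<lambda>w. cnj (f w)) has_derivative (\<lambda>v. cnj (D v))) (at w)"
    using D(1) by (rule bounded_linear.has_derivative[OF bounded_linear_cnj])
  then show "\<exists>D. ((\<lambda>w. cnj (f w)) has_derivative D) (at w) \<and> (\<forall>c v. D (c *\<^sub>C v) = c *\<^sub>C D v)"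
    using D(2) by (intro exI[of _ "\<lambda>v. cnj (D v)"]) (auto simp: scaleC_complex_def)
qed

lemma antihol_at_vec:
  fixes f :: "complex^'n::finite \<Rightarrow> complex^'m::finite"
  assumes "\<And>i. antihol_at (\<lambda>w. f w $ i) w" shows "antihol_at f w"
proof -
  have "f = (\<lambda>w. \<Sum>i\<in>UNIV. (f w $ i) *\<^sub>C axis i 1)"
    by (simp add: fun_eq_iff vec_eq_iff scaleC_vec_def scaleC_complex_def axis_def if_distrib cong: if_cong)
  moreover have "antihol_at (\<lambda>w. \<Sum>i\<in>UNIV. (f w $ i) *\<^sub>C (axis i 1 :: complex^'m)) w"
    by (intro antihol_at_sum antihol_at_scaleC antihol_at_const assms)
  ultimately show ?thesis by simp
qed

section \<open>Cauchy's formula and the regularity of antiholomorphic maps\<close>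

instance chilbert_space \<subseteq> banach ..

definition unit_circle :: "real \<Rightarrow> complex" where
  "unit_circle t = exp (2 * of_real pi * \<i> * of_real t)"

lemma norm_unit_circle [simp]: "cmod (unit_circle t) = 1"
  by (simp add: unit_circle_def norm_exp_eq_Re)

lemma continuous_on_unit_circle [continuous_intros]: "continuous_on T unit_circle"
  unfolding unit_circle_def by (intro continuous_intros)

lemma inverse_unit_circle: "inverse (unit_circle t) = cnj (unit_circle t)"
  by (simp add: unit_circle_def exp_cnj flip: exp_minus)

lemma unit_circle_neq_0 [simp]: "unit_circle t \<noteq> 0"
  by (simp add: unit_circle_def)

text \<open>
  Pairing with a fixed vector and conjugating the parameter of the disc reduces this to Cauchy's
  formula for the derivative of a holomorphic function of one variable.
\<close>

lemma antihol_Cauchy: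
  fixes f :: "complex^'n::finite \<Rightarrow> 'a::chilbert_space"
  assumes "open U" and f: "antihol_on U f" and U: "\<And>\<zeta>. cmod \<zeta> \<le> 1 \<Longrightarrow> w + \<zeta> *\<^sub>C v \<in> U"
  shows "((\<lambda>t. cnj (unit_circle t) *\<^sub>C f (w + cnj (unit_circle t) *\<^sub>C v)) has_integral
    frechet_derivative f (at w) v) {0..1}"
proof -
  let ?\<psi> = "\<lambda>t. cnj (unit_circle t) *\<^sub>C f (w + cnj (unit_circle t) *\<^sub>C v)"
  have cont: "continuous_on {0..1} ?\<psi>"
    by (intro continuous_intros continuous_on_compose2[OF antihol_on_continuous_on[OF f]])
      (auto intro!: U)
  then have I: "(?\<psi> has_integral integral {0..1} ?\<psi>) {0..1}"
    by (intro integrable_integral integrable_continuous_interval)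
  have "cinner (integral {0..1} ?\<psi>) y = cinner (frechet_derivative f (at w) v) y" for y
  proof -
    define F where "F \<zeta> = cinner (f (w + cnj \<zeta> *\<^sub>C v)) y" for \<zeta>
    define T where "T = (\<lambda>\<zeta>. w + cnj \<zeta> *\<^sub>C v) -` U"
    have "open T" unfolding T_def
      by (intro open_vimage \<open>open U\<close> continuous_intros)
    have F: "(F has_field_derivative cinner (frechet_derivative f (at (w + cnj \<zeta> *\<^sub>C v)) v) y) (at \<zeta>)"
      if "\<zeta> \<in> T" for \<zeta>
    proof -
      let ?D = "frechet_derivative f (at (w + cnj \<zeta> *\<^sub>C v))"
      have at: "antihol_at f (w + cnj \<zeta> *\<^sub>C v)" using f that by (auto simp: T_def antihol_on_iff)
      have "((\<lambda>\<zeta>. w + cnj \<zeta> *\<^sub>C v) has_derivative (\<lambda>h. cnj h *\<^sub>C v)) (at \<zeta>)"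
        using bounded_bilinear.FDERIV[OF bounded_bilinear_scaleC
            bounded_linear.has_derivative[OF bounded_linear_cnj has_derivative_ident] has_derivative_const[of v]]
        by (intro derivative_eq_intros) auto
      from has_derivative_compose[OF this antihol_at_derivative(1)[OF at]]
      have "((\<lambda>\<zeta>. f (w + cnj \<zeta> *\<^sub>C v)) has_derivative (\<lambda>h. h *\<^sub>C ?D v)) (at \<zeta>)"
        by (simp add: antihol_at_derivative(2)[OF at])
      from bounded_bilinear.FDERIV[OF bounded_bilinear_cinner this has_derivative_const[of y]]
      show ?thesis unfolding has_field_derivative_def F_def
        by (rule has_derivative_eq_rhs) (simp add: cinner_scaleC_left fun_eq_iff)
    qed
    have cT: "cball 0 1 \<subseteq> T" using U by (auto simp: T_def)
    have hol: "F holomorphic_on T"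
      using F \<open>open T\<close> by (auto simp: holomorphic_on_open)
    have dF: "deriv F 0 = cinner (frechet_derivative f (at w) v) y"
      using F[OF subsetD[OF cT, of 0]] by (intro DERIV_imp_deriv) simp
    have CI: "((\<lambda>u. F u / (u - 0) ^ Suc 1) has_contour_integral ((2 * of_real pi * \<i>) / fact 1 * (deriv ^^ 1) F 0))
        (circlepath 0 1)"
      using Cauchy_has_contour_integral_higher_derivative_circlepath[of 0 1 F 0 1]
        holomorphic_on_imp_continuous_on[OF holomorphic_on_subset[OF hol cT]]
        holomorphic_on_subset[OF hol ball_subset_cball[THEN subset_trans, OF cT]]
      by simp
    have "((\<lambda>t. F (unit_circle t) / (unit_circle t) ^ 2 * (2 * of_real pi * \<i> * unit_circle t))
        has_integral 2 * of_real pi * \<i> / fact 1 * (deriv ^^ 1) F 0) {0..1}"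
    proof (rule has_integral_eq[OF _ CI[unfolded has_contour_integral_def]])
      fix t :: real assume "t \<in> {0..1}"
      then have "vector_derivative (circlepath 0 1) (at t within {0..1}) = 2 * of_real pi * \<i> * unit_circle t"
        using vector_derivative_circlepath01[of t 0 1] by (simp add: unit_circle_def)
      then show "F (circlepath 0 1 t) / (circlepath 0 1 t - 0) ^ Suc 1 *
          vector_derivative (circlepath 0 1) (at t within {0..1})
        = F (unit_circle t) / (unit_circle t) ^ 2 * (2 * of_real pi * \<i> * unit_circle t)"
        by (simp only:) (simp add: circlepath power2_eq_square flip: unit_circle_def)
    qed
    then have "((\<lambda>t. F (unit_circle t) / (unit_circle t) ^ 2 * (2 * of_real pi * \<i> * unit_circle t))
        has_integral 2 * of_real pi * \<i> * deriv F 0) {0..1}" by simp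
    from has_integral_mult_right[OF this, of "1 / (2 * of_real pi * \<i>)"]
    have "((\<lambda>t. 1 / (2 * of_real pi * \<i>) * (F (unit_circle t) / (unit_circle t) ^ 2 * (2 * of_real pi * \<i> * unit_circle t)))
        has_integral deriv F 0) {0..1}" by simp
    then have lhs: "((\<lambda>t. cinner (?\<psi> t) y) has_integral deriv F 0) {0..1}"
    proof (rule has_integral_eq[rotated])
      fix t :: real
      have "1 / (2 * of_real pi * \<i>) * (F (unit_circle t) / (unit_circle t) ^ 2 * (2 * of_real pi * \<i> * unit_circle t))
          = inverse (unit_circle t) * F (unit_circle t)"
        by (simp add: power2_eq_square divide_simps)
      also have "\<dots> = cinner (?\<psi> t) y"
        by (simp only: inverse_unit_circle F_def cinner_scaleC_left)
      finally show "1 / (2 * of_real pi * \<i>) * (F (unit_circle t) / (unit_circle t) ^ 2 * (2 * of_real pi * \<i> * unit_circle t))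
          = cinner (?\<psi> t) y" .
    qed
    have rhs: "((\<lambda>t. cinner (?\<psi> t) y) has_integral cinner (integral {0..1} ?\<psi>) y) {0..1}"
      using has_integral_linear[OF I bounded_bilinear.bounded_linear_left[OF bounded_bilinear_cinner]]
      by (simp add: o_def)
    show ?thesis using has_integral_unique[OF lhs rhs] dF by simp
  qed
  then have "cinner (integral {0..1} ?\<psi> - frechet_derivative f (at w) v)
      (integral {0..1} ?\<psi> - frechet_derivative f (at w) v) = 0"
    by (simp only: cinner_diff_left diff_self)
  then have "integral {0..1} ?\<psi> = frechet_derivative f (at w) v"
    by (simp only: cinner_self_eq_0 eq_iff_diff_eq_0[symmetric])
  then show ?thesis using I by simp
qed


lemma has_integral_unit_interval_bound:
  fixes g :: "real \<Rightarrow> 'a::real_normed_vector"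
  assumes "(g has_integral y) {0..1}" "\<And>t. norm (g t) \<le> B"
  shows "norm y \<le> B"
proof -
  have "0 \<le> B" using assms(2)[of 0] norm_ge_zero order_trans by blast
  then have "norm y \<le> B * measure lborel {0..1::real}"
    using assms by (intro has_integral_bound_real) auto
  then show ?thesis by simp
qed

text \<open>
  Cauchy's formula on small discs bounds the derivative by the map, so a locally bounded map is locally Lipschitz; applied to
  differences, it then makes the derivative locally Lipschitz. The linear approximation of \<open>f\<close> has
  therefore a quadratic error, uniformly, and integrating it over circles differentiates the
  formula.
\<close>

lemma antihol_on_directional_derivative:
  fixes f :: "complex^'n::finite \<Rightarrow> 'a::chilbert_space"
  assumes "open U" and f: "antihol_on U f"
  shows "antihol_on U (\<lambda>w. frechet_derivative f (at w) v)"
proof (rule antihol_onI)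
  fix w0 assume w0: "w0 \<in> U"
  define F where "F w = frechet_derivative f (at w)" for w
  obtain r0 where r0: "r0 > 0" "ball w0 r0 \<subseteq> U" using \<open>open U\<close> w0 openE by blast
  have "isCont f w0" using f w0 antihol_at_continuous antihol_onD by blast
  then obtain r1 where r1: "r1 > 0" "\<And>w. dist w w0 < r1 \<Longrightarrow> dist (f w) (f w0) < 1"
    unfolding continuous_at_eps_delta by (metis zero_less_one)
  \<comment> \<open>On the balls of radius \<open>3 r\<close>, \<open>2 r\<close> and \<open>r\<close> there are bounds for the map, for its derivative,
    and for the Lipschitz constant of the derivative; each step loses \<open>r\<close> to the discs.\<close>
  define r where "r = min r0 r1 / 3"
  define M where "M = norm (f w0) + 1"
  have r: "r > 0" using r0 r1 by (simp add: r_def)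
  have ballU: "ball w0 (3 * r) \<subseteq> U" using r0 by (auto simp: r_def)
  have fM: "norm (f w) \<le> M" if "w \<in> ball w0 (3 * r)" for w
  proof -
    have "dist (f w) (f w0) < 1" using that r1 by (intro r1(2)) (auto simp: r_def dist_commute)
    then show ?thesis using norm_triangle_ineq[of "f w - f w0" "f w0"] by (simp add: M_def dist_norm)
  qed
  have at: "antihol_at f w" if "w \<in> ball w0 (3 * r)" for w
    using antihol_onD[OF f] ballU that by blast
  have der: "(f has_derivative F w) (at w)" and conj: "F w (c *\<^sub>C u) = cnj c *\<^sub>C F w u"
    if "w \<in> ball w0 (3 * r)" for w c u
    using antihol_at_derivative[OF at[OF that]] by (auto simp: F_def)
  have lin: "linear (F w)" if "w \<in> ball w0 (3 * r)" for w
    using der[OF that] has_derivative_linear by blast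
  have circ: "w + \<zeta> *\<^sub>C u \<in> ball w0 (s + r)" if "w \<in> ball w0 s" "norm u < r" "cmod \<zeta> \<le> 1" for w \<zeta> u s
  proof -
    have "norm (\<zeta> *\<^sub>C u) < r"
      using that mult_mono[of "cmod \<zeta>" 1 "norm u" "norm u"] by (simp add: norm_scaleC)
    moreover have "norm ((w + \<zeta> *\<^sub>C u) - w0) \<le> norm (w - w0) + norm (\<zeta> *\<^sub>C u)"
      using norm_triangle_ineq[of "w - w0" "\<zeta> *\<^sub>C u"] by (simp add: algebra_simps)
    moreover have "norm (w - w0) < s" using that(1) by (simp add: dist_norm norm_minus_commute)
    ultimately show ?thesis by (simp add: dist_norm norm_minus_commute)
  qed
  have Cauchy: "((\<lambda>t. cnj (unit_circle t) *\<^sub>C f (w + cnj (unit_circle t) *\<^sub>C u)) has_integral F w u) {0..1}"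
    if "w \<in> ball w0 (2 * r)" "norm u < r" for w u
    unfolding F_def
  proof (rule antihol_Cauchy[OF \<open>open U\<close> f])
    show "w + \<zeta> *\<^sub>C u \<in> U" if "cmod \<zeta> \<le> 1" for \<zeta>
      using circ[OF \<open>w \<in> _\<close> \<open>norm u < r\<close> that] ballU by auto
  qed
  have scaled: "norm (G u) \<le> (2 * N / r) * norm u"
    if G: "linear G" and small: "\<And>u. norm u < r \<Longrightarrow> norm (G u) \<le> N" for G :: "complex^'n \<Rightarrow> 'a" and N u
  proof (cases "u = 0")
    case True
    then show ?thesis using linear_0[OF G] by simp
  next
    case False
    define c where "c = r / (2 * norm u)"
    have c: "c > 0" using r False by (simp add: c_def)
    have "norm (G (c *\<^sub>R u)) \<le> N" using r False by (intro small) (simp add: c_def)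
    then have "c * norm (G u) \<le> N" using c by (simp add: linear_scale[OF G])
    then show ?thesis using r False by (simp add: c_def field_simps)
  qed
  define B where "B = 2 * M / r"
  have M0: "M \<ge> 0" by (simp add: M_def)
  have B0: "B \<ge> 0" using M0 r by (simp add: B_def)
  have FB: "norm (F w u) \<le> B * norm u" if w: "w \<in> ball w0 (2 * r)" for w u
    unfolding B_def
  proof (rule scaled)
    show "linear (F w)" using w r by (intro lin) auto
    fix u :: "complex^'n" assume u: "norm u < r"
    show "norm (F w u) \<le> M"
    proof (rule has_integral_unit_interval_bound[OF Cauchy[OF w u]])
      fix t :: real
      show "norm (cnj (unit_circle t) *\<^sub>C f (w + cnj (unit_circle t) *\<^sub>C u)) \<le> M"
        using fM circ[OF w u, of "cnj (unit_circle t)"] by (simp add: norm_scaleC)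
    qed
  qed
  have fLip: "norm (f x - f y) \<le> B * norm (x - y)" if "x \<in> ball w0 (2 * r)" "y \<in> ball w0 (2 * r)" for x y
  proof (rule differentiable_bound[OF convex_ball])
    fix w assume w: "w \<in> ball w0 (2 * r)"
    then show "(f has_derivative F w) (at w within ball w0 (2 * r))"
      using r by (intro der[THEN has_derivative_at_withinI]) auto
    show "onorm (F w) \<le> B" using FB[OF w] by (rule onorm_le)
  qed (use that in auto)
  define C where "C = 2 * B / r"
  have C0: "C \<ge> 0" using B0 r by (simp add: C_def)
  have FLip: "norm (F x u - F y u) \<le> C * norm (x - y) * norm u"
    if x: "x \<in> ball w0 r" and y: "y \<in> ball w0 r" for x y u
  proof -
    have xy: "x \<in> ball w0 (3 * r)" "y \<in> ball w0 (3 * r)" "x \<in> ball w0 (2 * r)" "y \<in> ball w0 (2 * r)"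
      using x y r by auto
    have "norm (F x u - F y u) \<le> (2 * (B * norm (x - y)) / r) * norm u"
    proof (rule scaled)
      show "linear (\<lambda>u. F x u - F y u)" using lin xy by (intro linear_compose_sub) auto
      fix u :: "complex^'n" assume u: "norm u < r"
      show "norm (F x u - F y u) \<le> B * norm (x - y)"
      proof (rule has_integral_unit_interval_bound[OF has_integral_diff[OF Cauchy[OF xy(3) u] Cauchy[OF xy(4) u]]])
        fix t :: real
        show "norm (cnj (unit_circle t) *\<^sub>C f (x + cnj (unit_circle t) *\<^sub>C u)
            - cnj (unit_circle t) *\<^sub>C f (y + cnj (unit_circle t) *\<^sub>C u)) \<le> B * norm (x - y)"
          using fLip[of "x + cnj (unit_circle t) *\<^sub>C u" "y + cnj (unit_circle t) *\<^sub>C u"]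
            circ[OF x u, of "cnj (unit_circle t)"] circ[OF y u, of "cnj (unit_circle t)"]
          by (simp add: norm_scaleC flip: cvec.scale_right_diff_distrib)
      qed
    qed
    then show ?thesis by (simp add: C_def mult_ac)
  qed
  have quad: "norm (f (x + h) - f x - F x h) \<le> C * (norm h)\<^sup>2"
    if x: "x \<in> ball w0 r" and xh: "x + h \<in> ball w0 r" for x h
  proof -
    let ?S = "ball w0 r \<inter> cball x (norm h)"
    have "norm (f (x + h) - f x - F x ((x + h) - x)) \<le> norm ((x + h) - x) * (C * norm h)"
    proof (rule differentiable_bound_linearization)
      fix t :: real assume t: "t \<in> {0..1}"
      have "x + t *\<^sub>R (x + h - x) = (1 - t) *\<^sub>R x + t *\<^sub>R (x + h)" by (simp add: algebra_simps)
      also have "\<dots> \<in> ball w0 r"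
        using x xh t convex_ball[of w0 r] by (intro convexD_alt) auto
      finally show "x + t *\<^sub>R (x + h - x) \<in> ?S"
        using t by (simp add: dist_norm mult_left_le_one_le)
    next
      fix y assume y: "y \<in> ?S"
      show "(f has_derivative F y) (at y within ?S)"
        using y r by (intro der[THEN has_derivative_at_withinI]) auto
      have "norm (F y u - F x u) \<le> C * norm h * norm u" for u
      proof -
        have "norm (F y u - F x u) \<le> C * norm (y - x) * norm u" using FLip y x by blast
        also have "\<dots> \<le> C * norm h * norm u"
          using y C0 by (intro mult_right_mono mult_left_mono) (auto simp: dist_norm norm_minus_commute)
        finally show ?thesis .
      qed
      then show "onorm (F y - F x) \<le> C * norm h" by (intro onorm_le) simp
    qed (use x in auto)
    then show ?thesis by (simp add: power2_eq_square mult_ac)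
  qed
  have small: "antihol_at (\<lambda>w. F w u) w0" if u: "norm u < r / 2" for u
  proof -
    let ?p = "\<lambda>t. w0 + cnj (unit_circle t) *\<^sub>C u"
    have nu: "norm (cnj (unit_circle t) *\<^sub>C u) < r / 2" for t using u by (simp add: norm_scaleC)
    have p: "?p t \<in> ball w0 (r / 2)" for t using nu by (simp add: dist_norm)
    then have p': "?p t \<in> ball w0 r" "?p t \<in> ball w0 (3 * r)" for t using r by (smt (verit) mem_ball field_sum_of_halves)+
    define I where "I h = (\<lambda>t. cnj (unit_circle t) *\<^sub>C F (?p t) h)" for h
    define L where "L h = integral {0..1} (I h)" for h
    have Fc: "continuous_on (ball w0 r) (\<lambda>w. F w h)" for h
    proof (rule lipschitz_on_continuous_on)
      show "(C * norm h)-lipschitz_on (ball w0 r) (\<lambda>w. F w h)"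
        using FLip C0 by (intro lipschitz_onI) (auto simp: dist_norm mult_ac)
    qed
    have pc: "continuous_on {0..1} ?p" by (intro continuous_intros)
    have "?p ` {0..1} \<subseteq> ball w0 r" using p'(1) by blast
    then have "continuous_on {0..1} (\<lambda>t. F (?p t) h)" for h
      by (rule continuous_on_compose2[OF Fc pc])
    then have "continuous_on {0..1} (I h)" for h unfolding I_def by (intro continuous_intros)
    then have I: "(I h has_integral L h) {0..1}" for h
      unfolding L_def by (intro integrable_integral integrable_continuous_interval)
    have L_eq: "L h = y" if "(I h has_integral y) {0..1}" for h y
      using has_integral_unique[OF I that] .
    have L_scale: "L (c *\<^sub>C h) = cnj c *\<^sub>C L h" for c h
    proof (rule L_eq)
      have "I (c *\<^sub>C h) = (\<lambda>t. cnj c *\<^sub>C I h t)"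
        by (simp add: I_def fun_eq_iff conj[OF p'(2)] scaleC_scaleC mult.commute)
      then show "(I (c *\<^sub>C h) has_integral cnj c *\<^sub>C L h) {0..1}"
        using has_integral_linear[OF I bounded_bilinear.bounded_linear_right[OF bounded_bilinear_scaleC]]
        by (simp add: o_def)
    qed
    have L_add: "L (h + k) = L h + L k" for h k
    proof (rule L_eq)
      have "I (h + k) = (\<lambda>t. I h t + I k t)"
        by (simp add: I_def fun_eq_iff linear_add[OF lin[OF p'(2)]] scaleC_add_right)
      then show "(I (h + k) has_integral L h + L k) {0..1}" using has_integral_add[OF I I] by simp
    qed
    have "linear L" using L_add L_scale[of "complex_of_real _"] by (intro linearI) (simp_all add: scaleR_scaleC)
    then have bL: "bounded_linear L" by (simp add: linear_conv_bounded_linear)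
    have "((\<lambda>w. F w u) has_derivative L) (at w0)"
    proof (rule has_derivativeI_sandwich[where e = "r / 2" and H = "\<lambda>y. C * norm (y - w0)"])
      fix y assume y: "y \<noteq> w0" "dist y w0 < r / 2"
      define h where "h = y - w0"
      have h: "norm h < r / 2" "y = w0 + h" using y by (auto simp: h_def dist_norm)
      have w0b: "w0 \<in> ball w0 (2 * r)" "y \<in> ball w0 (2 * r)" using r h by (auto simp: dist_norm)
      have ur: "norm u < r" using u r by simp
      have "norm (F y u - F w0 u - L h) \<le> C * (norm h)\<^sup>2"
      proof (rule has_integral_unit_interval_bound[OF
            has_integral_diff[OF has_integral_diff[OF Cauchy[OF w0b(2) ur] Cauchy[OF w0b(1) ur]] I]])
        fix t :: real
        have ph: "?p t + h \<in> ball w0 r"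
        proof -
          have "norm (cnj (unit_circle t) *\<^sub>C u + h) < r"
            using nu[of t] h norm_triangle_ineq[of "cnj (unit_circle t) *\<^sub>C u" h] by linarith
          moreover have "w0 - (?p t + h) = - (cnj (unit_circle t) *\<^sub>C u + h)" by simp
          ultimately show ?thesis unfolding mem_ball dist_norm by (simp only: norm_minus_cancel)
        qed
        have "cnj (unit_circle t) *\<^sub>C f (y + cnj (unit_circle t) *\<^sub>C u) - cnj (unit_circle t) *\<^sub>C f (?p t) - I h t
          = cnj (unit_circle t) *\<^sub>C (f (?p t + h) - f (?p t) - F (?p t) h)"
          by (simp add: I_def cvec.scale_right_diff_distrib h(2) add_ac)
        then show "norm (cnj (unit_circle t) *\<^sub>C f (y + cnj (unit_circle t) *\<^sub>C u) - cnj (unit_circle t) *\<^sub>C f (?p t) - I h t)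
          \<le> C * (norm h)\<^sup>2"
          using quad[OF p'(1) ph] by (simp add: norm_scaleC)
      qed
      then show "norm (F y u - F w0 u - L (y - w0)) / norm (y - w0) \<le> C * norm (y - w0)"
        using y by (simp add: h_def power2_eq_square field_simps)
    next
      have "((\<lambda>y. C * norm (y - w0)) \<longlongrightarrow> C * norm (w0 - w0)) (at w0)" by (intro tendsto_intros)
      then show "((\<lambda>y. C * norm (y - w0)) \<longlongrightarrow> 0) (at w0)" by simp
    qed (use r bL in auto)
    then show ?thesis using L_scale by (rule antihol_atI)
  qed
  \<comment> \<open>The derivative is linear in the direction, which may therefore be shortened.\<close>
  define \<epsilon> where "\<epsilon> = r / (4 * (norm v + 1))"
  have nv: "norm v + 1 > 0" by (smt (verit) norm_ge_zero)
  have \<epsilon>: "\<epsilon> > 0" using r nv by (simp add: \<epsilon>_def)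
  have "\<epsilon> * norm v < r / 2"
  proof -
    have "\<epsilon> * norm v \<le> \<epsilon> * (norm v + 1)" using \<epsilon> by simp
    also have "r / (4 * N) * N = r / 4" if "N > 0" for N using that by simp
    from this[OF nv] have "\<epsilon> * (norm v + 1) = r / 4" by (simp only: \<epsilon>_def)
    finally show ?thesis using r by simp
  qed
  then have "antihol_at (\<lambda>w. F w (complex_of_real \<epsilon> *\<^sub>C v)) w0" using \<epsilon> by (intro small) (simp add: norm_scaleC)
  then have "antihol_at (\<lambda>w. (1 / complex_of_real \<epsilon>) *\<^sub>C F w (complex_of_real \<epsilon> *\<^sub>C v)) w0"
    by (intro antihol_at_scaleC antihol_at_const)
  then show "antihol_at (\<lambda>w. frechet_derivative f (at w) v) w0"
  proof (rule antihol_at_cong[where U = "ball w0 (3 * r)"])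
    show "frechet_derivative f (at z) v = (1 / complex_of_real \<epsilon>) *\<^sub>C F z (complex_of_real \<epsilon> *\<^sub>C v)"
      if "z \<in> ball w0 (3 * r)" for z
      using \<epsilon> by (simp add: conj[OF that] scaleC_scaleC) (simp add: F_def)
  qed (use r in auto)
qed

section \<open>Continuously differentiable functions\<close>

lemma frechet_derivative_cong_open:
  assumes "open U" "w \<in> U" "\<And>z. z \<in> U \<Longrightarrow> f z = g z"
  shows "frechet_derivative f (at w) = frechet_derivative g (at w)"
proof -
  have "(f has_derivative D) (at w) \<longleftrightarrow> (g has_derivative D) (at w)" for D
    using assms has_derivative_transform_within_open[of f D w UNIV U g]
      has_derivative_transform_within_open[of g D w UNIV U f] by auto
  then show ?thesis by (simp add: frechet_derivative_def)
qed

lemma Ck_on_cong: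
  fixes f g :: "complex^'n::finite \<Rightarrow> 'b::real_normed_vector"
  assumes U: "open U"
  shows "(\<And>w. w \<in> U \<Longrightarrow> f w = g w) \<Longrightarrow> Ck_on k U f \<Longrightarrow> Ck_on k U g"
proof (induction k arbitrary: f g)
  case 0
  then show ?case by (metis Ck_on.simps(1) continuous_on_cong)
next
  case (Suc k)
  have "g differentiable at w" if "w \<in> U" for w
    using Suc.prems that U has_derivative_transform_within_open[of f _ w UNIV U g]
    by (metis Ck_on.simps(2) differentiable_def)
  moreover have "Ck_on k U (\<lambda>w. frechet_derivative g (at w) v)" for v
  proof (rule Suc.IH[of "\<lambda>w. frechet_derivative f (at w) v"])
    show "frechet_derivative f (at w) v = frechet_derivative g (at w) v" if "w \<in> U" for w
      using frechet_derivative_cong_open[OF U that Suc.prems(1)] by simp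
    show "Ck_on k U (\<lambda>w. frechet_derivative f (at w) v)" using Suc.prems(2) by simp
  qed
  ultimately show ?case by simp
qed

text \<open>
  The definition of \<open>Ck_on\<close> speaks of the chosen derivative; any explicit derivative does as well.
\<close>

lemma Ck_onI:
  fixes f :: "complex^'n::finite \<Rightarrow> 'b::real_normed_vector"
  assumes U: "open U" and F: "\<And>w. w \<in> U \<Longrightarrow> (f has_derivative F w) (at w)"
    and Ck: "\<And>v. Ck_on k U (\<lambda>w. F w v)"
  shows "Ck_on (Suc k) U f"
proof -
  have "F w v = frechet_derivative f (at w) v" if "w \<in> U" for w v
    using F[OF that] by (metis frechet_derivative_at)
  then have "Ck_on k U (\<lambda>w. frechet_derivative f (at w) v)" for v
    using Ck[of v] by (rule Ck_on_cong[OF U])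
  then show ?thesis using F by (auto simp: differentiable_def)
qed

lemma Ck_on_derivative:
  "Ck_on (Suc k) U f \<Longrightarrow> w \<in> U \<Longrightarrow> (f has_derivative frechet_derivative f (at w)) (at w)"
  using frechet_derivative_works by auto

lemma Ck_on_continuous: "Ck_on k U f \<Longrightarrow> continuous_on U f"
proof (cases k)
  case (Suc m)
  assume "Ck_on k U f"
  then have "isCont f w" if "w \<in> U" for w
    using that Suc by (intro differentiable_imp_continuous_within) simp
  then show ?thesis by (simp add: continuous_at_imp_continuous_on)
qed simp

lemma Ck_on_SucD: "Ck_on (Suc k) U f \<Longrightarrow> Ck_on k U f"
proof (induction k arbitrary: f)
  case 0
  then show ?case using Ck_on_continuous[OF 0] by (simp only: Ck_on.simps)
next
  case (Suc k)
  then show ?case unfolding Ck_on.simps(2)[of "Suc k"] Ck_on.simps(2)[of k U f] by blast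
qed

lemma Ck_on_local:
  fixes f :: "complex^'n::finite \<Rightarrow> 'b::real_normed_vector"
  shows "(\<And>w. w \<in> U \<Longrightarrow> \<exists>W. open W \<and> w \<in> W \<and> Ck_on k W f) \<Longrightarrow> Ck_on k U f"
proof (induction k arbitrary: f)
  case 0
  have "isCont f w" if "w \<in> U" for w
    using 0[OF that] continuous_on_eq_continuous_at by (metis Ck_on.simps(1))
  then show ?case by (simp add: continuous_at_imp_continuous_on)
next
  case (Suc k)
  have "Ck_on k U (\<lambda>w. frechet_derivative f (at w) v)" for v
  proof (rule Suc.IH)
    fix w assume "w \<in> U"
    then obtain W where "open W" "w \<in> W" "Ck_on (Suc k) W f" using Suc.prems by blast
    then show "\<exists>W. open W \<and> w \<in> W \<and> Ck_on k W (\<lambda>w. frechet_derivative f (at w) v)" by auto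
  qed
  moreover have "f differentiable at w" if w: "w \<in> U" for w
  proof -
    obtain W where "open W" "w \<in> W" "Ck_on (Suc k) W f" using Suc.prems[OF w] by blast
    then show ?thesis by simp
  qed
  ultimately show ?case by simp
qed

lemma Ck_on_add:
  assumes U: "open U"
  shows "Ck_on k U f \<Longrightarrow> Ck_on k U g \<Longrightarrow> Ck_on k U (\<lambda>w. f w + g w)"
proof (induction k arbitrary: f g)
  case (Suc k)
  show ?case
    by (rule Ck_onI[OF U has_derivative_add[OF Ck_on_derivative[OF Suc.prems(1)] Ck_on_derivative[OF Suc.prems(2)]]])
      (use Suc in auto)
qed (auto intro: continuous_intros)

lemma Ck_on_bounded_bilinear:
  assumes U: "open U" and B: "bounded_bilinear B"
  shows "Ck_on k U f \<Longrightarrow> Ck_on k U g \<Longrightarrow> Ck_on k U (\<lambda>w. B (f w) (g w))"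
proof (induction k arbitrary: f g)
  case 0
  then show ?case using bounded_bilinear.continuous_on[OF B] by auto
next
  case (Suc k)
  have "Ck_on k U f" "Ck_on k U g" using Suc.prems[THEN Ck_on_SucD] by auto
  then show ?case
    using Suc
    by (intro Ck_onI[OF U bounded_bilinear.FDERIV[OF B Ck_on_derivative[OF Suc.prems(1)] Ck_on_derivative[OF Suc.prems(2)]]])
      (auto intro!: Ck_on_add[OF U])
qed

lemma Ck_on_bounded_linear:
  assumes U: "open U" and L: "bounded_linear L"
  shows "Ck_on k U f \<Longrightarrow> Ck_on k U (\<lambda>w. L (f w))"
proof (induction k arbitrary: f)
  case 0
  then show ?case using bounded_linear.continuous_on[OF L] by auto
next
  case (Suc k)
  show ?case
    by (rule Ck_onI[OF U bounded_linear.has_derivative[OF L Ck_on_derivative[OF Suc.prems]]])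
      (use Suc in auto)
qed

lemma Ck_on_mult:
  fixes f g :: "_ \<Rightarrow> 'b::real_normed_algebra"
  shows "open U \<Longrightarrow> Ck_on k U f \<Longrightarrow> Ck_on k U g \<Longrightarrow> Ck_on k U (\<lambda>w. f w * g w)"
  by (rule Ck_on_bounded_bilinear[OF _ bounded_bilinear_mult])

lemma Ck_on_inverse:
  fixes f :: "complex^'n::finite \<Rightarrow> real"
  assumes U: "open U" and nz: "\<And>w. w \<in> U \<Longrightarrow> f w \<noteq> 0"
  shows "Ck_on k U f \<Longrightarrow> Ck_on k U (\<lambda>w. inverse (f w))"
proof (induction k)
  case 0
  then show ?case using nz by (auto intro!: continuous_intros)
next
  case (Suc k)
  have *: "Ck_on k U (\<lambda>w. inverse (f w))" using Suc Ck_on_SucD by blast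
  have neg: "Ck_on k U (\<lambda>w. - (f w))" if "Ck_on k U f" for f :: "complex^'n \<Rightarrow> real"
    using Ck_on_bounded_linear[OF U bounded_linear_minus[OF bounded_linear_ident] that] by simp
  show ?case
    by (rule Ck_onI[OF U Deriv.has_derivative_inverse[OF nz Ck_on_derivative[OF Suc.prems]]])
      (use Suc.prems in \<open>auto intro!: neg Ck_on_mult[OF U] *\<close>)
qed

lemma Ck_on_ln:
  fixes f :: "complex^'n::finite \<Rightarrow> real"
  assumes U: "open U" and pos: "\<And>w. w \<in> U \<Longrightarrow> f w > 0" and f: "Ck_on k U f"
  shows "Ck_on k U (\<lambda>w. ln (f w))"
proof (cases k)
  case 0
  then show ?thesis using pos f by (auto intro!: continuous_intros simp: less_imp_neq[THEN not_sym])
next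
  case (Suc m)
  have inv: "Ck_on m U (\<lambda>w. inverse (f w))"
    using Ck_on_inverse[OF U _ Ck_on_SucD] pos f Suc by (metis less_irrefl)
  have "((\<lambda>w. ln (f w)) has_derivative (\<lambda>v. frechet_derivative f (at w) v * inverse (f w))) (at w)"
    if "w \<in> U" for w
    using has_derivative_ln[OF pos[OF that] Ck_on_derivative[OF f[unfolded Suc] that]]
    by (rule has_derivative_eq_rhs) (simp add: fun_eq_iff)
  then show ?thesis unfolding Suc
    by (rule Ck_onI[OF U _]) (use f Suc inv in \<open>auto intro!: Ck_on_mult[OF U]\<close>)
qed

lemma antihol_on_Ck_on:
  fixes f :: "complex^'n::finite \<Rightarrow> 'a::chilbert_space"
  assumes U: "open U"
  shows "antihol_on U f \<Longrightarrow> Ck_on k U f"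
proof (induction k arbitrary: f)
  case 0
  then show ?case by (simp add: antihol_on_continuous_on)
next
  case (Suc k)
  show ?case
    by (rule Ck_onI[OF U antihol_at_derivative(1)[OF antihol_onD[OF Suc.prems]]])
      (use Suc.IH antihol_on_directional_derivative[OF U Suc.prems] in auto)
qed

lemma antihol_on_Ck_on_sq_norm:
  fixes s :: "complex^'n::finite \<Rightarrow> 'a::chilbert_space"
  assumes "open U" "antihol_on U s"
  shows "Ck_on k U (\<lambda>w. inner (s w) (s w))"
  by (rule Ck_on_bounded_bilinear[OF assms(1) bounded_bilinear_inner antihol_on_Ck_on[OF assms]
        antihol_on_Ck_on[OF assms]])

section \<open>Antiholomorphic line subbundles\<close>

text \<open>
  The families of lines whose \<open>antihol_subbundle\<close> is a line bundle: one-dimensional fibres, and a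
  non-vanishing local section through every point.
\<close>

definition antihol_line_family ::
    "(complex^'n::finite) set \<Rightarrow> (complex^'n \<Rightarrow> 'a::chilbert_space set) \<Rightarrow> bool" where
  "antihol_line_family \<Omega> S \<longleftrightarrow> (\<forall>w\<in>\<Omega>. \<exists>e. e \<noteq> 0 \<and> S w = cvec.span {e}) \<and>
     (\<forall>w\<in>\<Omega>. \<exists>U s. w \<in> U \<and> (U, s) \<in> frames (antihol_subbundle \<Omega> S))"

lemma span_singleton_eq:
  assumes "x \<in> cvec.span {e}" "x \<noteq> 0"
  shows "cvec.span {x} = cvec.span {e :: 'a::complex_inner}"
proof -
  obtain c where c: "x = c *\<^sub>C e" using assms by (auto simp: cvec.span_singleton)
  then have "e = (1 / c) *\<^sub>C x" using assms(2) by (auto simp: scaleC_scaleC)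
  then have "e \<in> cvec.span {x}" by (simp add: cvec.span_base cvec.span_scale)
  then show ?thesis using assms(1) by (simp add: cvec.span_eq)
qed

lemma antihol_line_family_span:
  assumes "antihol_line_family \<Omega> S" "w \<in> \<Omega>" "x \<in> S w" "x \<noteq> 0"
  shows "S w = cvec.span {x}"
proof -
  obtain e where "S w = cvec.span {e}" using assms(1,2) unfolding antihol_line_family_def by blast
  then show ?thesis using span_singleton_eq[of x e] assms(3,4) by simp
qed

lemma antihol_line_family_frame:
  assumes "antihol_line_family \<Omega> S" "w \<in> \<Omega>"
  obtains U s where "w \<in> U" "(U, s) \<in> frames (antihol_subbundle \<Omega> S)"
  using assms unfolding antihol_line_family_def by blast

lemma frames_antihol_subbundleD:
  assumes "(U, s) \<in> frames (antihol_subbundle \<Omega> S)"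
  shows "open U" "U \<subseteq> \<Omega>" "antihol_on U s" "w \<in> U \<Longrightarrow> s w \<in> S w" "w \<in> U \<Longrightarrow> s w \<noteq> 0"
  using assms by (auto simp: antihol_subbundle_def)

lemma sq_norm_antihol_subbundle: "sq_norm (antihol_subbundle \<Omega> S) s w = inner (s w) (s w)"
  by (simp add: sq_norm_def antihol_subbundle_def sub_space_def inner_eq_Re_cinner)

lemma open_nonzero_pairing:
  fixes t :: "complex^'n::finite \<Rightarrow> 'a::chilbert_space"
  assumes "open U" "antihol_on U t"
  shows "open {w \<in> U. cinner (t w) y \<noteq> 0}"
proof -
  have "continuous_on U (\<lambda>w. cinner (t w) y)"
    using assms by (intro continuous_intros antihol_on_continuous_on)
  then have "open (U \<inter> (\<lambda>w. cinner (t w) y) -` (- {0}))"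
    using assms(1) by (intro continuous_open_preimage) auto
  moreover have "{w \<in> U. cinner (t w) y \<noteq> 0} = U \<inter> (\<lambda>w. cinner (t w) y) -` (- {0})" by auto
  ultimately show ?thesis by simp
qed

lemma frames_antihol_subbundle_cong:
  assumes "\<And>w. w \<in> \<Omega> \<Longrightarrow> S w = T w"
  shows "frames (antihol_subbundle \<Omega> S) = frames (antihol_subbundle \<Omega> T)"
  using assms by (auto simp: antihol_subbundle_def)

lemma curvature_antihol_subbundle_cong:
  assumes "\<And>w. w \<in> \<Omega> \<Longrightarrow> S w = T w"
  shows "curvature (antihol_subbundle \<Omega> S) w u v = curvature (antihol_subbundle \<Omega> T) w u v"
proof -
  have "frames (antihol_subbundle \<Omega> S) = frames (antihol_subbundle \<Omega> T)"
    using assms by (rule frames_antihol_subbundle_cong)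
  then show ?thesis unfolding curvature_def sq_norm_antihol_subbundle by simp
qed

text \<open>
  Near a point \<open>w\<^sub>1\<close> the quotient of two sections of a line is the quotient of their pairings with
  the fixed vector \<open>t w\<^sub>1\<close>, which is antiholomorphic.
\<close>

lemma antihol_transition:
  fixes s t :: "complex^'n::finite \<Rightarrow> 'a::chilbert_space"
  assumes U: "open U" and s: "antihol_on U s" and t: "antihol_on U t"
    and t0: "\<And>w. w \<in> U \<Longrightarrow> t w \<noteq> 0" and span: "\<And>w. w \<in> U \<Longrightarrow> s w \<in> cvec.span {t w}"
  shows "\<exists>g. antihol_on U g \<and> (\<forall>w\<in>U. s w = g w *\<^sub>C t w)"
proof -
  have "\<exists>c. s w = c *\<^sub>C t w" if "w \<in> U" for w using span[OF that] by (auto simp: cvec.span_singleton)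
  then obtain g where g: "\<And>w. w \<in> U \<Longrightarrow> s w = g w *\<^sub>C t w" by metis
  have "antihol_at g w1" if w1: "w1 \<in> U" for w1
  proof (rule antihol_at_cong)
    show "open {w \<in> U. cinner (t w) (t w1) \<noteq> 0}" by (rule open_nonzero_pairing[OF U t])
    show "w1 \<in> {w \<in> U. cinner (t w) (t w1) \<noteq> 0}" using w1 t0 by simp
    show "antihol_at (\<lambda>w. cinner (s w) (t w1) / cinner (t w) (t w1)) w1"
      using s t w1 t0 by (intro antihol_at_divide antihol_at_cinner_const) (auto dest: antihol_onD)
    show "g w = cinner (s w) (t w1) / cinner (t w) (t w1)"
      if "w \<in> {w \<in> U. cinner (t w) (t w1) \<noteq> 0}" for w
      using that g by (simp add: cinner_scaleC_left)
  qed
  then show ?thesis using g by (blast intro: antihol_onI)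
qed

lemma frames_transition:
  assumes S: "antihol_line_family \<Omega> S"
    and s: "(U, s) \<in> frames (antihol_subbundle \<Omega> S)" and t: "(V, t) \<in> frames (antihol_subbundle \<Omega> S)"
  shows "\<exists>g. antihol_on (U \<inter> V) g \<and> (\<forall>w\<in>U \<inter> V. s w = g w *\<^sub>C t w)"
proof (rule antihol_transition)
  note s = frames_antihol_subbundleD[OF s] and t = frames_antihol_subbundleD[OF t]
  show "open (U \<inter> V)" "antihol_on (U \<inter> V) s" "antihol_on (U \<inter> V) t"
    using s t by (auto simp: antihol_on_iff)
  show "t w \<noteq> 0" if "w \<in> U \<inter> V" for w using that t by blast
  show "s w \<in> cvec.span {t w}" if w: "w \<in> U \<inter> V" for w
    using antihol_line_family_span[OF S, of w "t w"] s t w by blast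
qed

lemma herm_vector_space_sub_space:
  assumes "cvec.subspace S" shows "herm_vector_space (sub_space S)"
proof -
  note closed = cvec.subspace_0[OF assms] cvec.subspace_add[OF assms] cvec.subspace_scale[OF assms]
  have neg: "\<forall>x\<in>S. \<exists>y\<in>S. x + y = 0"
    using cvec.subspace_neg[OF assms] by (metis add.right_inverse)
  have pos: "x \<noteq> 0 \<longrightarrow> 0 < Re (cinner x x)" for x :: 'a by (simp add: cinner_self)
  show ?thesis unfolding herm_vector_space_def sub_space_def herm_space.simps
    using closed neg pos cinner_commute
    by (intro conjI allI ballI) (simp_all add: add.assoc add.commute
        scaleC_add_right scaleC_add_left scaleC_scaleC cinner_add_left cinner_scaleC_left)
qed

lemma herm_antihol_line_bundle_subbundle:
  assumes S: "antihol_line_family \<Omega> S"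
  shows "herm_antihol_line_bundle \<Omega> (antihol_subbundle \<Omega> S)"
  unfolding herm_antihol_line_bundle_def herm_line_bundle_def
proof (intro conjI ballI)
  fix w assume "w \<in> \<Omega>"
  then obtain e where e: "e \<noteq> 0" "S w = cvec.span {e}" using S by (auto simp: antihol_line_family_def)
  then show "herm_vector_space (fibre (antihol_subbundle \<Omega> S) w)"
    by (simp add: antihol_subbundle_def herm_vector_space_sub_space)
  show "one_dimensional (fibre (antihol_subbundle \<Omega> S) w)"
    unfolding one_dimensional_def using e cvec.span_base[of e "{e}"]
    by (intro bexI[of _ e]) (auto simp: antihol_subbundle_def sub_space_def cvec.span_singleton)
  show "\<exists>(U, s)\<in>frames (antihol_subbundle \<Omega> S). w \<in> U"
  proof -
    obtain U s where "w \<in> U" "(U, s) \<in> frames (antihol_subbundle \<Omega> S)"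
      using antihol_line_family_frame[OF S \<open>w \<in> \<Omega>\<close>] .
    then show ?thesis by (intro bexI[of _ "(U, s)"]) simp_all
  qed
next
  fix x assume "x \<in> frames (antihol_subbundle \<Omega> S)"
  moreover obtain U s where "x = (U, s)" by (cases x)
  ultimately have x: "x = (U, s)" "(U, s) \<in> frames (antihol_subbundle \<Omega> S)" by simp_all
  note s = frames_antihol_subbundleD[OF x(2)]
  show "case x of (U, s) \<Rightarrow> open U \<and> U \<subseteq> \<Omega> \<and>
      (\<forall>w\<in>U. s w \<in> hcarrier (fibre (antihol_subbundle \<Omega> S) w) \<and>
        s w \<noteq> hzero (fibre (antihol_subbundle \<Omega> S) w))"
    unfolding x(1) prod.case using s(1,2) s(4,5) by (simp add: antihol_subbundle_def sub_space_def)
  show "case x of (U, s) \<Rightarrow> smooth_on U (sq_norm (antihol_subbundle \<Omega> S) s)"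
    using antihol_on_Ck_on_sq_norm[OF s(1,3)]
    by (simp add: x smooth_on_def sq_norm_antihol_subbundle[abs_def])
  show "case x of (U, s) \<Rightarrow> \<forall>(V, t)\<in>frames (antihol_subbundle \<Omega> S). \<exists>g. antihol_on (U \<inter> V) g \<and>
      (\<forall>w\<in>U \<inter> V. s w = hscale (fibre (antihol_subbundle \<Omega> S) w) (g w) (t w))"
    unfolding x(1) prod.case
  proof (rule ballI, clarify)
    fix V t assume "(V, t) \<in> frames (antihol_subbundle \<Omega> S)"
    from frames_transition[OF S x(2) this]
    show "\<exists>g. antihol_on (U \<inter> V) g \<and>
        (\<forall>w\<in>U \<inter> V. s w = hscale (fibre (antihol_subbundle \<Omega> S) w) (g w) (t w))"
      by (simp add: antihol_subbundle_def sub_space_def)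
  qed
qed

text \<open>
  For equal families the identity is an isometric isomorphism; in terms of frames it is given by the
  transition functions.
\<close>

lemma antihol_subbundle_equiv:
  assumes S: "antihol_line_family \<Omega> S" and eq: "\<And>w. w \<in> \<Omega> \<Longrightarrow> S w = T w"
  shows "antihol_bundle_equiv \<Omega> (antihol_subbundle \<Omega> S) (antihol_subbundle \<Omega> T)"
proof -
  have fr: "frames (antihol_subbundle \<Omega> T) = frames (antihol_subbundle \<Omega> S)"
    using eq by (rule frames_antihol_subbundle_cong[symmetric])
  have T: "antihol_line_family \<Omega> T" using S eq by (simp add: antihol_line_family_def fr)
  show ?thesis unfolding antihol_bundle_equiv_def
  proof (intro conjI herm_antihol_line_bundle_subbundle S T exI[of _ "\<lambda>w x. x"])
    show "\<forall>w\<in>\<Omega>. bij_betw (\<lambda>x. x) (hcarrier (fibre (antihol_subbundle \<Omega> S) w))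
         (hcarrier (fibre (antihol_subbundle \<Omega> T) w)) \<and>
        (\<forall>x\<in>hcarrier (fibre (antihol_subbundle \<Omega> S) w). \<forall>y\<in>hcarrier (fibre (antihol_subbundle \<Omega> S) w).
            hadd (fibre (antihol_subbundle \<Omega> S) w) x y = hadd (fibre (antihol_subbundle \<Omega> T) w) x y) \<and>
        (\<forall>c. \<forall>x\<in>hcarrier (fibre (antihol_subbundle \<Omega> S) w).
            hscale (fibre (antihol_subbundle \<Omega> S) w) c x = hscale (fibre (antihol_subbundle \<Omega> T) w) c x) \<and>
        (\<forall>x\<in>hcarrier (fibre (antihol_subbundle \<Omega> S) w). \<forall>y\<in>hcarrier (fibre (antihol_subbundle \<Omega> S) w).
            hinner (fibre (antihol_subbundle \<Omega> T) w) x y = hinner (fibre (antihol_subbundle \<Omega> S) w) x y)"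
      using eq by (auto simp: antihol_subbundle_def sub_space_def bij_betw_def)
    show "\<forall>(U, s)\<in>frames (antihol_subbundle \<Omega> S). \<forall>(V, t)\<in>frames (antihol_subbundle \<Omega> T).
       \<exists>g. antihol_on (U \<inter> V) g \<and> (\<forall>w\<in>U \<inter> V. s w = hscale (fibre (antihol_subbundle \<Omega> T) w) (g w) (t w))"
      using frames_transition[OF S] unfolding fr
      by (auto simp: antihol_subbundle_def sub_space_def)
  qed
qed

lemma norm_tensor: "norm (tensor h v) = norm h * norm v"
proof -
  have "complex_of_real ((norm (tensor h v))\<^sup>2) = complex_of_real ((norm h * norm v)\<^sup>2)"
    by (simp only: cinner_self[symmetric] cinner_tensor power_mult_distrib of_real_mult)
  then show ?thesis unfolding of_real_eq_iff by (rule power2_eq_imp_eq) simp_all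
qed

lemma bounded_bilinear_tensor:
  "bounded_bilinear (tensor :: 'a::complex_inner \<Rightarrow> complex^'q::finite \<Rightarrow> 'a^'q)"
proof
  fix a a' :: 'a and b b' :: "complex^'q" and r :: real
  show "tensor (a + a') b = tensor a b + tensor a' b"
    by (simp add: tensor_def vec_eq_iff scaleC_add_right)
  show "tensor a (b + b') = tensor a b + tensor a b'"
    by (simp add: tensor_def vec_eq_iff scaleC_add_left)
  show "tensor (r *\<^sub>R a) b = r *\<^sub>R tensor a b"
    by (simp add: tensor_def vec_eq_iff scaleR_scaleC scaleC_scaleC scaleC_vec_def mult.commute)
  show "tensor a (r *\<^sub>R b) = r *\<^sub>R tensor a b"
    by (simp add: tensor_def vec_eq_iff scaleR_scaleC scaleC_scaleC scaleC_complex_def scaleC_vec_def)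
next
  show "\<exists>K. \<forall>a b. norm (tensor a b :: 'a^'q) \<le> norm a * norm b * K"
    by (rule exI[of _ 1]) (simp add: norm_tensor)
qed

lemma tensor_scaleC_left: "tensor (c *\<^sub>C h) v = c *\<^sub>C tensor h v"
  by (simp only: tensor_def scaleC_vec_def scaleC_scaleC vec_lambda_beta mult.commute)

lemma tensor_scaleC_right: "tensor h (c *\<^sub>C v) = c *\<^sub>C tensor h v"
  by (simp only: tensor_def scaleC_vec_def scaleC_scaleC scaleC_complex_def vec_lambda_beta)

lemma tensor_eq_0_iff [simp]: "tensor h v = 0 \<longleftrightarrow> h = 0 \<or> v = 0"
  by (auto simp: tensor_def vec_eq_iff)

lemma antihol_at_tensor: "antihol_at f w \<Longrightarrow> antihol_at g w \<Longrightarrow> antihol_at (\<lambda>w. tensor (f w) (g w)) w"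
  by (rule antihol_at_bounded_bilinear[OF bounded_bilinear_tensor _ _ tensor_scaleC_left tensor_scaleC_right])

lemma span_tensor_lines:
  "cvec.span {tensor h v | h v. h \<in> cvec.span {a} \<and> v \<in> cvec.span {b}} = cvec.span {tensor a b}"
proof (rule cvec.span_eq[THEN iffD2], intro conjI)
  show "{tensor h v | h v. h \<in> cvec.span {a} \<and> v \<in> cvec.span {b}} \<subseteq> cvec.span {tensor a b}"
    by (auto simp: cvec.span_singleton tensor_scaleC_left tensor_scaleC_right scaleC_scaleC)
  show "{tensor a b} \<subseteq> cvec.span {tensor h v | h v. h \<in> cvec.span {a} \<and> v \<in> cvec.span {b}}"
    using cvec.span_base[of a "{a}"] cvec.span_base[of b "{b}"] by (auto intro!: cvec.span_base)
qed

definition tensor_family ::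
    "(complex^'n \<Rightarrow> 'a::chilbert_space set) \<Rightarrow> (complex^'n \<Rightarrow> (complex^'q::finite) set) \<Rightarrow>
     complex^'n \<Rightarrow> ('a^'q) set" where
  "tensor_family S L w = cvec.span {tensor h v | h v. h \<in> S w \<and> v \<in> L w}"

lemma tensor_family_span:
  assumes "antihol_line_family \<Omega> S" "antihol_line_family \<Omega> L" "w \<in> \<Omega>"
    "h \<in> S w" "h \<noteq> 0" "v \<in> L w" "v \<noteq> 0"
  shows "tensor_family S L w = cvec.span {tensor h v}"
  using span_tensor_lines[of h v] antihol_line_family_span[OF assms(1,3-5)]
    antihol_line_family_span[OF assms(2,3,6,7)]
  by (simp add: tensor_family_def)

lemma tensor_frame:
  assumes S: "antihol_line_family \<Omega> S" and L: "antihol_line_family \<Omega> L"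
    and s: "(U, s) \<in> frames (antihol_subbundle \<Omega> S)" and t: "(V, t) \<in> frames (antihol_subbundle \<Omega> L)"
  shows "(U \<inter> V, \<lambda>w. tensor (s w) (t w)) \<in> frames (antihol_subbundle \<Omega> (tensor_family S L))"
proof -
  note s = frames_antihol_subbundleD[OF s] and t = frames_antihol_subbundleD[OF t]
  have "tensor (s w) (t w) \<in> tensor_family S L w" if "w \<in> U \<inter> V" for w
    unfolding tensor_family_def using s(4)[of w] t(4)[of w] that by (intro cvec.span_base) auto
  moreover have "antihol_on (U \<inter> V) (\<lambda>w. tensor (s w) (t w))"
    using s(3) t(3) by (auto simp: antihol_on_iff intro: antihol_at_tensor)
  ultimately show ?thesis using s t by (auto simp: antihol_subbundle_def)
qed

lemma antihol_line_family_tensor: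
  assumes S: "antihol_line_family \<Omega> S" and L: "antihol_line_family \<Omega> L"
  shows "antihol_line_family \<Omega> (tensor_family S L)"
  unfolding antihol_line_family_def
proof (intro conjI ballI)
  fix w assume w: "w \<in> \<Omega>"
  obtain U s where s: "w \<in> U" "(U, s) \<in> frames (antihol_subbundle \<Omega> S)"
    using antihol_line_family_frame[OF S w] .
  obtain V t where t: "w \<in> V" "(V, t) \<in> frames (antihol_subbundle \<Omega> L)"
    using antihol_line_family_frame[OF L w] .
  show "\<exists>U s. w \<in> U \<and> (U, s) \<in> frames (antihol_subbundle \<Omega> (tensor_family S L))"
    using tensor_frame[OF S L s(2) t(2)] s(1) t(1) IntI by blast
  show "\<exists>e. e \<noteq> 0 \<and> tensor_family S L w = cvec.span {e}"
    using tensor_family_span[OF S L w, of "s w" "t w"] frames_antihol_subbundleD(4,5)[OF s(2) s(1)]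
      frames_antihol_subbundleD(4,5)[OF t(2) t(1)]
    by (intro exI[of _ "tensor (s w) (t w)"]) simp
qed

section \<open>Curvature of a tensor product of line bundles\<close>

definition log_sq :: "(complex^'n::finite \<Rightarrow> 'a::complex_inner) \<Rightarrow> complex^'n \<Rightarrow> complex" where
  "log_sq s z = complex_of_real (ln (inner (s z) (s z)))"

lemma Ck_on_log_sq:
  fixes s :: "complex^'n::finite \<Rightarrow> 'a::chilbert_space"
  assumes U: "open U" and s: "antihol_on U s" and nz: "\<And>w. w \<in> U \<Longrightarrow> s w \<noteq> 0"
  shows "Ck_on k U (log_sq s)"
proof -
  have "Ck_on k U (\<lambda>w. ln (inner (s w) (s w)))"
    using nz by (intro Ck_on_ln[OF U] antihol_on_Ck_on_sq_norm[OF U s]) simp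
  from Ck_on_bounded_linear[OF U bounded_linear_of_real this]
  show ?thesis by (simp add: log_sq_def[abs_def])
qed

lemma wirtinger_cong:
  assumes "open N" "w \<in> N" "\<And>z. z \<in> N \<Longrightarrow> f z = g z"
  shows "wirtinger i f w = wirtinger i g w" "wirtinger_bar i f w = wirtinger_bar i g w"
  using frechet_derivative_cong_open[OF assms] by (simp_all add: wirtinger_def wirtinger_bar_def)

lemma wirtinger_add:
  assumes "f differentiable at w" "g differentiable at w"
  shows "wirtinger i (\<lambda>z. f z + g z) w = wirtinger i f w + wirtinger i g w"
    and "wirtinger_bar i (\<lambda>z. f z + g z) w = wirtinger_bar i f w + wirtinger_bar i g w"
proof -
  have "frechet_derivative (\<lambda>z. f z + g z) (at w) =
      (\<lambda>v. frechet_derivative f (at w) v + frechet_derivative g (at w) v)"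
    using has_derivative_add[OF assms[unfolded frechet_derivative_works]]
    by (rule frechet_derivative_at[symmetric])
  then show "wirtinger i (\<lambda>z. f z + g z) w = wirtinger i f w + wirtinger i g w"
    "wirtinger_bar i (\<lambda>z. f z + g z) w = wirtinger_bar i f w + wirtinger_bar i g w"
    by (simp_all add: wirtinger_def wirtinger_bar_def field_simps)
qed

lemma wirtinger_bar_differentiable:
  assumes U: "open U" and f: "Ck_on (Suc (Suc 0)) U f" and w: "w \<in> U"
  shows "wirtinger_bar j f differentiable at w"
proof -
  have "(\<lambda>w. frechet_derivative f (at w) v) differentiable at w" for v using f w by simp
  then show ?thesis unfolding wirtinger_bar_def[abs_def]
    by (intro differentiable_divide differentiable_add differentiable_mult differentiable_const) auto
qed

lemma mixed_wirtinger_add: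
  assumes U: "open U" and w: "w \<in> U" and f: "Ck_on (Suc (Suc 0)) U f" and g: "Ck_on (Suc (Suc 0)) U g"
  shows "wirtinger i (wirtinger_bar j (\<lambda>z. f z + g z)) w =
    wirtinger i (wirtinger_bar j f) w + wirtinger i (wirtinger_bar j g) w"
proof -
  have "wirtinger i (wirtinger_bar j (\<lambda>z. f z + g z)) w =
      wirtinger i (\<lambda>z. wirtinger_bar j f z + wirtinger_bar j g z) w"
    using f g by (intro wirtinger_cong[OF U w] wirtinger_add) auto
  also have "\<dots> = wirtinger i (wirtinger_bar j f) w + wirtinger i (wirtinger_bar j g) w"
    by (intro wirtinger_add wirtinger_bar_differentiable[OF U _ w] f g)
  finally show ?thesis .
qed

lemma axis_ii: "axis i \<i> = \<i> *\<^sub>C axis i (1::complex)"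
  by (simp add: vec_eq_iff scaleC_vec_def scaleC_complex_def axis_def)

text \<open>
  For antiholomorphic \<open>g\<close> the function \<open>log |g|\<^sup>2\<close> is pluriharmonic: its \<open>\<partial>/\<partial>w\<^sub>j\<close>-bar is
  \<open>(\<partial>g/\<partial>w\<^sub>j\<close>-bar\<open>)/g\<close>, which is again antiholomorphic and so is killed by \<open>\<partial>/\<partial>w\<^sub>i\<close>.
\<close>

lemma mixed_wirtinger_log_sq_scalar:
  fixes g :: "complex^'n::finite \<Rightarrow> complex"
  assumes U: "open U" and w: "w \<in> U" and g: "antihol_on U g" and nz: "\<And>z. z \<in> U \<Longrightarrow> g z \<noteq> 0"
  shows "wirtinger i (wirtinger_bar j (log_sq g)) w = 0"
proof -
  define q where "q z = frechet_derivative g (at z) (axis j 1) / g z" for z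
  have bar: "wirtinger_bar j (log_sq g) z = q z" if z: "z \<in> U" for z
  proof -
    define D where "D = frechet_derivative g (at z)"
    have D: "(g has_derivative D) (at z)" "\<And>c v. D (c *\<^sub>C v) = cnj c *\<^sub>C D v"
      using antihol_at_derivative[OF antihol_onD[OF g z]] by (auto simp: D_def)
    have pos: "inner (g z) (g z) > 0" using nz[OF z] by simp
    have "((\<lambda>z. ln (inner (g z) (g z))) has_derivative
        (\<lambda>v. (inner (g z) (D v) + inner (D v) (g z)) * inverse (inner (g z) (g z)))) (at z)"
      using has_derivative_ln[OF pos has_derivative_inner[OF D(1) D(1)]]
      by (rule has_derivative_eq_rhs) (simp add: fun_eq_iff)
    then have "(log_sq g has_derivative (\<lambda>v. complex_of_real
        ((inner (g z) (D v) + inner (D v) (g z)) * inverse (inner (g z) (g z))))) (at z)"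
      unfolding log_sq_def[abs_def] by (rule bounded_linear.has_derivative[OF bounded_linear_of_real])
    then have fd: "frechet_derivative (log_sq g) (at z) = (\<lambda>v. complex_of_real
        ((inner (g z) (D v) + inner (D v) (g z)) * inverse (inner (g z) (g z))))"
      by (rule frechet_derivative_at[symmetric])
    define a where "a = g z"
    define b where "b = D (axis j 1)"
    have Dii: "D (axis j \<i>) = - \<i> * b" by (simp add: axis_ii D(2) b_def scaleC_complex_def)
    have a: "a \<noteq> 0" using nz[OF z] by (simp add: a_def)
    have aa: "complex_of_real (inner a a) = a * cnj a"
      using complex_norm_square[of a] by (simp add: power2_norm_eq_inner)
    have half: "(complex_of_real ((x + x) * c) + \<i> * complex_of_real ((y + y) * c)) / 2 =
        complex_of_real c * (complex_of_real x + \<i> * complex_of_real y)" for x y c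
      by (simp add: complex_eq_iff)
    have "wirtinger_bar j (log_sq g) z = complex_of_real (inverse (inner a a)) *
        (complex_of_real (inner a b) + \<i> * complex_of_real (inner a (- \<i> * b)))"
      unfolding wirtinger_bar_def fd Dii a_def[symmetric] b_def[symmetric]
        inner_commute[of b a] inner_commute[of "- \<i> * b" a] by (rule half)
    also have "complex_of_real (inner a b) + \<i> * complex_of_real (inner a (- \<i> * b)) = cnj a * b"
      by (simp add: inner_complex_def complex_eq_iff)
    also have "complex_of_real (inverse (inner a a)) * (cnj a * b) = b / a"
      using a by (simp add: aa field_simps)
    finally show ?thesis by (simp add: q_def a_def b_def D_def)
  qed
  have "antihol_at q w" unfolding q_def
    using antihol_on_directional_derivative[OF U g] g w nz
    by (intro antihol_at_divide) (auto dest: antihol_onD)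
  note q = antihol_at_derivative(2)[OF this]
  have "wirtinger i (wirtinger_bar j (log_sq g)) w = wirtinger i q w"
    by (rule wirtinger_cong(1)[OF U w bar])
  also have "\<dots> = 0" by (simp add: wirtinger_def axis_ii q scaleC_complex_def)
  finally show ?thesis .
qed

definition frame_curvature ::
    "(complex^'n::finite \<Rightarrow> 'a::complex_inner) \<Rightarrow> complex^'n \<Rightarrow> complex^'n \<Rightarrow> complex^'n \<Rightarrow> complex" where
  "frame_curvature s w u v = - (\<Sum>i\<in>UNIV. \<Sum>j\<in>UNIV.
     wirtinger i (wirtinger_bar j (log_sq s)) w * (u $ i * cnj (v $ j) - v $ i * cnj (u $ j)))"

lemma curvature_antihol_subbundle:
  assumes "antihol_line_family \<Omega> S" "w \<in> \<Omega>"
  obtains U s where "w \<in> U" "(U, s) \<in> frames (antihol_subbundle \<Omega> S)"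
    and "curvature (antihol_subbundle \<Omega> S) w = frame_curvature s w"
proof -
  define s where "s = (SOME s. \<exists>U. (U, s) \<in> frames (antihol_subbundle \<Omega> S) \<and> w \<in> U)"
  have "\<exists>s U. (U, s) \<in> frames (antihol_subbundle \<Omega> S) \<and> w \<in> U"
    using antihol_line_family_frame[OF assms] by metis
  then have "\<exists>U. (U, s) \<in> frames (antihol_subbundle \<Omega> S) \<and> w \<in> U" unfolding s_def by (rule someI_ex)
  then obtain U where "w \<in> U" "(U, s) \<in> frames (antihol_subbundle \<Omega> S)" by blast
  moreover have "curvature (antihol_subbundle \<Omega> S) w = frame_curvature s w"
    by (simp add: fun_eq_iff frame_curvature_def curvature_def Let_def s_def[symmetric]
        sq_norm_antihol_subbundle log_sq_def[abs_def])
  ultimately show thesis by (rule that)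
qed

text \<open>
  Any frame of the tensor product is \<open>g\<close> times the tensor product of frames of the factors, with \<open>g\<close>
  antiholomorphic. Norms of elementary tensors multiply, so the logarithms of the squared norms add
  up, apart from the pluriharmonic term \<open>log |g|\<^sup>2\<close>.
\<close>

lemma curvature_tensor:
  assumes S: "antihol_line_family \<Omega> S" and L: "antihol_line_family \<Omega> L" and w: "w \<in> \<Omega>"
  shows "curvature (antihol_subbundle \<Omega> (tensor_family S L)) w u v =
    curvature (antihol_subbundle \<Omega> S) w u v + curvature (antihol_subbundle \<Omega> L) w u v"
proof -
  note T = antihol_line_family_tensor[OF S L]
  obtain U s where s: "w \<in> U" "(U, s) \<in> frames (antihol_subbundle \<Omega> (tensor_family S L))"
    and cs: "curvature (antihol_subbundle \<Omega> (tensor_family S L)) w = frame_curvature s w"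
    using curvature_antihol_subbundle[OF T w] .
  obtain V t where t: "w \<in> V" "(V, t) \<in> frames (antihol_subbundle \<Omega> S)"
    and ct: "curvature (antihol_subbundle \<Omega> S) w = frame_curvature t w"
    using curvature_antihol_subbundle[OF S w] .
  obtain W e where e: "w \<in> W" "(W, e) \<in> frames (antihol_subbundle \<Omega> L)"
    and ce: "curvature (antihol_subbundle \<Omega> L) w = frame_curvature e w"
    using curvature_antihol_subbundle[OF L w] .
  note fs = frames_antihol_subbundleD[OF s(2)] and ft = frames_antihol_subbundleD[OF t(2)]
    and fe = frames_antihol_subbundleD[OF e(2)]
  define N where "N = U \<inter> (V \<inter> W)"
  have N: "open N" "w \<in> N" using s t e fs(1) ft(1) fe(1) by (auto simp: N_def)
  obtain g where g: "antihol_on N g" "\<forall>z\<in>N. s z = g z *\<^sub>C tensor (t z) (e z)"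
    using frames_transition[OF T s(2) tensor_frame[OF S L t(2) e(2)]] by (auto simp: N_def)
  have g0: "g z \<noteq> 0" if "z \<in> N" for z
    using that g(2) fs(5)[of z] by (auto simp: N_def)
  have t0: "t z \<noteq> 0" and e0: "e z \<noteq> 0" if "z \<in> N" for z
    using that ft(5)[of z] fe(5)[of z] by (auto simp: N_def)
  have anti: "antihol_on N t" "antihol_on N e" using ft(3) fe(3) by (auto simp: N_def antihol_on_iff)
  have log: "log_sq s z = log_sq g z + (log_sq t z + log_sq e z)" if z: "z \<in> N" for z
  proof -
    have "inner (s z) (s z) = inner (g z) (g z) * (inner (t z) (t z) * inner (e z) (e z))"
      using g(2) z by (simp add: norm_scaleC norm_tensor power_mult_distrib flip: power2_norm_eq_inner)
    then show ?thesis using g0[OF z] t0[OF z] e0[OF z]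
      by (simp add: log_sq_def ln_mult)
  qed
  have "wirtinger i (wirtinger_bar j (log_sq s)) w =
      wirtinger i (wirtinger_bar j (log_sq t)) w + wirtinger i (wirtinger_bar j (log_sq e)) w" for i j
  proof -
    have Ck: "Ck_on (Suc (Suc 0)) N (log_sq g)" "Ck_on (Suc (Suc 0)) N (log_sq t)"
      "Ck_on (Suc (Suc 0)) N (log_sq e)"
      by (rule Ck_on_log_sq[OF N(1) g(1) g0] Ck_on_log_sq[OF N(1) anti(1) t0]
          Ck_on_log_sq[OF N(1) anti(2) e0]; assumption)+
    have "wirtinger i (wirtinger_bar j (log_sq s)) w =
        wirtinger i (wirtinger_bar j (\<lambda>z. log_sq g z + (log_sq t z + log_sq e z))) w"
      by (intro wirtinger_cong(1)[OF N] wirtinger_cong(2)[OF N(1)] log)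
    also have "\<dots> = wirtinger i (wirtinger_bar j (log_sq g)) w +
        (wirtinger i (wirtinger_bar j (log_sq t)) w + wirtinger i (wirtinger_bar j (log_sq e)) w)"
      by (simp only: mixed_wirtinger_add[OF N Ck(1) Ck_on_add[OF N(1) Ck(2,3)]]
          mixed_wirtinger_add[OF N Ck(2,3)])
    also have "wirtinger i (wirtinger_bar j (log_sq g)) w = 0"
      by (rule mixed_wirtinger_log_sq_scalar[OF N g(1) g0])
    finally show ?thesis by simp
  qed
  then show ?thesis by (simp add: cs ct ce frame_curvature_def distrib_right sum.distrib)
qed

section \<open>Joint eigenspaces of Hilbert modules\<close>

lemma bounded_op_onD:
  assumes "bounded_op_on S T"
  shows "x \<in> S \<Longrightarrow> T x \<in> S" "x \<in> S \<Longrightarrow> y \<in> S \<Longrightarrow> T (x + y) = T x + T y"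
    "x \<in> S \<Longrightarrow> T (c *\<^sub>C x) = c *\<^sub>C T x"
  using assms unfolding bounded_op_on_def by blast+

lemma bounded_op_on_bound:
  assumes "bounded_op_on S T"
  shows "\<exists>K\<ge>0. \<forall>x\<in>S. norm (T x) \<le> K * norm x"
proof -
  obtain K where K: "\<forall>x\<in>S. norm (T x) \<le> K * norm x" using assms unfolding bounded_op_on_def by blast
  have "norm (T x) \<le> \<bar>K\<bar> * norm x" if "x \<in> S" for x
    using K that mult_right_mono[OF abs_ge_self[of K] norm_ge_zero[of x]] order_trans by blast
  then show ?thesis by (intro exI[of _ "\<bar>K\<bar>"]) simp
qed

lemma bounded_op_on_diff:
  assumes "bounded_op_on S T" "cvec.subspace S" "x \<in> S" "y \<in> S"
  shows "T (x - y) = T x - T y"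
  using bounded_op_onD(2)[OF assms(1), of "x - y" y] cvec.subspace_diff[OF assms(2-4)] assms(4)
  by (simp add: algebra_simps)

lemma bounded_op_on_sub_scale:
  assumes T: "bounded_op_on S T" and S: "cvec.subspace S"
  shows "bounded_op_on S (\<lambda>x. T x - c *\<^sub>C x)"
proof -
  obtain K where K: "\<And>x. x \<in> S \<Longrightarrow> norm (T x) \<le> K * norm x" using bounded_op_on_bound[OF T] by blast
  have "norm (T x - c *\<^sub>C x) \<le> (K + cmod c) * norm x" if "x \<in> S" for x
    using norm_triangle_ineq4[of "T x" "c *\<^sub>C x"] K[OF that] by (simp add: norm_scaleC distrib_right)
  moreover have "T x - c *\<^sub>C x \<in> S" if "x \<in> S" for x
    using bounded_op_onD(1)[OF T that] cvec.subspace_diff[OF S] cvec.subspace_scale[OF S that] by blast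
  ultimately show ?thesis
    using bounded_op_onD(2,3)[OF T] unfolding bounded_op_on_def
    by (intro conjI ballI allI exI[of _ "K + cmod c"])
      (simp_all add: scaleC_add_right scaleC_scaleC cvec.scale_right_diff_distrib mult.commute)
qed

lemma hilbert_moduleD:
  assumes "hilbert_module H"
  shows "cvec.subspace (hspace H)" "closed (hspace H)" "bounded_op_on (hspace H) (hact H i)"
    "x \<in> hspace H \<Longrightarrow> hact H i (hact H j x) = hact H j (hact H i x)"
  using assms unfolding hilbert_module_def by blast+

lemma adj_column_in:
  assumes "hilbert_module H" shows "adj_column H w h $ i \<in> hspace H"
  using adjoint_on(1)[OF hilbert_moduleD(1,2)[OF assms] bounded_op_on_sub_scale[OF hilbert_moduleD(3,1)[OF assms]]]
  by (simp add: adj_column_def)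

lemma adj_column_pairing:
  assumes "hilbert_module H" "x \<in> hspace H"
  shows "cinner x (adj_column H w h $ i) = cinner (hact H i x) h - w $ i * cinner x h"
  using adjoint_on(2)[OF hilbert_moduleD(1,2)[OF assms(1)]
      bounded_op_on_sub_scale[OF hilbert_moduleD(3,1)[OF assms(1)]] assms(2), of i "w $ i" h]
  by (simp add: adj_column_def cinner_diff_left cinner_scaleC_left)

lemma adj_column_eqI:
  assumes "hilbert_module H" "\<And>i. z $ i \<in> hspace H"
    and "\<And>i x. x \<in> hspace H \<Longrightarrow> cinner x (z $ i) = cinner (hact H i x) h - w $ i * cinner x h"
  shows "adj_column H w h = z"
proof -
  have "adjoint_on (hspace H) (\<lambda>x. hact H i x - w $ i *\<^sub>C x) h = z $ i" for i
    using hilbert_moduleD(1)[OF assms(1)] assms(2,3)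
    by (intro adjoint_on_eqI) (simp_all add: cinner_diff_left cinner_scaleC_left)
  then show ?thesis by (simp add: adj_column_def vec_eq_iff)
qed

lemma joint_ker_iff:
  assumes "hilbert_module H"
  shows "k \<in> joint_ker H w \<longleftrightarrow> k \<in> hspace H \<and> (\<forall>i. \<forall>x\<in>hspace H. cinner (hact H i x) k = w $ i * cinner x k)"
proof -
  note S = hilbert_moduleD(1)[OF assms]
  have "adj_column H w k = 0 \<longleftrightarrow> (\<forall>i. \<forall>x\<in>hspace H. cinner (hact H i x) k = w $ i * cinner x k)"
  proof
    assume "adj_column H w k = 0"
    then show "\<forall>i. \<forall>x\<in>hspace H. cinner (hact H i x) k = w $ i * cinner x k"
      using adj_column_pairing[OF assms, of _ w k] by simp
  next
    assume "\<forall>i. \<forall>x\<in>hspace H. cinner (hact H i x) k = w $ i * cinner x k"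
    then show "adj_column H w k = 0"
      by (intro adj_column_eqI assms) (simp_all add: cvec.subspace_0[OF S])
  qed
  then show ?thesis by (simp add: joint_ker_def)
qed

lemma subspace_joint_ker:
  assumes "hilbert_module H" shows "cvec.subspace (joint_ker H w)"
proof -
  note S = hilbert_moduleD(1)[OF assms]
  show ?thesis unfolding cvec.subspace_def
    using cvec.subspace_0[OF S] cvec.subspace_add[OF S] cvec.subspace_scale[OF S]
    by (simp add: joint_ker_iff[OF assms] cinner_add_right cinner_right distrib_left)
qed

lemma closure_span_eq_iff:
  fixes S :: "'a::chilbert_space set"
  assumes S: "cvec.subspace S" "closed S" and A: "A \<subseteq> S"
  shows "closure (cvec.span A) = S \<longleftrightarrow> (\<forall>x\<in>S. (\<forall>a\<in>A. cinner x a = 0) \<longrightarrow> x = 0)"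
proof
  assume eq: "closure (cvec.span A) = S"
  show "\<forall>x\<in>S. (\<forall>a\<in>A. cinner x a = 0) \<longrightarrow> x = 0"
  proof (intro ballI impI)
    fix x assume x: "x \<in> S" "\<forall>a\<in>A. cinner x a = 0"
    have "cvec.subspace {y. cinner x y = 0}"
      by (simp add: cvec.subspace_def cinner_add_right cinner_right)
    then have "cvec.span A \<subseteq> {y. cinner x y = 0}" using x(2) by (intro cvec.span_minimal) auto
    moreover have "closed {y. cinner x y = 0}" by (intro closed_Collect_eq continuous_intros)
    ultimately have "closure (cvec.span A) \<subseteq> {y. cinner x y = 0}" by (rule closure_minimal)
    then have "cinner x x = 0" using x(1) eq by blast
    then show "x = 0" by simp
  qed
next
  assume orth: "\<forall>x\<in>S. (\<forall>a\<in>A. cinner x a = 0) \<longrightarrow> x = 0"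
  show "closure (cvec.span A) = S"
  proof (rule closed_subspace_eqI[OF csubspace_closure[OF cvec.subspace_span] closed_closure S(1)])
    show "closure (cvec.span A) \<subseteq> S"
      using cvec.span_minimal[OF A S(1)] S(2) by (rule closure_minimal)
    fix x assume "x \<in> S" and x: "\<And>z. z \<in> closure (cvec.span A) \<Longrightarrow> cinner x z = 0"
    have "cinner x a = 0" if "a \<in> A" for a
      using x closure_subset cvec.span_base[OF that] by blast
    then show "x = 0" using orth \<open>x \<in> S\<close> by blast
  qed
qed

text \<open>
  The analytic part of membership in \<open>B_star\<close>, with the spanning condition in its dual form.
\<close>

definition closed_spanning_module ::
    "(complex^'n::finite) set \<Rightarrow> ('n, 'a::chilbert_space) hilbert_mod \<Rightarrow> bool" where
  "closed_spanning_module \<Omega> H \<longleftrightarrow> hilbert_module H \<and>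
     (\<forall>w\<in>\<Omega>. closed (adj_column H w ` hspace H)) \<and>
     (\<forall>x\<in>hspace H. (\<forall>w\<in>\<Omega>. \<forall>k\<in>joint_ker H w. cinner x k = 0) \<longrightarrow> x = 0)"

lemma B_star_iff:
  "H \<in> B_star m \<Omega> \<longleftrightarrow> closed_spanning_module \<Omega> H \<and> 0 < m \<and> (\<forall>w\<in>\<Omega>. cvec.dim (joint_ker H w) = m)"
proof (cases "hilbert_module H")
  case True
  have "(\<Union>w\<in>\<Omega>. joint_ker H w) \<subseteq> hspace H" by (auto simp: joint_ker_def)
  from closure_span_eq_iff[OF hilbert_moduleD(1,2)[OF True] this]
  have "closure (cvec.span (\<Union>w\<in>\<Omega>. joint_ker H w)) = hspace H \<longleftrightarrow>
      (\<forall>x\<in>hspace H. (\<forall>w\<in>\<Omega>. \<forall>k\<in>joint_ker H w. cinner x k = 0) \<longrightarrow> x = 0)"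
    by simp
  then show ?thesis unfolding B_star_def closed_spanning_module_def by auto
next
  case False
  then show ?thesis by (simp add: B_star_def closed_spanning_module_def)
qed

lemma dim_1_iff:
  fixes V :: "'a::complex_inner set"
  assumes V: "cvec.subspace V"
  shows "cvec.dim V = 1 \<longleftrightarrow> (\<exists>e. e \<noteq> 0 \<and> V = cvec.span {e})"
proof
  assume dim: "cvec.dim V = 1"
  obtain B where B: "B \<subseteq> V" "cvec.independent B" "V \<subseteq> cvec.span B" "card B = cvec.dim V"
    using cvec.basis_exists by blast
  then obtain e where e: "B = {e}" using dim card_1_singletonE by metis
  then have "e \<noteq> 0" using B(2) cvec.dependent_zero by blast
  moreover have "V = cvec.span {e}" using B(1,3) e cvec.span_minimal[OF _ V] by blast
  ultimately show "\<exists>e. e \<noteq> 0 \<and> V = cvec.span {e}" by blast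
next
  assume "\<exists>e. e \<noteq> 0 \<and> V = cvec.span {e}"
  then obtain e where e: "e \<noteq> 0" "V = cvec.span {e}" by blast
  then have "cvec.independent {e}" by (simp add: cvec.dependent_single)
  then show "cvec.dim V = 1" using e by (simp add: cvec.dim_span cvec.dim_eq_card_independent)
qed

lemma B_star_1_iff:
  "H \<in> B_star 1 \<Omega> \<longleftrightarrow> closed_spanning_module \<Omega> H \<and> (\<forall>w\<in>\<Omega>. \<exists>e. e \<noteq> 0 \<and> joint_ker H w = cvec.span {e})"
proof (cases "hilbert_module H")
  case True
  then show ?thesis unfolding B_star_iff dim_1_iff[OF subspace_joint_ker[OF True]] by simp
next
  case False
  then show ?thesis by (simp add: B_star_iff closed_spanning_module_def)
qed

section \<open>Tensor products with a finite-dimensional space\<close>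

lemma norm_vec_le_sum: "norm (x :: 'a::real_normed_vector ^ 'q::finite) \<le> (\<Sum>i\<in>UNIV. norm (x $ i))"
  unfolding norm_vec_def by (rule L2_set_le_sum) simp

lemma hspace_tensor: "f \<in> hspace (tensor_module H) \<longleftrightarrow> (\<forall>r. f $ r \<in> hspace H)"
  by (simp add: tensor_module_def)

lemma hact_tensor: "hact (tensor_module H) i f $ r = hact H i (f $ r)"
  by (simp add: tensor_module_def)

lemma cinner_axis: "cinner x (axis r k :: 'a::complex_inner^'q::finite) = cinner (x $ r) k"
  by (simp add: cinner_vec_def axis_def if_distrib[of "cinner _"] cong: if_cong)

lemma hilbert_module_tensor:
  fixes H :: "('n::finite, 'a::chilbert_space) hilbert_mod"
  assumes H: "hilbert_module H"
  shows "hilbert_module (tensor_module H :: ('n, 'a^'q::finite) hilbert_mod)"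
proof -
  let ?K = "tensor_module H :: ('n, 'a^'q) hilbert_mod"
  note S = hilbert_moduleD[OF H]
  have "cvec.subspace (hspace ?K)"
  proof (rule cvec.subspaceI)
    show "0 \<in> hspace ?K" using cvec.subspace_0[OF S(1)] by (simp add: hspace_tensor)
    show "x + y \<in> hspace ?K" if "x \<in> hspace ?K" "y \<in> hspace ?K" for x y
      using that cvec.subspace_add[OF S(1)] by (simp add: hspace_tensor)
    show "c *\<^sub>C x \<in> hspace ?K" if "x \<in> hspace ?K" for c x
      using that cvec.subspace_scale[OF S(1)] by (simp add: hspace_tensor scaleC_vec_def)
  qed
  moreover have "closed (hspace ?K)"
  proof -
    have "hspace ?K = (\<Inter>r. (\<lambda>f. f $ r) -` hspace H)" by (auto simp: hspace_tensor)
    also have "closed \<dots>" using S(2) by (intro closed_INT ballI closed_vimage continuous_intros)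
    finally show ?thesis .
  qed
  moreover have "bounded_op_on (hspace ?K) (hact ?K i)" for i
  proof -
    obtain C where C: "C \<ge> 0" "\<And>x. x \<in> hspace H \<Longrightarrow> norm (hact H i x) \<le> C * norm x"
      using bounded_op_on_bound[OF S(3)[of i]] by blast
    have "norm (hact ?K i f) \<le> (real CARD('q) * C) * norm f" if f: "f \<in> hspace ?K" for f
    proof -
      have "norm (hact ?K i f) \<le> (\<Sum>r\<in>UNIV. norm (hact ?K i f $ r))" by (rule norm_vec_le_sum)
      also have "\<dots> \<le> (\<Sum>r\<in>(UNIV::'q set). C * norm f)"
      proof (rule sum_mono)
        fix r
        have "norm (hact ?K i f $ r) \<le> C * norm (f $ r)" using C(2) f by (simp add: hact_tensor hspace_tensor)
        also have "\<dots> \<le> C * norm f" by (intro mult_left_mono C Finite_Cartesian_Product.norm_nth_le)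
        finally show "norm (hact ?K i f $ r) \<le> C * norm f" .
      qed
      finally show ?thesis by simp
    qed
    then show ?thesis
      unfolding bounded_op_on_def using bounded_op_onD[OF S(3)]
      by (intro conjI ballI allI exI[of _ "real CARD('q) * C"])
        (simp_all add: vec_eq_iff hact_tensor hspace_tensor scaleC_vec_def)
  qed
  moreover have "hact ?K i (hact ?K j x) = hact ?K j (hact ?K i x)" if "x \<in> hspace ?K" for i j x
    using that S(4) by (simp add: vec_eq_iff hact_tensor hspace_tensor)
  ultimately show ?thesis unfolding hilbert_module_def by blast
qed

lemma adj_column_tensor:
  fixes f :: "'a::chilbert_space^'q::finite"
  assumes H: "hilbert_module H"
  shows "adj_column (tensor_module H) w f = (\<chi> i r. adj_column H w (f $ r) $ i)"
proof (rule adj_column_eqI[OF hilbert_module_tensor[OF H]])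
  show "(\<chi> i r. adj_column H w (f $ r) $ i) $ i \<in> hspace (tensor_module H)" for i
    using adj_column_in[OF H] by (simp add: hspace_tensor)
  fix i and x :: "'a^'q" assume "x \<in> hspace (tensor_module H)"
  then show "cinner x ((\<chi> i r. adj_column H w (f $ r) $ i) $ i) =
      cinner (hact (tensor_module H) i x) f - w $ i * cinner x f"
    using adj_column_pairing[OF H]
    by (simp add: cinner_vec_def hact_tensor hspace_tensor sum_subtractf sum_distrib_left)
qed

lemma joint_ker_tensor:
  fixes f :: "'a::chilbert_space^'q::finite"
  assumes H: "hilbert_module H"
  shows "f \<in> joint_ker (tensor_module H) w \<longleftrightarrow> (\<forall>r. f $ r \<in> joint_ker H w)"
  by (auto simp: joint_ker_def hspace_tensor adj_column_tensor[OF H] vec_eq_iff)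

lemma closed_spanning_tensor:
  fixes H :: "('n::finite, 'a::chilbert_space) hilbert_mod"
  assumes H: "closed_spanning_module \<Omega> H"
  shows "closed_spanning_module \<Omega> (tensor_module H :: ('n, 'a^'q::finite) hilbert_mod)"
proof -
  let ?K = "tensor_module H :: ('n, 'a^'q) hilbert_mod"
  have HM: "hilbert_module H" using H by (simp add: closed_spanning_module_def)
  have "closed (adj_column ?K w ` hspace ?K)" if w: "w \<in> \<Omega>" for w
  proof -
    have cl: "closed (adj_column H w ` hspace H)" using H w by (simp add: closed_spanning_module_def)
    have "adj_column ?K w ` hspace ?K = (\<Inter>r. (\<lambda>g. \<chi> i. g $ i $ r) -` (adj_column H w ` hspace H))"
    proof (intro equalityI subsetI)
      fix g assume "g \<in> adj_column ?K w ` hspace ?K"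
      then obtain f where f: "f \<in> hspace ?K" "g = adj_column ?K w f" by blast
      then have "(\<chi> i. g $ i $ r) = adj_column H w (f $ r)" for r
        by (simp add: adj_column_tensor[OF HM])
      then show "g \<in> (\<Inter>r. (\<lambda>g. \<chi> i. g $ i $ r) -` (adj_column H w ` hspace H))"
        using f(1) by (auto simp: hspace_tensor)
    next
      fix g :: "('a^'q)^'n" assume "g \<in> (\<Inter>r. (\<lambda>g. \<chi> i. g $ i $ r) -` (adj_column H w ` hspace H))"
      then have "\<forall>r. \<exists>h. h \<in> hspace H \<and> (\<chi> i. g $ i $ r) = adj_column H w h" by blast
      then obtain h where h: "\<And>r. h r \<in> hspace H" "\<And>r. (\<chi> i. g $ i $ r) = adj_column H w (h r)" by metis
      have "g = adj_column ?K w (\<chi> r. h r)"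
        by (simp add: adj_column_tensor[OF HM] vec_eq_iff flip: h(2))
      then show "g \<in> adj_column ?K w ` hspace ?K" using h(1) by (auto simp: hspace_tensor)
    qed
    also have "closed \<dots>"
      by (intro closed_INT ballI closed_vimage cl continuous_intros)
    finally show ?thesis .
  qed
  moreover have "x = 0" if x: "x \<in> hspace ?K" "\<forall>w\<in>\<Omega>. \<forall>k\<in>joint_ker ?K w. cinner x k = 0" for x
  proof -
    have "cinner (x $ r) k = 0" if "w \<in> \<Omega>" "k \<in> joint_ker H w" for r w k
    proof -
      have "(axis r k :: 'a^'q) \<in> joint_ker ?K w"
        using that cvec.subspace_0[OF subspace_joint_ker[OF HM]] by (simp add: joint_ker_tensor[OF HM] axis_def)
      then show ?thesis using x(2) that(1) cinner_axis by metis
    qed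
    then have "x $ r = 0" for r
      using H x(1) unfolding closed_spanning_module_def hspace_tensor by blast
    then show ?thesis by (simp add: vec_eq_iff)
  qed
  ultimately show ?thesis using hilbert_module_tensor[OF HM] unfolding closed_spanning_module_def by blast
qed

section \<open>Quotients by complemented submodules\<close>

text \<open>
  Let the submodule be the kernel of a bounded idempotent module map \<open>Q\<close>. The adjoint \<open>J\<close> of \<open>Q\<close>
  is a bounded idempotent onto the orthogonal complement \<open>N\<close> of the submodule, and it commutes with
  the adjoints of the action. So closedness of the ranges and the spanning property descend to
  \<open>N\<close> by applying \<open>J\<close>.
\<close>

lemma closed_spanning_quotient:
  fixes K :: "('n::finite, 'a::chilbert_space) hilbert_mod"
  assumes K: "closed_spanning_module \<Omega> K" and Q: "bounded_op_on (hspace K) Q"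
    and idem: "\<And>x. x \<in> hspace K \<Longrightarrow> Q (Q x) = Q x"
    and comm: "\<And>i x. x \<in> hspace K \<Longrightarrow> Q (hact K i x) = hact K i (Q x)"
    and R_def: "R = {x \<in> hspace K. Q x = 0}"
  shows "closed_spanning_module \<Omega> (quotient_module K R)"
    and "joint_ker (quotient_module K R) w = joint_ker K w \<inter> orth (hspace K) R"
proof -
  have KM: "hilbert_module K" using K by (simp add: closed_spanning_module_def)
  note S = hilbert_moduleD[OF KM]
  define N where "N = orth (hspace K) R"
  let ?H = "quotient_module K R"
  define J where "J = adjoint_on (hspace K) Q"
  have NS: "N \<subseteq> hspace K" by (auto simp: N_def orth_def)
  have N: "cvec.subspace N" "closed N"
    using csubspace_orth[OF S(1)] closed_orth[OF S(2)] by (auto simp: N_def)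
  note proj = proj_on[OF N]
  have hs: "hspace ?H = N" and ha: "hact ?H i f = proj_on N (hact K i f)" for i f
    by (simp_all add: quotient_module_def N_def)
  have J: "J y \<in> hspace K" "x \<in> hspace K \<Longrightarrow> cinner (Q x) y = cinner x (J y)" for x y
    using adjoint_on[OF S(1,2) Q] by (auto simp: J_def)
  have JN: "J y \<in> N" for y
    using J(1)[of y] J(2)[of _ y] cinner_eq_0_sym[of "J y"] by (auto simp: N_def orth_def R_def)
      (metis cinner_zero_left)
  have J_id: "J y = y" if y: "y \<in> N" for y
    unfolding J_def
  proof (rule adjoint_on_eqI[OF S(1)])
    show "y \<in> hspace K" using y NS by blast
    fix x assume x: "x \<in> hspace K"
    note Qx = bounded_op_onD(1)[OF Q x]
    have "x - Q x \<in> R"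
      using x Qx idem[OF x] bounded_op_on_diff[OF Q S(1) x Qx] cvec.subspace_diff[OF S(1) x Qx]
      by (simp add: R_def)
    then have "cinner y (x - Q x) = 0" using y by (simp add: N_def orth_def)
    then show "cinner (Q x) y = cinner x y"
      using cinner_eq_0_sym[of y "x - Q x"] by (simp add: cinner_diff_left)
  qed
  have R_act: "hact K i x \<in> R" if "x \<in> R" for i x
  proof -
    have "hact K i 0 = 0" using bounded_op_onD(3)[OF S(3)[of i] cvec.subspace_0[OF S(1)], of 0] by simp
    then show ?thesis using that comm[of x i] bounded_op_onD(1)[OF S(3)[of i]] by (simp add: R_def)
  qed
  have adj_N: "adj_column K w f $ i \<in> N" if f: "f \<in> N" for w f i
  proof -
    have "cinner r (adj_column K w f $ i) = 0" if r: "r \<in> R" for r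
    proof -
      have "r \<in> hspace K" using r by (simp add: R_def)
      from adj_column_pairing[OF KM this, of w f i]
      show ?thesis
        using f r R_act[OF r, of i] cinner_eq_0_sym[of f] by (simp add: N_def orth_def)
    qed
    then show ?thesis
      using adj_column_in[OF KM] cinner_eq_0_sym by (fastforce simp: N_def orth_def)
  qed
  have adj_pair: "cinner (hact ?H i x) y = cinner (hact K i x) y" if "x \<in> N" "y \<in> N" for x y i
    using proj(2)[OF that(2)] by (simp add: ha)
  \<comment> \<open>The column at the origin consists of the adjoints of the action itself.\<close>
  define T where "T i f = adj_column K 0 f $ i" for i f
  have TN: "T i f \<in> N" if "f \<in> N" for i f using adj_N[OF that] by (simp add: T_def)
  have T: "cinner (hact K i x) f = cinner x (T i f)" if "x \<in> hspace K" for i x f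
    using adj_column_pairing[OF KM that, of 0 f i] by (simp add: T_def)
  have HM: "hilbert_module ?H"
    unfolding hilbert_module_def hs
  proof (intro conjI allI ballI N)
    fix i
    obtain C where C: "C \<ge> 0" "\<And>x. x \<in> hspace K \<Longrightarrow> norm (hact K i x) \<le> C * norm x"
      using bounded_op_on_bound[OF S(3)[of i]] by blast
    have eqN: "x = y" if "x \<in> N" "y \<in> N" "\<And>z. z \<in> N \<Longrightarrow> cinner x z = cinner y z" for x y
      using that(3)[of "x - y"] cvec.subspace_diff[OF N(1) that(1,2)] 
      by (metis cinner_diff_left cinner_self_eq_0 eq_iff_diff_eq_0)
    have HN: "hact ?H i x \<in> N" for i x using proj(1) by (simp add: ha)
    have bound: "norm (hact ?H i x) \<le> C * norm x" if x: "x \<in> N" for x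
    proof -
      let ?y = "hact ?H i x"
      have "(norm ?y)\<^sup>2 = cmod (cinner ?y ?y)" by (simp add: cinner_self norm_power)
      also have "\<dots> = cmod (cinner (hact K i x) ?y)" using adj_pair[OF x HN] by simp
      also have "\<dots> \<le> norm (hact K i x) * norm ?y" by (rule Cauchy_Schwarz_cinner)
      also have "\<dots> \<le> (C * norm x) * norm ?y" using C(2) x NS by (intro mult_right_mono) auto
      finally have "norm ?y * norm ?y \<le> (C * norm x) * norm ?y" by (simp add: power2_eq_square)
      then show ?thesis
        using C(1) by (cases "?y = 0") (simp, subst (asm) mult_le_cancel_right, auto)
    qed
    show "bounded_op_on N (hact ?H i)"
      unfolding bounded_op_on_def
    proof (intro conjI ballI allI exI[of _ C])
      fix x y c assume x: "x \<in> N"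
      show "hact ?H i x \<in> N" by (rule HN)
      show "norm (hact ?H i x) \<le> C * norm x" by (rule bound[OF x])
      show "hact ?H i (c *\<^sub>C x) = c *\<^sub>C hact ?H i x"
        using x NS by (intro eqN HN cvec.subspace_scale[OF N(1)])
          (simp add: adj_pair cvec.subspace_scale[OF N(1)] bounded_op_onD(3)[OF S(3)] cinner_scaleC_left subsetD)
      assume y: "y \<in> N"
      show "hact ?H i (x + y) = hact ?H i x + hact ?H i y"
        using x y NS by (intro eqN HN cvec.subspace_add[OF N(1)])
          (simp add: adj_pair cvec.subspace_add[OF N(1)] bounded_op_onD(2)[OF S(3)] cinner_add_left subsetD)
    qed
    fix j x assume x: "x \<in> N"
    show "hact ?H i (hact ?H j x) = hact ?H j (hact ?H i x)"
    proof (rule eqN[OF HN HN])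
      fix z assume z: "z \<in> N"
      have *: "cinner (hact ?H i (hact ?H j x)) z = cinner (hact K j x) (T i z)" for i j
      proof -
        have "cinner (hact ?H i (hact ?H j x)) z = cinner (hact ?H j x) (T i z)"
          by (simp only: adj_pair[OF HN z] T[OF subsetD[OF NS HN]])
        also have "\<dots> = cinner (hact K j x) (T i z)" by (rule adj_pair[OF x TN[OF z]])
        finally show ?thesis .
      qed
      have **: "cinner (hact K j x) (T i z) = cinner (hact K i (hact K j x)) z" for i j
        using T[of "hact K j x" i z] bounded_op_onD(1)[OF S(3)] x NS by (metis subsetD)
      show "cinner (hact ?H i (hact ?H j x)) z = cinner (hact ?H j (hact ?H i x)) z"
        unfolding * ** using S(4)[of x i j] x NS by (metis subsetD)
    qed
  qed
  have adj_eq: "adj_column ?H w f = adj_column K w f" if f: "f \<in> N" for w f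
    using f adj_N NS
    by (intro adj_column_eqI[OF HM]) (auto simp: hs adj_pair intro!: adj_column_pairing[OF KM])
  have jk: "joint_ker ?H w = joint_ker K w \<inter> N" for w
    using adj_eq NS by (auto simp: joint_ker_def hs)
  then show "joint_ker ?H w = joint_ker K w \<inter> orth (hspace K) R" by (simp add: N_def)
  have J_adj: "J (adj_column K w f $ i) = adj_column K w (J f) $ i" if f: "f \<in> hspace K" for w f i
    unfolding J_def
  proof (rule adjoint_on_eqI[OF S(1) adj_column_in[OF KM]])
    fix x assume x: "x \<in> hspace K"
    note Qx = bounded_op_onD(1)[OF Q x] and Tx = bounded_op_onD(1)[OF S(3) x]
    show "cinner (Q x) (adj_column K w f $ i) = cinner x (adj_column K w (adjoint_on (hspace K) Q f) $ i)"
      unfolding adj_column_pairing[OF KM Qx] adj_column_pairing[OF KM x] J_def[symmetric]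
      using comm[OF x] J(2)[OF x] J(2)[OF Tx] by metis
  qed
  have "closed (adj_column ?H w ` N)" if w: "w \<in> \<Omega>" for w
  proof -
    \<comment> \<open>If \<open>D f\<close> has all its entries in \<open>N\<close>, then \<open>D f = J (D f) = D (J f)\<close>.\<close>
    have "adj_column ?H w ` N = adj_column K w ` hspace K \<inter> (\<Inter>i. (\<lambda>g. g $ i) -` N)"
    proof (intro equalityI subsetI)
      fix g assume "g \<in> adj_column ?H w ` N"
      then show "g \<in> adj_column K w ` hspace K \<inter> (\<Inter>i. (\<lambda>g. g $ i) -` N)"
        using adj_eq adj_N NS by auto
    next
      fix g assume g: "g \<in> adj_column K w ` hspace K \<inter> (\<Inter>i. (\<lambda>g. g $ i) -` N)"
      then obtain f where f: "f \<in> hspace K" "g = adj_column K w f" by blast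
      have "g $ i = adj_column K w (J f) $ i" for i
        using J_id[of "g $ i"] J_adj[OF f(1), of w i] g f(2) by auto
      then have "g = adj_column ?H w (J f)" using adj_eq[OF JN] by (simp add: vec_eq_iff)
      then show "g \<in> adj_column ?H w ` N" using JN by blast
    qed
    also have "closed \<dots>"
      using K w N(2) unfolding closed_spanning_module_def
      by (intro closed_Int closed_INT ballI closed_vimage continuous_intros) auto
    finally show ?thesis .
  qed
  moreover have "x = 0" if x: "x \<in> N" "\<forall>w\<in>\<Omega>. \<forall>k\<in>joint_ker ?H w. cinner x k = 0" for x
  proof -
    have xS: "x \<in> hspace K" using x(1) NS by blast
    have "cinner (Q x) k = 0" if w: "w \<in> \<Omega>" and k: "k \<in> joint_ker K w" for w k
    proof -
      have kS: "k \<in> hspace K" "adj_column K w k = 0" using k by (auto simp: joint_ker_def)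
      have "J 0 = 0" using J_id[of 0] cvec.subspace_0[OF N(1)] by blast
      then have "adj_column K w (J k) = 0" using J_adj[OF kS(1), of w] kS(2) by (simp add: vec_eq_iff)
      then have "J k \<in> joint_ker ?H w" unfolding jk using J(1) JN by (simp add: joint_ker_def)
      then show ?thesis using x(2) w J(2)[OF xS] by simp
    qed
    then have "Q x = 0"
      using K bounded_op_onD(1)[OF Q xS] unfolding closed_spanning_module_def by blast
    then have "x \<in> R" using xS by (simp add: R_def)
    then have "cinner x x = 0" using x(1) by (simp add: N_def orth_def)
    then show ?thesis by simp
  qed
  ultimately show "closed_spanning_module \<Omega> ?H"
    using HM unfolding closed_spanning_module_def hs by blast
qed

section \<open>Local antiholomorphic frames of joint eigenspaces\<close>

lemma adj_column_linear:
  assumes H: "hilbert_module H" and x: "x \<in> hspace H"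
  shows "y \<in> hspace H \<Longrightarrow> adj_column H w (x + y) = adj_column H w x + adj_column H w y"
    and "y \<in> hspace H \<Longrightarrow> adj_column H w (x - y) = adj_column H w x - adj_column H w y"
    and "adj_column H w (c *\<^sub>C x) = c *\<^sub>C adj_column H w x"
proof -
  note S = hilbert_moduleD(1,2)[OF H]
  have B: "bounded_op_on (hspace H) (adjoint_on (hspace H) (\<lambda>x. hact H i x - w $ i *\<^sub>C x))" for i
    by (intro bounded_op_on_adjoint S bounded_op_on_sub_scale hilbert_moduleD(3)[OF H])
  show "y \<in> hspace H \<Longrightarrow> adj_column H w (x + y) = adj_column H w x + adj_column H w y"
    using bounded_op_onD(2)[OF B] x by (simp add: adj_column_def vec_eq_iff)
  show "y \<in> hspace H \<Longrightarrow> adj_column H w (x - y) = adj_column H w x - adj_column H w y"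
    using bounded_op_on_diff[OF B S(1)] x by (simp add: adj_column_def vec_eq_iff)
  show "adj_column H w (c *\<^sub>C x) = c *\<^sub>C adj_column H w x"
    using bounded_op_onD(3)[OF B] x by (simp add: adj_column_def vec_eq_iff scaleC_vec_def)
qed

text \<open>
  The adjoint of the column operator is the row operator \<open>z \<mapsto> \<Sum>\<^sub>i (M\<^sub>i - w\<^sub>i) z\<^sub>i\<close>.
\<close>

lemma adj_column_bounded_below:
  assumes H: "closed_spanning_module \<Omega> H" and w: "w \<in> \<Omega>"
  shows "\<exists>C>0. \<forall>h\<in>hspace H. (\<forall>k\<in>joint_ker H w. cinner h k = 0) \<longrightarrow> norm h \<le> C * norm (adj_column H w h)"
proof -
  have HM: "hilbert_module H" using H by (simp add: closed_spanning_module_def)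
  note S = hilbert_moduleD(1,2)[OF HM]
  have Tw: "bounded_op_on (hspace H) (\<lambda>x. hact H i x - w $ i *\<^sub>C x)" for i
    by (intro bounded_op_on_sub_scale S hilbert_moduleD(3)[OF HM])
  have "\<forall>i. \<exists>K. K \<ge> 0 \<and> (\<forall>h\<in>hspace H. norm (adj_column H w h $ i) \<le> K * norm h)"
    using bounded_op_on_bound[OF bounded_op_on_adjoint[OF S Tw]] by (simp add: adj_column_def)
  then obtain K where K: "\<And>i h. h \<in> hspace H \<Longrightarrow> norm (adj_column H w h $ i) \<le> K i * norm h" by metis
  have bound: "norm (adj_column H w h) \<le> (\<Sum>i\<in>UNIV. K i) * norm h" if "h \<in> hspace H" for h
  proof -
    have "(\<Sum>i\<in>UNIV. norm (adj_column H w h $ i)) \<le> (\<Sum>i\<in>UNIV. K i * norm h)"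
      by (intro sum_mono K that)
    then show ?thesis using norm_vec_le_sum[of "adj_column H w h"] by (simp add: sum_distrib_right)
  qed
  define A where "A z = (\<Sum>i\<in>UNIV. hact H i (z $ i) - w $ i *\<^sub>C z $ i)" for z
  have zS: "z $ i \<in> hspace H" if "z \<in> adj_column H w ` hspace H" for z i
    using that adj_column_in[OF HM] by auto
  have A_in: "A z \<in> hspace H" if "z \<in> adj_column H w ` hspace H" for z
    unfolding A_def using bounded_op_onD(1)[OF Tw zS[OF that]] by (intro cvec.subspace_sum[OF S(1)]) auto
  have A_adj: "cinner (adj_column H w h) z = cinner h (A z)"
    if z: "z \<in> adj_column H w ` hspace H" for z h
  proof -
    have "cinner (adj_column H w h $ i) (z $ i) = cinner h (hact H i (z $ i) - w $ i *\<^sub>C z $ i)" for i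
    proof -
      have "cinner (z $ i) (adj_column H w h $ i) = cinner (hact H i (z $ i) - w $ i *\<^sub>C z $ i) h"
        using adj_column_pairing[OF HM zS[OF z]] by (simp add: cinner_diff_left cinner_scaleC_left)
      then show ?thesis by (metis cinner_commute)
    qed
    then show ?thesis by (simp add: cinner_vec_def A_def cinner_sum_right)
  qed
  have cl: "closed (adj_column H w ` hspace H)" using H w by (simp add: closed_spanning_module_def)
  obtain C where C: "C > 0" "\<And>h. h \<in> hspace H \<Longrightarrow>
      (\<And>k. k \<in> hspace H \<Longrightarrow> adj_column H w k = 0 \<Longrightarrow> cinner h k = 0) \<Longrightarrow> norm h \<le> C * norm (adj_column H w h)"
    by (rule closed_range_bounded_below[OF S adj_column_linear(1)[OF HM] adj_column_linear(3)[OF HM] bound cl A_in A_adj])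
      blast+
  then show ?thesis by (intro exI[of _ C]) (auto simp: joint_ker_def)
qed

definition cnj_vec :: "complex^'n \<Rightarrow> complex^'n" where
  "cnj_vec v = (\<chi> i. cnj (v $ i))"

lemma norm_cnj_vec [simp]: "norm (cnj_vec v) = norm (v :: complex^'n::finite)"
  by (simp add: cnj_vec_def norm_vec_def)

lemma adj_column_eigenvector:
  assumes H: "hilbert_module H" and k: "k \<in> joint_ker H w"
  shows "adj_column H w1 k = tensor k (cnj_vec (w - w1))"
proof (rule adj_column_eqI[OF H])
  have "k \<in> hspace H" using k by (simp add: joint_ker_def)
  then show "tensor k (cnj_vec (w - w1)) $ i \<in> hspace H" for i
    using cvec.subspace_scale[OF hilbert_moduleD(1)[OF H]] by (simp add: tensor_def)
  show "cinner x (tensor k (cnj_vec (w - w1)) $ i) = cinner (hact H i x) k - w1 $ i * cinner x k"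
    if "x \<in> hspace H" for i x
    using k that by (simp add: joint_ker_iff[OF H] tensor_def cnj_vec_def cinner_right left_diff_distrib)
qed

text \<open>
  Let \<open>h w\<close> be unit vectors in the joint eigenspaces and rescale them so that their component along
  \<open>h w\<^sub>1\<close> is fixed. Then \<open>D (g w) = (w - w\<^sub>1)\<close>-bar \<open>g w\<close> for the column operator \<open>D\<close> at \<open>w\<^sub>1\<close>, so
  boundedness below gives \<open>g w - h w\<^sub>1 = O(w - w\<^sub>1)\<close>. Dividing by the increment shows that
  \<open>h w\<^sub>1\<close> in each coordinate slot is a limit of elements of the range of \<open>D\<close>; as the range is closed, it
  has a preimage \<open>\<xi>\<^sub>i\<close>, and the \<open>\<xi>\<^sub>i\<close> are the derivatives of \<open>g\<close> in the conjugate coordinates.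
\<close>

lemma eigenvector_antihol_at:
  fixes H :: "('n::finite, 'a::chilbert_space) hilbert_mod"
  assumes \<Omega>: "open \<Omega>" and H: "closed_spanning_module \<Omega> H" and w1: "w1 \<in> \<Omega>"
    and h: "\<And>w. w \<in> \<Omega> \<Longrightarrow> joint_ker H w = cvec.span {h w}" "\<And>w. w \<in> \<Omega> \<Longrightarrow> norm (h w) = 1"
  shows "\<exists>r>0. ball w1 r \<subseteq> \<Omega> \<and> (\<forall>w\<in>ball w1 r. cinner (h w) (h w1) \<noteq> 0) \<and>
    antihol_at (\<lambda>w. (1 / cinner (h w) (h w1)) *\<^sub>C h w) w1"
proof -
  have HM: "hilbert_module H" using H by (simp add: closed_spanning_module_def)
  note S = hilbert_moduleD(1,2)[OF HM]
  let ?D = "adj_column H w1"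
  define \<gamma> where "\<gamma> = h w1"
  define g where "g w = (1 / cinner (h w) \<gamma>) *\<^sub>C h w" for w
  have jk: "joint_ker H w1 = cvec.span {\<gamma>}" using h(1)[OF w1] by (simp add: \<gamma>_def)
  have hjk: "h w \<in> joint_ker H w" if "w \<in> \<Omega>" for w using h(1)[OF that] cvec.span_base by blast
  have jkS: "x \<in> hspace H" if "x \<in> joint_ker H w" for x w using that by (simp add: joint_ker_def)
  have gjk: "g w \<in> joint_ker H w" if "w \<in> \<Omega>" for w
    unfolding g_def using hjk[OF that] cvec.subspace_scale[OF subspace_joint_ker[OF HM]] by blast
  have gS: "g w \<in> hspace H" if "w \<in> \<Omega>" for w using gjk[OF that] jkS by blast
  have \<gamma>: "\<gamma> \<in> joint_ker H w1" "\<gamma> \<in> hspace H" "cinner \<gamma> \<gamma> = 1" "norm \<gamma> = 1"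
    using hjk[OF w1] jkS h(2)[OF w1] by (auto simp: \<gamma>_def cinner_self)
  have D\<gamma>: "?D \<gamma> = 0" using \<gamma>(1) by (simp add: joint_ker_def)
  obtain C where C: "C > 0" "\<forall>x\<in>hspace H. (\<forall>k\<in>joint_ker H w1. cinner x k = 0) \<longrightarrow> norm x \<le> C * norm (?D x)"
    using adj_column_bounded_below[OF H w1] by blast
  have below: "norm x \<le> C * norm (?D x)" if "x \<in> hspace H" "cinner x \<gamma> = 0" for x
  proof -
    have "\<forall>k\<in>joint_ker H w1. cinner x k = 0"
      using that(2) by (auto simp: jk cvec.span_singleton cinner_right)
    then show ?thesis using C(2) that(1) by blast
  qed
  obtain r0 where r0: "r0 > 0" "ball w1 r0 \<subseteq> \<Omega>" using \<Omega> w1 openE by blast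
  \<comment> \<open>Within this radius \<open>C |w - w\<^sub>1| < 1/2\<close>, so the error terms can be absorbed.\<close>
  define r where "r = min r0 (1 / (2 * C))"
  have r: "r > 0" using r0 C by (simp add: r_def)
  have ball\<Omega>: "w \<in> \<Omega>" if "w \<in> ball w1 r" for w using that r0 by (auto simp: r_def)
  have small: "C * norm (w - w1) < 1/2" if "w \<in> ball w1 r" for w
  proof -
    have "norm (w - w1) < 1 / (2 * C)" using that by (simp add: r_def dist_norm norm_minus_commute)
    then show ?thesis using C(1) by (simp add: field_simps)
  qed
  have p0: "cinner (h w) \<gamma> \<noteq> 0" if w: "w \<in> ball w1 r" for w
  proof
    assume "cinner (h w) \<gamma> = 0"
    then have "norm (h w) \<le> C * norm (?D (h w))" using jkS[OF hjk[OF ball\<Omega>[OF w]]] by (intro below)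
    also have "\<dots> = C * norm (w - w1)"
      using adj_column_eigenvector[OF HM hjk[OF ball\<Omega>[OF w]]] h(2)[OF ball\<Omega>[OF w]] by (simp add: norm_tensor)
    finally show False using small[OF w] h(2)[OF ball\<Omega>[OF w]] by simp
  qed
  define \<eta> where "\<eta> w = g w - \<gamma>" for w
  have \<eta>S: "\<eta> w \<in> hspace H" if "w \<in> ball w1 r" for w
    unfolding \<eta>_def using gS[OF ball\<Omega>[OF that]] \<gamma>(2) by (rule cvec.subspace_diff[OF S(1)])
  have \<eta>\<gamma>: "cinner (\<eta> w) \<gamma> = 0" if "w \<in> ball w1 r" for w
    using p0[OF that] by (simp add: \<eta>_def g_def cinner_diff_left cinner_scaleC_left \<gamma>(3))
  have D\<eta>: "?D (\<eta> w) = tensor (g w) (cnj_vec (w - w1))" if w: "w \<in> ball w1 r" for w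
    unfolding \<eta>_def adj_column_linear(2)[OF HM gS[OF ball\<Omega>[OF w]] \<gamma>(2)] D\<gamma>
    using adj_column_eigenvector[OF HM gjk[OF ball\<Omega>[OF w]]] by simp
  have \<eta>_bound: "norm (\<eta> w) \<le> 2 * C * norm (w - w1)" if w: "w \<in> ball w1 r" for w
  proof -
    have "norm (g w) \<le> 1 + norm (\<eta> w)" using norm_triangle_ineq[of \<gamma> "\<eta> w"] \<gamma>(4) by (simp add: \<eta>_def)
    have "norm (\<eta> w) \<le> C * norm (?D (\<eta> w))" by (rule below[OF \<eta>S[OF w] \<eta>\<gamma>[OF w]])
    also have "\<dots> = (C * norm (w - w1)) * norm (g w)" by (simp add: D\<eta>[OF w] norm_tensor)
    also have "\<dots> \<le> (C * norm (w - w1)) * (1 + norm (\<eta> w))"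
      using C(1) \<open>norm (g w) \<le> _\<close> by (intro mult_left_mono) auto
    also have "\<dots> \<le> C * norm (w - w1) + 1/2 * norm (\<eta> w)"
      using small[OF w] mult_right_mono[of "C * norm (w - w1)" "1/2" "norm (\<eta> w)"]
      by (simp add: distrib_left)
    finally show ?thesis by simp
  qed
  have "\<exists>x. x \<in> hspace H \<and> cinner x \<gamma> = 0 \<and> ?D x = tensor \<gamma> (axis i 1)" for i
  proof -
    have cl: "closed (?D ` hspace H)" using H w1 by (simp add: closed_spanning_module_def)
    have "tensor \<gamma> (axis i 1) \<in> ?D ` hspace H"
      unfolding closed_approachable[OF cl, symmetric]
    proof (intro allI impI)
      fix e :: real assume e: "e > 0"
      \<comment> \<open>An increment for which \<open>w\<close> stays in the ball and the error \<open>2 C t\<close> is below \<open>e\<close>.\<close>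
      define t where "t = min (r / 2) (e / (4 * C))"
      have t: "t > 0" "t < r" using r e C by (auto simp: t_def)
      have "2 * C * t \<le> 2 * C * (e / (4 * C))" using C by (intro mult_left_mono) (auto simp: t_def)
      then have te: "2 * C * t < e" using C(1) e by simp
      define w where "w = w1 + t *\<^sub>R axis i (1::complex)"
      have nw: "norm (w - w1) = t" using t by (simp add: w_def norm_axis_1)
      have w: "w \<in> ball w1 r" using nw t by (simp add: dist_norm norm_minus_commute)
      have "cnj_vec (w - w1) = complex_of_real t *\<^sub>C axis i 1"
        by (simp add: w_def cnj_vec_def vec_eq_iff scaleC_vec_def scaleC_complex_def axis_def complex_eq_iff)
      then have "?D ((1 / complex_of_real t) *\<^sub>C \<eta> w) = tensor (g w) (axis i 1)"
        using t(1) by (simp add: adj_column_linear(3)[OF HM \<eta>S[OF w]] D\<eta>[OF w] tensor_scaleC_right scaleC_scaleC)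
      moreover have "(1 / complex_of_real t) *\<^sub>C \<eta> w \<in> hspace H"
        by (rule cvec.subspace_scale[OF S(1) \<eta>S[OF w]])
      moreover have "dist (tensor (g w) (axis i 1)) (tensor \<gamma> (axis i 1)) < e"
      proof -
        have "dist (tensor (g w) (axis i 1)) (tensor \<gamma> (axis i 1)) = norm (tensor (\<eta> w) (axis i (1::complex)))"
          by (simp add: dist_norm \<eta>_def bounded_bilinear.diff_left[OF bounded_bilinear_tensor])
        also have "\<dots> \<le> 2 * C * t" using \<eta>_bound[OF w] by (simp add: norm_tensor norm_axis_1 nw)
        finally show ?thesis using te by simp
      qed
      ultimately show "\<exists>y\<in>?D ` hspace H. dist y (tensor \<gamma> (axis i 1)) < e" by (metis imageI)
    qed
    then obtain x where x: "x \<in> hspace H" "?D x = tensor \<gamma> (axis i 1)" by (metis imageE)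
    have c\<gamma>: "cinner x \<gamma> *\<^sub>C \<gamma> \<in> hspace H" by (rule cvec.subspace_scale[OF S(1) \<gamma>(2)])
    show ?thesis
    proof (intro exI[of _ "x - cinner x \<gamma> *\<^sub>C \<gamma>"] conjI)
      show "x - cinner x \<gamma> *\<^sub>C \<gamma> \<in> hspace H" by (rule cvec.subspace_diff[OF S(1) x(1) c\<gamma>])
      show "cinner (x - cinner x \<gamma> *\<^sub>C \<gamma>) \<gamma> = 0" by (simp add: cinner_diff_left cinner_scaleC_left \<gamma>(3))
      show "?D (x - cinner x \<gamma> *\<^sub>C \<gamma>) = tensor \<gamma> (axis i 1)"
        by (simp add: adj_column_linear(2)[OF HM x(1) c\<gamma>] adj_column_linear(3)[OF HM \<gamma>(2)] D\<gamma> x(2))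
    qed
  qed
  then obtain \<xi> where \<xi>: "\<And>i. \<xi> i \<in> hspace H" "\<And>i. cinner (\<xi> i) \<gamma> = 0" "\<And>i. ?D (\<xi> i) = tensor \<gamma> (axis i 1)"
    by metis
  define L where "L v = (\<Sum>i\<in>UNIV. cnj (v $ i) *\<^sub>C \<xi> i)" for v :: "complex^'n"
  have LS: "L v \<in> hspace H" for v
    unfolding L_def by (intro cvec.subspace_sum[OF S(1)] cvec.subspace_scale[OF S(1)] \<xi>)
  have L\<gamma>: "cinner (L v) \<gamma> = 0" for v by (simp add: L_def cinner_sum_left cinner_scaleC_left \<xi>(2))
  have DL: "?D (L v) = tensor \<gamma> (cnj_vec v)" for v
  proof (rule adj_column_eqI[OF HM])
    show "tensor \<gamma> (cnj_vec v) $ i \<in> hspace H" for i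
      using cvec.subspace_scale[OF S(1) \<gamma>(2)] by (simp add: tensor_def)
    fix i x assume x: "x \<in> hspace H"
    have "cinner (hact H i x) (L v) - w1 $ i * cinner x (L v) =
        (\<Sum>j\<in>UNIV. v $ j * (cinner (hact H i x) (\<xi> j) - w1 $ i * cinner x (\<xi> j)))"
      by (simp add: L_def cinner_sum_right cinner_right sum_distrib_left sum_subtractf algebra_simps)
    also have "\<dots> = (\<Sum>j\<in>UNIV. v $ j * cinner x (tensor \<gamma> (axis j 1) $ i))"
      by (simp only: adj_column_pairing[OF HM x, symmetric] \<xi>(3))
    also have "\<dots> = (\<Sum>j\<in>UNIV. if i = j then v $ j * cinner x \<gamma> else 0)"
      by (intro sum.cong refl) (simp add: tensor_def axis_def)
    also have "\<dots> = cinner x (tensor \<gamma> (cnj_vec v) $ i)"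
      by (simp add: tensor_def cnj_vec_def cinner_right)
    finally show "cinner x (tensor \<gamma> (cnj_vec v) $ i) = cinner (hact H i x) (L v) - w1 $ i * cinner x (L v)" by simp
  qed
  have L_scale: "L (c *\<^sub>C v) = cnj c *\<^sub>C L v" for c v
    by (simp add: L_def cvec.scale_sum_right scaleC_vec_def scaleC_complex_def scaleC_scaleC)
  have "linear L"
  proof (rule linearI)
    show "L (u + v) = L u + L v" for u v
      by (simp add: L_def scaleC_add_left sum.distrib)
    show "L (a *\<^sub>R v) = a *\<^sub>R L v" for a v
      using L_scale[of "complex_of_real a" v] by (simp add: scaleR_scaleC)
  qed
  then have bL: "bounded_linear L" by (simp add: linear_conv_bounded_linear)
  have g\<gamma>: "g w1 = \<gamma>" by (simp add: g_def \<gamma>(3) flip: \<gamma>_def)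
  have "(g has_derivative L) (at w1)"
  proof (rule has_derivativeI_sandwich[where e = r and H = "\<lambda>y. 2 * C * C * norm (y - w1)"])
    fix w assume ww: "w \<noteq> w1" "dist w w1 < r"
    have w: "w \<in> ball w1 r" using ww by (simp add: dist_commute)
    have "norm (\<eta> w - L (w - w1)) \<le> C * norm (?D (\<eta> w - L (w - w1)))"
      using \<eta>\<gamma>[OF w] L\<gamma> by (intro below cvec.subspace_diff[OF S(1) \<eta>S[OF w] LS]) (simp add: cinner_diff_left)
    also have "?D (\<eta> w - L (w - w1)) = tensor (\<eta> w) (cnj_vec (w - w1))"
      unfolding adj_column_linear(2)[OF HM \<eta>S[OF w] LS] D\<eta>[OF w] DL
      by (simp add: \<eta>_def bounded_bilinear.diff_left[OF bounded_bilinear_tensor])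
    also have "C * norm (tensor (\<eta> w) (cnj_vec (w - w1))) = C * norm (\<eta> w) * norm (w - w1)"
      by (simp add: norm_tensor)
    also have "\<dots> \<le> C * (2 * C * norm (w - w1)) * norm (w - w1)"
      using C(1) \<eta>_bound[OF w] by (intro mult_right_mono mult_left_mono) auto
    finally show "norm (g w - g w1 - L (w - w1)) / norm (w - w1) \<le> 2 * C * C * norm (w - w1)"
      using ww(1) by (simp add: g\<gamma> \<eta>_def field_simps)
  next
    have "((\<lambda>y. 2 * C * C * norm (y - w1)) \<longlongrightarrow> 2 * C * C * norm (w1 - w1)) (at w1)" by (intro tendsto_intros)
    then show "((\<lambda>y. 2 * C * C * norm (y - w1)) \<longlongrightarrow> 0) (at w1)" by simp
  qed (use r bL in auto)
  then have "antihol_at g w1" using L_scale by (rule antihol_atI)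
  then show ?thesis using r ball\<Omega> p0 unfolding g_def[abs_def] \<gamma>_def by (intro exI[of _ r]) auto
qed

text \<open>
  The eigenvectors normalised against \<open>h w\<^sub>0\<close> form a section near \<open>w\<^sub>0\<close>. Near any other point \<open>w\<^sub>1\<close> it
  arises by rescaling the eigenvectors normalised against \<open>h w\<^sub>1\<close>, whose antiholomorphy at
  \<open>w\<^sub>1\<close> is known.
\<close>

lemma antihol_line_family_joint_ker:
  fixes H :: "('n::finite, 'a::chilbert_space) hilbert_mod"
  assumes \<Omega>: "open \<Omega>" and H: "H \<in> B_star 1 \<Omega>"
  shows "antihol_line_family \<Omega> (joint_ker H)"
proof -
  have cs: "closed_spanning_module \<Omega> H" and lines: "\<And>w. w \<in> \<Omega> \<Longrightarrow> \<exists>e. e \<noteq> 0 \<and> joint_ker H w = cvec.span {e}"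
    using H unfolding B_star_1_iff by blast+
  have "\<exists>e. norm e = 1 \<and> joint_ker H w = cvec.span {e}" if w: "w \<in> \<Omega>" for w
  proof -
    obtain e where e: "e \<noteq> 0" "joint_ker H w = cvec.span {e}" using lines[OF w] by blast
    let ?u = "complex_of_real (1 / norm e) *\<^sub>C e"
    have "norm ?u = 1" using e(1) by (simp add: norm_scaleC norm_divide)
    moreover have "cvec.span {?u} = cvec.span {e}"
      using e(1) by (intro span_singleton_eq cvec.span_scale cvec.span_base) auto
    ultimately show ?thesis using e(2) by metis
  qed
  then obtain h where h: "\<And>w. w \<in> \<Omega> \<Longrightarrow> norm (h w) = 1" "\<And>w. w \<in> \<Omega> \<Longrightarrow> joint_ker H w = cvec.span {h w}" by metis
  note at = eigenvector_antihol_at[OF \<Omega> cs _ h(2,1)]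
  show ?thesis unfolding antihol_line_family_def
  proof (intro conjI ballI)
    fix w0 assume w0: "w0 \<in> \<Omega>"
    show "\<exists>e. e \<noteq> 0 \<and> joint_ker H w0 = cvec.span {e}" by (rule lines[OF w0])
    obtain r where r: "r > 0" "ball w0 r \<subseteq> \<Omega>" "\<And>w. w \<in> ball w0 r \<Longrightarrow> cinner (h w) (h w0) \<noteq> 0"
      using at[OF w0] by blast
    define s where "s w = (1 / cinner (h w) (h w0)) *\<^sub>C h w" for w
    have "antihol_on (ball w0 r) s"
    proof (rule antihol_onI)
      fix w1 assume w1: "w1 \<in> ball w0 r"
      then have w1\<Omega>: "w1 \<in> \<Omega>" using r(2) by blast
      define g where "g w = (1 / cinner (h w) (h w1)) *\<^sub>C h w" for w
      obtain r1 where r1: "r1 > 0" "\<And>w. w \<in> ball w1 r1 \<Longrightarrow> cinner (h w) (h w1) \<noteq> 0" and g: "antihol_at g w1"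
        using at[OF w1\<Omega>] unfolding g_def[abs_def] by blast
      have "cinner (h w1) (h w1) = 1" using h(1)[OF w1\<Omega>] by (simp add: cinner_self)
      then have g1: "g w1 = h w1" by (simp add: g_def)
      show "antihol_at s w1"
      proof (rule antihol_at_cong[where f = "\<lambda>w. (1 / cinner (g w) (h w0)) *\<^sub>C g w" and U = "ball w1 r1"])
        show "antihol_at (\<lambda>w. (1 / cinner (g w) (h w0)) *\<^sub>C g w) w1"
          using r(3)[OF w1]
          by (intro antihol_at_scaleC antihol_at_divide antihol_at_const antihol_at_cinner_const g) (simp add: g1)
        show "s w = (1 / cinner (g w) (h w0)) *\<^sub>C g w" if "w \<in> ball w1 r1" for w
          using r1(2)[OF that] by (simp add: s_def g_def cinner_scaleC_left scaleC_scaleC)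
      qed (use r1 in auto)
    qed
    moreover have "s w \<in> joint_ker H w" "s w \<noteq> 0" if w: "w \<in> ball w0 r" for w
    proof -
      have w\<Omega>: "w \<in> \<Omega>" using w r(2) by blast
      show "s w \<in> joint_ker H w"
        unfolding s_def h(2)[OF w\<Omega>] by (intro cvec.span_scale cvec.span_base) simp
      show "s w \<noteq> 0" using r(3)[OF w] by (auto simp: s_def)
    qed
    ultimately have "(ball w0 r, s) \<in> frames (antihol_subbundle \<Omega> (joint_ker H))"
      using r(2) by (simp add: antihol_subbundle_def)
    then show "\<exists>U s. w0 \<in> U \<and> (U, s) \<in> frames (antihol_subbundle \<Omega> (joint_ker H))"
      using r(1) centre_in_ball by blast
  qed
qed

section \<open>Left invertible matrices of corank one\<close>

definition conj_transpose :: "complex^'l^'q \<Rightarrow> complex^'q^'l" where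
  "conj_transpose A = (\<chi> j i. cnj (A $ i $ j))"

lemma cinner_conj_transpose:
  fixes A :: "complex^'l::finite^'q::finite"
  shows "cinner (A *v u) v = cinner u (conj_transpose A *v v)"
proof -
  have "cinner (A *v u) v = (\<Sum>i\<in>UNIV. \<Sum>j\<in>UNIV. A $ i $ j * u $ j * cnj (v $ i))"
    by (simp add: cinner_vec_def cinner_complex_def matrix_vector_mult_def sum_distrib_right)
  also have "\<dots> = (\<Sum>j\<in>UNIV. \<Sum>i\<in>UNIV. A $ i $ j * u $ j * cnj (v $ i))" by (rule sum.swap)
  also have "\<dots> = cinner u (conj_transpose A *v v)"
    by (simp add: cinner_vec_def cinner_complex_def matrix_vector_mult_def conj_transpose_def
        sum_distrib_left cnj_sum mult_ac)
  finally show ?thesis .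
qed

lemma conj_transpose_mult:
  fixes A :: "complex^'l::finite^'q::finite" and B :: "complex^'q^'m::finite"
  shows "conj_transpose A ** conj_transpose B = conj_transpose (B ** A)"
  by (simp add: conj_transpose_def matrix_matrix_mult_def vec_eq_iff cnj_sum mult.commute)

lemma conj_transpose_mat_1 [simp]: "conj_transpose (mat 1) = mat 1"
  by (simp add: conj_transpose_def mat_def vec_eq_iff)

lemma mem_orth_range_iff:
  fixes A :: "complex^'l::finite^'q::finite"
  shows "v \<in> orth UNIV (range ((*v) A)) \<longleftrightarrow> conj_transpose A *v v = 0"
proof -
  have "cinner v (A *v u) = 0 \<longleftrightarrow> cinner u (conj_transpose A *v v) = 0" for u
    using cinner_eq_0_sym[of v "A *v u"] cinner_conj_transpose[of A u v] by simp
  then have "v \<in> orth UNIV (range ((*v) A)) \<longleftrightarrow> (\<forall>u. cinner u (conj_transpose A *v v) = 0)"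
    by (simp add: orth_def)
  also have "\<dots> \<longleftrightarrow> conj_transpose A *v v = 0"
    using cinner_self_eq_0[of "conj_transpose A *v v"] cinner_zero_right by metis
  finally show ?thesis .
qed

lemma scaleC_eq_smult: "c *\<^sub>C v = c *s (v :: complex^'q::finite)"
  by (simp add: vec_eq_iff scaleC_vec_def scaleC_complex_def)

lemma matrix_vector_mult_scaleC:
  fixes A :: "complex^'l::finite^'q::finite"
  shows "A *v (c *\<^sub>C u) = c *\<^sub>C (A *v u)"
  by (simp add: scaleC_eq_smult vector_scalar_commute)

lemma subspace_range_matrix:
  fixes A :: "complex^'l::finite^'q::finite"
  shows "cvec.subspace (range ((*v) A))"
proof (rule cvec.subspaceI)
  show "0 \<in> range ((*v) A)" by (rule range_eqI[of _ _ 0]) simp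
next
  fix x y assume "x \<in> range ((*v) A)" "y \<in> range ((*v) A)"
  then obtain u v where uv: "x = A *v u" "y = A *v v" by blast
  show "x + y \<in> range ((*v) A)"
    by (rule range_eqI[of _ _ "u + v"]) (simp add: uv matrix_vector_right_distrib)
next
  fix c x assume "x \<in> range ((*v) A)"
  then obtain u where u: "x = A *v u" by blast
  show "c *\<^sub>C x \<in> range ((*v) A)"
    by (rule range_eqI[of _ _ "c *\<^sub>C u"]) (simp add: u matrix_vector_mult_scaleC)
qed

lemma closed_csubspace_finite_dim:
  fixes R :: "(complex^'q::finite) set"
  assumes "cvec.subspace R" shows "closed R"
proof (rule closed_subspace)
  show "subspace R"
    using cvec.subspace_0[OF assms] cvec.subspace_add[OF assms] cvec.subspace_scale[OF assms]
    by (intro subspaceI) (simp_all add: scaleR_scaleC)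
qed

text \<open>
  Conjugate transposition turns the left inverse \<open>B\<close> of \<open>A\<close> into a right inverse of \<open>A\<^sup>*\<close>, so the
  whole space is the direct sum of the kernel of \<open>A\<^sup>*\<close> and of a space of dimension \<open>l\<close>.
\<close>

lemma orth_range_line:
  fixes A :: "complex^'l::finite^'q::finite" and B :: "complex^'q^'l"
  assumes inv: "B ** A = mat 1" and card: "CARD('q) = CARD('l) + 1"
  shows "\<exists>e. e \<noteq> 0 \<and> orth UNIV (range ((*v) A)) = cvec.span {e}"
proof -
  let ?A = "conj_transpose A" and ?B = "conj_transpose B"
  define V where "V = {v. ?A *v v = 0}"
  define W where "W = range ((*v) ?B)"
  have AB: "?A *v (?B *v x) = x" for x
    by (simp add: matrix_vector_mul_assoc conj_transpose_mult inv)
  have V: "vec.subspace V"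
    unfolding V_def by (rule vec.subspaceI) (simp_all add: matrix_vector_right_distrib vector_scalar_commute)
  have W: "vec.subspace W"
    using vec.subspace_UNIV vec.subspace_image unfolding W_def by blast
  have "inj ((*v) ?B)" using AB by (metis injI)
  then have dW: "vec.dim W = CARD('l)"
    unfolding W_def using vec.dim_image_eq[OF matrix_vector_mul_linear_gen, of ?B UNIV]
    unfolding vec_dim_card by (simp add: inj_on_subset)
  have "V \<inter> W \<subseteq> {0}" using AB by (auto simp: V_def W_def)
  then have dVW: "vec.dim (V \<inter> W) = 0" by simp
  have sums: "{x + y |x y. x \<in> V \<and> y \<in> W} = UNIV"
  proof -
    have "\<exists>x y. v = x + y \<and> x \<in> V \<and> y \<in> W" for v
      by (rule exI[of _ "v - ?B *v (?A *v v)"], rule exI[of _ "?B *v (?A *v v)"])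
        (simp add: V_def W_def matrix_vector_mult_diff_distrib AB)
    then show ?thesis by blast
  qed
  have "vec.dim V = 1"
    using vec.dim_sums_Int[OF V W] vec_dim_card[where 'a = complex and 'n = 'q] card dW dVW
    unfolding sums by linarith
  then obtain E where E: "E \<subseteq> V" "vec.independent E" "V \<subseteq> vec.span E" "card E = 1"
    using vec.basis_exists by metis
  then obtain e where e: "E = {e}" using card_1_singletonE by blast
  have "e \<noteq> 0" using E(2) e vec.dependent_zero by blast
  moreover have "V = vec.span {e}" using E(1,3) e vec.span_minimal[OF _ V] by blast
  then have "V = cvec.span {e}"
    by (simp add: vec.span_singleton cvec.span_singleton scaleC_eq_smult)
  moreover have "orth UNIV (range ((*v) A)) = V" by (auto simp: mem_orth_range_iff V_def)
  ultimately show ?thesis by blast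
qed

section \<open>Hermitian quotients of a finite-dimensional space\<close>

text \<open>
  The component orthogonal to a closed subspace \<open>R\<close>, which is the element of least norm in the coset
  of \<open>v\<close>.
\<close>

definition residual :: "'a::chilbert_space set \<Rightarrow> 'a \<Rightarrow> 'a" where
  "residual R v = v - proj_on R v"

lemma residual:
  assumes "cvec.subspace R" "closed R"
  shows "v - residual R v \<in> R" "residual R v \<in> orth UNIV R"
  using proj_on[OF assms] by (auto simp: residual_def orth_def cinner_diff_left)

lemma residual_eqI:
  assumes "cvec.subspace R" "v - y \<in> R" "y \<in> orth UNIV R"
  shows "residual R v = y"
proof -
  have "proj_on R v = v - y" using assms by (intro proj_on_eqI) (auto simp: orth_def)
  then show ?thesis by (simp add: residual_def)
qed

lemma residual_add:
  assumes "cvec.subspace R" "closed R"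
  shows "residual R (u + v) = residual R u + residual R v"
proof (rule residual_eqI[OF assms(1)])
  show "u + v - (residual R u + residual R v) \<in> R"
    using cvec.subspace_add[OF assms(1) residual(1)[OF assms, of u] residual(1)[OF assms, of v]]
    by (simp add: algebra_simps)
  show "residual R u + residual R v \<in> orth UNIV R"
    by (intro cvec.subspace_add csubspace_orth cvec.subspace_UNIV residual(2)[OF assms])
qed

lemma residual_scaleC:
  assumes "cvec.subspace R" "closed R"
  shows "residual R (c *\<^sub>C v) = c *\<^sub>C residual R v"
proof (rule residual_eqI[OF assms(1)])
  show "c *\<^sub>C v - c *\<^sub>C residual R v \<in> R"
    using cvec.subspace_scale[OF assms(1) residual(1)[OF assms, of v], of c]
    by (simp add: cvec.scale_right_diff_distrib)
  show "c *\<^sub>C residual R v \<in> orth UNIV R"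
    by (intro cvec.subspace_scale csubspace_orth cvec.subspace_UNIV residual(2)[OF assms])
qed

lemma mem_coset_iff:
  assumes "cvec.subspace R" shows "x \<in> coset R v \<longleftrightarrow> x - v \<in> R"
proof
  assume "x - v \<in> R"
  then show "x \<in> coset R v" unfolding coset_def by (intro image_eqI[of _ _ "x - v"]) simp_all
qed (auto simp: coset_def)

lemma coset_eq_iff:
  assumes R: "cvec.subspace R" shows "coset R u = coset R v \<longleftrightarrow> u - v \<in> R"
proof
  assume "coset R u = coset R v"
  then have "u \<in> coset R v" using mem_coset_iff[OF R, of u u] cvec.subspace_0[OF R] by simp
  then show "u - v \<in> R" by (simp add: mem_coset_iff[OF R])
next
  assume uv: "u - v \<in> R"
  have "x - u \<in> R \<longleftrightarrow> x - v \<in> R" for x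
    using cvec.subspace_add[OF R, of "x - u" "u - v"] cvec.subspace_diff[OF R, of "x - v" "u - v"] uv
    by auto
  then show "coset R u = coset R v" by (auto simp: mem_coset_iff[OF R])
qed

lemma coset_0: "coset R 0 = R"
  by (simp add: coset_def)

lemma least_elem_coset:
  assumes R: "cvec.subspace R" "closed R"
  shows "least_elem (coset R v) = residual R v"
  unfolding least_elem_def
proof (rule the_equality)
  have "residual R v - v \<in> R" using cvec.subspace_neg[OF R(1) residual(1)[OF R, of v]] by simp
  then have mem: "residual R v \<in> coset R v" by (simp add: mem_coset_iff[OF R(1)])
  have Pyth: "(norm b)\<^sup>2 = (norm (residual R v))\<^sup>2 + (norm (b - residual R v))\<^sup>2" if b: "b \<in> coset R v" for b
  proof -
    have "b - residual R v = (b - v) + (v - residual R v)" by simp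
    also have "\<dots> \<in> R"
      using b residual(1)[OF R] by (intro cvec.subspace_add[OF R(1)]) (simp_all add: mem_coset_iff[OF R(1)])
    finally have "cinner (residual R v) (b - residual R v) = 0"
      using residual(2)[OF R, of v] by (simp add: orth_def)
    then have "orthogonal (residual R v) (b - residual R v)"
      by (simp add: orthogonal_def inner_eq_Re_cinner)
    from norm_add_Pythagorean[OF this] show ?thesis by simp
  qed
  have min: "norm (residual R v) \<le> norm b" if "b \<in> coset R v" for b
  proof (rule power2_le_imp_le)
    show "(norm (residual R v))\<^sup>2 \<le> (norm b)\<^sup>2" unfolding Pyth[OF that] by simp
  qed simp
  then show "residual R v \<in> coset R v \<and> (\<forall>b\<in>coset R v. norm (residual R v) \<le> norm b)" using mem by blast
  fix a assume a: "a \<in> coset R v \<and> (\<forall>b\<in>coset R v. norm a \<le> norm b)"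
  then have "a \<in> coset R v" "norm a = norm (residual R v)" using mem min[of a] by (auto intro: order_antisym)
  then have "(norm (a - residual R v))\<^sup>2 = 0" using Pyth[of a] by simp
  then show "a = residual R v" by simp
qed

context
  fixes R :: "(complex^'q::finite) set"
  assumes R: "cvec.subspace R"
begin

lemma quotient_space_add:
  "hadd (quotient_space R) (coset R u) (coset R v) = coset R (u + v)"
proof -
  have "{a + b |a b. a \<in> coset R u \<and> b \<in> coset R v} = coset R (u + v)"
  proof (intro equalityI subsetI)
    fix x assume "x \<in> {a + b |a b. a \<in> coset R u \<and> b \<in> coset R v}"
    then obtain a b where ab: "x = a + b" "a - u \<in> R" "b - v \<in> R" by (auto simp: mem_coset_iff[OF R])
    have eq: "x - (u + v) = (a - u) + (b - v)" using ab(1) by simp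
    show "x \<in> coset R (u + v)"
      unfolding mem_coset_iff[OF R] eq by (rule cvec.subspace_add[OF R ab(2,3)])
  next
    fix x assume "x \<in> coset R (u + v)"
    then have "x - v \<in> coset R u" "v \<in> coset R v"
      using cvec.subspace_0[OF R] by (simp_all add: mem_coset_iff[OF R] algebra_simps)
    then show "x \<in> {a + b |a b. a \<in> coset R u \<and> b \<in> coset R v}"
      by (intro CollectI exI[of _ "x - v"] exI[of _ v]) simp
  qed
  then show ?thesis by (simp add: quotient_space_def)
qed

lemma quotient_space_scale:
  "hscale (quotient_space R) c (coset R v) = coset R (c *\<^sub>C v)"
proof -
  have "{c *\<^sub>C a + r |a r. a \<in> coset R v \<and> r \<in> R} = coset R (c *\<^sub>C v)"
  proof (intro equalityI subsetI)
    fix x assume "x \<in> {c *\<^sub>C a + r |a r. a \<in> coset R v \<and> r \<in> R}"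
    then obtain a r where ar: "x = c *\<^sub>C a + r" "a - v \<in> R" "r \<in> R" by (auto simp: mem_coset_iff[OF R])
    have eq: "x - c *\<^sub>C v = c *\<^sub>C (a - v) + r" using ar(1) by (simp add: cvec.scale_right_diff_distrib)
    show "x \<in> coset R (c *\<^sub>C v)"
      unfolding mem_coset_iff[OF R] eq
      by (rule cvec.subspace_add[OF R cvec.subspace_scale[OF R ar(2)] ar(3)])
  next
    fix x assume "x \<in> coset R (c *\<^sub>C v)"
    then have "x - c *\<^sub>C v \<in> R" "v \<in> coset R v"
      using cvec.subspace_0[OF R] by (simp_all add: mem_coset_iff[OF R])
    then show "x \<in> {c *\<^sub>C a + r |a r. a \<in> coset R v \<and> r \<in> R}"
      by (intro CollectI exI[of _ v] exI[of _ "x - c *\<^sub>C v"]) simp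
  qed
  then show ?thesis by (simp add: quotient_space_def)
qed

lemma quotient_space_inner:
  "hinner (quotient_space R) (coset R u) (coset R v) = cinner (residual R u) (residual R v)"
  by (simp add: quotient_space_def least_elem_coset[OF R closed_csubspace_finite_dim[OF R]])

lemma quotient_space_carrier: "hcarrier (quotient_space R) = range (coset R)"
  and quotient_space_zero: "hzero (quotient_space R) = coset R 0"
  by (simp_all add: quotient_space_def coset_0)

lemma herm_vector_space_quotient: "herm_vector_space (quotient_space R)"
proof -
  note cl = closed_csubspace_finite_dim[OF R]
  have neg: "\<exists>v. coset R (u + v) = coset R 0" for u by (rule exI[of _ "- u"]) simp
  have pos: "0 < Re (cinner (residual R u) (residual R u))" if "coset R u \<noteq> coset R 0" for u
  proof -
    have "residual R u \<noteq> 0"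
      using that residual(1)[OF R cl, of u] by (auto simp: coset_eq_iff[OF R])
    then show ?thesis by (simp add: cinner_self)
  qed
  have all: "(\<forall>x\<in>range (coset R). P x) \<longleftrightarrow> (\<forall>u. P (coset R u))" for P by blast
  have ex: "(\<exists>x\<in>range (coset R). P x) \<longleftrightarrow> (\<exists>u. P (coset R u))" for P by blast
  show ?thesis
    unfolding herm_vector_space_def quotient_space_carrier quotient_space_zero all ex
      quotient_space_add quotient_space_scale quotient_space_inner residual_add[OF R cl]
      residual_scaleC[OF R cl] cinner_add_left cinner_scaleC_left
    by (intro conjI allI impI;
        (rule refl | rule rangeI | rule neg | rule cinner_commute | erule pos
         | simp only: add.assoc scaleC_add_right scaleC_add_left scaleC_scaleC scaleC_one add_0_left
         | simp only: add.commute))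
qed

lemma one_dimensional_quotient:
  assumes e: "e \<noteq> 0" "orth UNIV R = cvec.span {e}"
  shows "one_dimensional (quotient_space R)"
  unfolding one_dimensional_def quotient_space_carrier quotient_space_zero
proof (intro bexI[of _ "coset R e"] conjI ballI)
  note cl = closed_csubspace_finite_dim[OF R]
  have "e \<in> orth UNIV R" using e(2) cvec.span_base by blast
  then show "coset R e \<noteq> coset R 0"
    using e(1) by (auto simp: coset_eq_iff[OF R] orth_def)
  fix x assume "x \<in> range (coset R)"
  then obtain v where v: "x = coset R v" by blast
  obtain c where "residual R v = c *\<^sub>C e"
    using residual(2)[OF R cl, of v] by (auto simp: e(2) cvec.span_singleton)
  then have "x = hscale (quotient_space R) c (coset R e)"
    using residual(1)[OF R cl, of v] by (simp add: v quotient_space_scale coset_eq_iff[OF R])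
  then show "\<exists>c. x = hscale (quotient_space R) c (coset R e)" by blast
qed simp

lemma residual_line:
  assumes e: "e \<noteq> 0" "orth UNIV R = cvec.span {e}"
  shows "residual R v = (cinner v e / cinner e e) *\<^sub>C e"
proof -
  note cl = closed_csubspace_finite_dim[OF R]
  obtain c where c: "residual R v = c *\<^sub>C e"
    using residual(2)[OF R cl, of v] by (auto simp: e(2) cvec.span_singleton)
  have "e \<in> orth UNIV R" using e(2) cvec.span_base by blast
  then have "cinner (v - residual R v) e = 0"
    using residual(1)[OF R cl, of v] cinner_eq_0_sym[of e] by (auto simp: orth_def)
  then have "cinner v e = c * cinner e e" by (simp add: c cinner_diff_left cinner_scaleC_left)
  then show ?thesis using c e(1) by simp
qed

lemma mem_iff_orthogonal_line:
  assumes e: "e \<noteq> 0" "orth UNIV R = cvec.span {e}"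
  shows "v \<in> R \<longleftrightarrow> cinner v e = 0"
proof -
  note cl = closed_csubspace_finite_dim[OF R]
  have "e \<in> orth UNIV R" using e(2) cvec.span_base by blast
  then have "cinner v e = 0" if "v \<in> R" using that cinner_eq_0_sym[of e] by (auto simp: orth_def)
  moreover have "v \<in> R" if "cinner v e = 0"
    using that residual(1)[OF R cl, of v] by (simp add: residual_line[OF e])
  ultimately show ?thesis by blast
qed

end

section \<open>The bundle of cokernels\<close>

lemma frames_L_ThetaE:
  assumes "x \<in> frames (L_Theta \<Omega> \<Theta>)"
  obtains U s where "x = (U, \<lambda>w. coset (range ((*v) (\<Theta> w))) (s w))" "open U" "U \<subseteq> \<Omega>" "hol_on U s"
    "\<forall>w\<in>U. s w \<notin> range ((*v) (\<Theta> w))"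
  using assms unfolding L_Theta_def by auto

text \<open>
  Everything is computed from a local antiholomorphic frame \<open>e\<close> of the orthogonal complement of the
  range: a vector \<open>v\<close> has residual \<open>(\<langle>v, e\<rangle> / \<langle>e, e\<rangle>) e\<close>, and for holomorphic \<open>s\<close> the pairing
  \<open>\<langle>e, s\<rangle>\<close> is an antiholomorphic function.
\<close>

lemma herm_hol_line_bundle_L_Theta:
  fixes \<Theta> :: "complex^'n::finite \<Rightarrow> complex^'l::finite^'q::finite"
  assumes L: "antihol_line_family \<Omega> (\<lambda>w. orth UNIV (range ((*v) (\<Theta> w))))"
  shows "herm_hol_line_bundle \<Omega> (L_Theta \<Omega> \<Theta>)"
proof -
  define R where "R w = range ((*v) (\<Theta> w))" for w
  have R: "cvec.subspace (R w)" for w unfolding R_def by (rule subspace_range_matrix)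
  let ?L = "\<lambda>w. orth UNIV (R w)"
  have L: "antihol_line_family \<Omega> ?L" using L by (simp add: R_def)
  have fib: "fibre (L_Theta \<Omega> \<Theta>) w = quotient_space (R w)" for w
    by (simp add: L_Theta_def R_def)
  have frame: "\<exists>W e. open W \<and> w \<in> W \<and> W \<subseteq> \<Omega> \<and> antihol_on W e \<and> (\<forall>z\<in>W. e z \<noteq> 0 \<and> orth UNIV (R z) = cvec.span {e z})"
    if w: "w \<in> \<Omega>" for w
  proof -
    obtain W e where e: "w \<in> W" "(W, e) \<in> frames (antihol_subbundle \<Omega> ?L)"
      using antihol_line_family_frame[OF L w] .
    note fe = frames_antihol_subbundleD[OF e(2)]
    have "orth UNIV (R z) = cvec.span {e z}" if "z \<in> W" for z
      using antihol_line_family_span[OF L, of z "e z"] fe that by blast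
    then show ?thesis using fe e(1) by blast
  qed
  show ?thesis
    unfolding herm_hol_line_bundle_def herm_line_bundle_def
  proof (intro conjI ballI)
    fix w assume w: "w \<in> \<Omega>"
    show "herm_vector_space (fibre (L_Theta \<Omega> \<Theta>) w)" unfolding fib by (rule herm_vector_space_quotient[OF R])
    obtain W e where W: "open W" "w \<in> W" "W \<subseteq> \<Omega>" "antihol_on W e"
      "\<And>z. z \<in> W \<Longrightarrow> e z \<noteq> 0" "\<And>z. z \<in> W \<Longrightarrow> orth UNIV (R z) = cvec.span {e z}"
      using frame[OF w] by blast
    show "one_dimensional (fibre (L_Theta \<Omega> \<Theta>) w)"
      unfolding fib by (rule one_dimensional_quotient[OF R W(5,6)[OF W(2)]])
    \<comment> \<open>Where the fixed vector \<open>e w\<close> has a component along \<open>e z\<close>, it represents a nonzero coset.\<close>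
    define V where "V = {z \<in> W. cinner (e z) (e w) \<noteq> 0}"
    have V: "open V" "w \<in> V" "V \<subseteq> \<Omega>"
      using open_nonzero_pairing[OF W(1,4)] W(2,3) W(5)[OF W(2)] by (auto simp: V_def)
    have "e w \<notin> R z" if "z \<in> V" for z
      using that mem_iff_orthogonal_line[OF R W(5,6), of z "e w"] cinner_eq_0_sym[of "e z" "e w"]
      by (auto simp: V_def)
    moreover have "hol_on V (\<lambda>z. e w)"
      unfolding hol_on_def by (intro ballI exI[of _ "\<lambda>_. 0"]) simp
    ultimately have "(V, \<lambda>z. coset (R z) (e w)) \<in> frames (L_Theta \<Omega> \<Theta>)"
      using V unfolding L_Theta_def R_def line_bundle.simps mem_Collect_eq
      by (intro exI[of _ V] exI[of _ "\<lambda>z. e w"]) simp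
    then show "\<exists>(U, s)\<in>frames (L_Theta \<Omega> \<Theta>). w \<in> U"
      using V(2) by (intro bexI[of _ "(V, \<lambda>z. coset (R z) (e w))"]) simp_all
  next
    fix x assume "x \<in> frames (L_Theta \<Omega> \<Theta>)"
    then obtain U s where x: "x = (U, \<lambda>w. coset (R w) (s w))" "open U" "U \<subseteq> \<Omega>" "hol_on U s"
      "\<forall>w\<in>U. s w \<notin> R w"
      unfolding R_def by (rule frames_L_ThetaE)
    show "case x of (U, s) \<Rightarrow> open U \<and> U \<subseteq> \<Omega> \<and>
        (\<forall>w\<in>U. s w \<in> hcarrier (fibre (L_Theta \<Omega> \<Theta>) w) \<and> s w \<noteq> hzero (fibre (L_Theta \<Omega> \<Theta>) w))"
      unfolding x(1) prod.case fib quotient_space_carrier[OF R] quotient_space_zero[OF R] coset_eq_iff[OF R]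
      using x(2,3,5) by simp
    show "case x of (U, s) \<Rightarrow> smooth_on U (sq_norm (L_Theta \<Omega> \<Theta>) s)"
      unfolding x(1) prod.case smooth_on_def
    proof (intro allI Ck_on_local)
      fix k w assume w: "w \<in> U"
      then have "w \<in> \<Omega>" using x(3) by blast
      from frame[OF this] obtain W e where W: "open W" "w \<in> W" "W \<subseteq> \<Omega>" "antihol_on W e"
        "\<And>z. z \<in> W \<Longrightarrow> e z \<noteq> 0" "\<And>z. z \<in> W \<Longrightarrow> orth UNIV (R z) = cvec.span {e z}" by blast
      define V where "V = U \<inter> W"
      have V: "open V" "w \<in> V" using x(2) W w by (auto simp: V_def)
      have e: "antihol_on V e" using W(4) by (auto simp: V_def antihol_on_iff)
      define q where "q z = cinner (e z) (s z)" for z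
      have q: "antihol_on V q" unfolding q_def[abs_def]
        by (intro antihol_onI antihol_at_cinner_hol[OF _ x(4)]) (auto simp: V_def intro: antihol_onD[OF W(4)])
      have "inner (q z) (q z) * inverse (inner (e z) (e z)) = sq_norm (L_Theta \<Omega> \<Theta>) (\<lambda>w. coset (R w) (s w)) z"
        if z: "z \<in> V" for z
      proof -
        have zW: "z \<in> W" using z by (simp add: V_def)
        have "sq_norm (L_Theta \<Omega> \<Theta>) (\<lambda>w. coset (R w) (s w)) z = (norm (residual (R z) (s z)))\<^sup>2"
          by (simp add: sq_norm_def fib quotient_space_inner[OF R] cinner_self)
        also have "\<dots> = (cmod (cinner (s z) (e z)) / (norm (e z))\<^sup>2 * norm (e z))\<^sup>2"
          by (simp add: residual_line[OF R W(5,6)[OF zW]] norm_scaleC norm_divide norm_power cinner_self[of "e z"])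
        also have "cmod (cinner (s z) (e z)) = norm (q z)"
          unfolding q_def by (metis cinner_commute complex_mod_cnj)
        also have "(norm (q z) / (norm (e z))\<^sup>2 * norm (e z))\<^sup>2 = inner (q z) (q z) * inverse (inner (e z) (e z))"
          using W(5)[OF zW] by (simp add: power2_norm_eq_inner[symmetric] power2_eq_square field_simps)
        finally show ?thesis by simp
      qed
      moreover have "Ck_on k V (\<lambda>z. inner (q z) (q z) * inverse (inner (e z) (e z)))"
        using W(5) by (intro Ck_on_mult[OF V(1)] Ck_on_inverse[OF V(1)] antihol_on_Ck_on_sq_norm[OF V(1)] q e)
          (simp add: V_def)
      ultimately have "Ck_on k V (sq_norm (L_Theta \<Omega> \<Theta>) (\<lambda>w. coset (R w) (s w)))"
        by (rule Ck_on_cong[OF V(1)])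
      then show "\<exists>W. open W \<and> w \<in> W \<and> Ck_on k W (sq_norm (L_Theta \<Omega> \<Theta>) (\<lambda>w. coset (R w) (s w)))"
        using V by blast
    qed
    show "case x of (U, s) \<Rightarrow> \<forall>(V, t)\<in>frames (L_Theta \<Omega> \<Theta>). \<exists>g. hol_on (U \<inter> V) g \<and>
        (\<forall>w\<in>U \<inter> V. s w = hscale (fibre (L_Theta \<Omega> \<Theta>) w) (g w) (t w))"
      unfolding x(1) prod.case
    proof
      fix y assume "y \<in> frames (L_Theta \<Omega> \<Theta>)"
      then obtain V t where y: "y = (V, \<lambda>w. coset (R w) (t w))" "open V" "V \<subseteq> \<Omega>" "hol_on V t"
        "\<forall>w\<in>V. t w \<notin> R w"
        unfolding R_def by (rule frames_L_ThetaE)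
      let ?N = "U \<inter> V"
      have ex: "\<exists>c. s w - c *\<^sub>C t w \<in> R w" if w: "w \<in> ?N" for w
      proof -
        have "w \<in> \<Omega>" using w x(3) by blast
        from frame[OF this] obtain e where e: "e \<noteq> 0" "orth UNIV (R w) = cvec.span {e}" by blast
        have "cinner (t w) e \<noteq> 0" using mem_iff_orthogonal_line[OF R e, of "t w"] y(5) w by blast
        then show ?thesis
          by (intro exI[of _ "cinner (s w) e / cinner (t w) e"])
            (simp add: mem_iff_orthogonal_line[OF R e] cinner_diff_left cinner_scaleC_left)
      qed
      then obtain g where g: "\<And>w. w \<in> ?N \<Longrightarrow> s w - g w *\<^sub>C t w \<in> R w" by metis
      have "antihol_at (\<lambda>w. cnj (g w)) w" if w: "w \<in> ?N" for w
      proof -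
        have "w \<in> \<Omega>" using w x(3) by blast
        from frame[OF this] obtain W e where W: "open W" "w \<in> W" "W \<subseteq> \<Omega>" "antihol_on W e"
          "\<And>z. z \<in> W \<Longrightarrow> e z \<noteq> 0" "\<And>z. z \<in> W \<Longrightarrow> orth UNIV (R z) = cvec.span {e z}" by blast
        have t0: "cinner (e z) (t z) \<noteq> 0" if "z \<in> W \<inter> ?N" for z
          using that mem_iff_orthogonal_line[OF R W(5,6), of z "t z"] y(5) cinner_eq_0_sym[of "e z"] by blast
        show ?thesis
        proof (rule antihol_at_cong)
          show "open (W \<inter> ?N)" "w \<in> W \<inter> ?N" using W w x(2) y(2) by auto
          show "antihol_at (\<lambda>w. cinner (e w) (s w) / cinner (e w) (t w)) w"
            using w W(2) by (intro antihol_at_divide t0 antihol_at_cinner_hol[OF antihol_onD[OF W(4)] x(4)]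
                antihol_at_cinner_hol[OF antihol_onD[OF W(4)] y(4)]) auto
          show "cnj (g z) = cinner (e z) (s z) / cinner (e z) (t z)" if z: "z \<in> W \<inter> ?N" for z
          proof -
            have "cinner (s z - g z *\<^sub>C t z) (e z) = 0"
              using mem_iff_orthogonal_line[OF R W(5,6), of z] g z by blast
            then have "cinner (e z) (s z) = cnj (g z) * cinner (e z) (t z)"
              unfolding cinner_eq_0_sym[of _ "e z"] by (simp add: cinner_diff_right cinner_right)
            then show ?thesis using t0[OF z] by simp
          qed
        qed
      qed
      then have "hol_on ?N (\<lambda>w. cnj (cnj (g w)))" by (intro hol_on_cnj antihol_onI)
      then have "hol_on ?N g" by simp
      moreover have "coset (R w) (s w) = hscale (fibre (L_Theta \<Omega> \<Theta>) w) (g w) (coset (R w) (t w))"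
        if "w \<in> ?N" for w
        unfolding fib quotient_space_scale[OF R] coset_eq_iff[OF R] by (rule g[OF that])
      ultimately show "case y of (V, t) \<Rightarrow> \<exists>g. hol_on (U \<inter> V) g \<and>
          (\<forall>w\<in>U \<inter> V. coset (R w) (s w) = hscale (fibre (L_Theta \<Omega> \<Theta>) w) (g w) (t w))"
        unfolding y(1) prod.case by blast
    qed
  qed
qed

section \<open>Multipliers\<close>

lemma mult_op:
  assumes "\<phi> \<in> multiplier \<Omega> H" and H: "hilbert_module H"
  shows "bounded_op_on (hspace H) (mult_op \<Omega> H \<phi>)"
    and "w \<in> \<Omega> \<Longrightarrow> k \<in> joint_ker H w \<Longrightarrow> x \<in> hspace H \<Longrightarrow> cinner (mult_op \<Omega> H \<phi> x) k = \<phi> w * cinner x k"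
proof -
  have "is_mult_op \<Omega> H \<phi> (mult_op \<Omega> H \<phi>)"
    using assms(1) unfolding multiplier_def mult_op_def mem_Collect_eq by (rule someI_ex)
  then have m: "bounded_op_on (hspace H) (mult_op \<Omega> H \<phi>)"
    "\<forall>w\<in>\<Omega>. \<forall>k\<in>joint_ker H w. adjoint_on (hspace H) (mult_op \<Omega> H \<phi>) k = cnj (\<phi> w) *\<^sub>C k"
    by (auto simp: is_mult_op_def)
  show "bounded_op_on (hspace H) (mult_op \<Omega> H \<phi>)" by (rule m(1))
  show "cinner (mult_op \<Omega> H \<phi> x) k = \<phi> w * cinner x k"
    if "w \<in> \<Omega>" "k \<in> joint_ker H w" "x \<in> hspace H"
    using adjoint_on(2)[OF hilbert_moduleD(1,2)[OF H] m(1) that(3), of k] m(2) that(1,2)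
    by (simp add: cinner_right)
qed

text \<open>
  For a local frame \<open>s\<close> of the joint eigenspaces, \<open>\<phi>\<close>-bar is the
  quotient of the pairings of \<open>s\<close> with two fixed vectors.
\<close>

lemma antihol_on_cnj_multiplier:
  fixes H :: "('n::finite, 'a::chilbert_space) hilbert_mod"
  assumes \<phi>: "\<phi> \<in> multiplier \<Omega> H" and H: "hilbert_module H" and E: "antihol_line_family \<Omega> (joint_ker H)"
  shows "antihol_on \<Omega> (\<lambda>w. cnj (\<phi> w))"
proof (rule antihol_onI)
  fix w0 assume w0: "w0 \<in> \<Omega>"
  obtain U s where s: "w0 \<in> U" "(U, s) \<in> frames (antihol_subbundle \<Omega> (joint_ker H))"
    using antihol_line_family_frame[OF E w0] .
  note fs = frames_antihol_subbundleD[OF s(2)]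
  let ?k = "s w0"
  have k: "?k \<in> hspace H" using fs(4)[OF s(1)] by (simp add: joint_ker_def)
  show "antihol_at (\<lambda>w. cnj (\<phi> w)) w0"
  proof (rule antihol_at_cong)
    show "open {w \<in> U. cinner (s w) ?k \<noteq> 0}" by (rule open_nonzero_pairing[OF fs(1,3)])
    show "w0 \<in> {w \<in> U. cinner (s w) ?k \<noteq> 0}" using s(1) fs(5) by simp
    show "antihol_at (\<lambda>w. cinner (s w) (mult_op \<Omega> H \<phi> ?k) / cinner (s w) ?k) w0"
      using fs(5)[OF s(1)] by (intro antihol_at_divide antihol_at_cinner_const antihol_onD[OF fs(3) s(1)]) simp
    show "cnj (\<phi> w) = cinner (s w) (mult_op \<Omega> H \<phi> ?k) / cinner (s w) ?k"
      if w: "w \<in> {w \<in> U. cinner (s w) ?k \<noteq> 0}" for w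
    proof -
      have wU: "w \<in> U" using w by blast
      have "cinner (mult_op \<Omega> H \<phi> ?k) (s w) = \<phi> w * cinner ?k (s w)"
        using wU fs(2,4) by (intro mult_op(2)[OF \<phi> H _ _ k]) auto
      then have "cinner (s w) (mult_op \<Omega> H \<phi> ?k) = cnj (\<phi> w) * cinner (s w) ?k"
        by (metis cinner_commute complex_cnj_mult)
      then show ?thesis using w by simp
    qed
  qed
qed

text \<open>The value of a vector-valued function at the point to which the joint eigenvector \<open>k\<close> belongs.\<close>

definition evaluate :: "'a::complex_inner^'p::finite \<Rightarrow> 'a \<Rightarrow> complex^'p" where
  "evaluate f k = (\<chi> j. cinner (f $ j) k)"

lemma evaluate_diff: "evaluate (f - g) k = evaluate f k - evaluate g k"
  by (simp add: evaluate_def vec_eq_iff cinner_diff_left)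

lemma cinner_tensor_evaluate: "cinner f (tensor k v) = cinner (evaluate f k) v"
  by (simp add: cinner_vec_def tensor_def evaluate_def cinner_right cinner_complex_def mult.commute)

lemma evaluate_eq_imp_eq:
  fixes f g :: "'a::chilbert_space^'p::finite"
  assumes H: "closed_spanning_module \<Omega> H" and f: "f \<in> hspace (tensor_module H)" and g: "g \<in> hspace (tensor_module H)"
    and eq: "\<And>w k. w \<in> \<Omega> \<Longrightarrow> k \<in> joint_ker H w \<Longrightarrow> evaluate f k = evaluate g k"
  shows "f = g"
proof -
  have S: "cvec.subspace (hspace H)" using H by (simp add: closed_spanning_module_def hilbert_moduleD)
  have "f $ r - g $ r = 0" for r
  proof -
    have "f $ r - g $ r \<in> hspace H" using f g cvec.subspace_diff[OF S] by (simp add: hspace_tensor)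
    moreover have "cinner (f $ r - g $ r) k = 0" if "w \<in> \<Omega>" "k \<in> joint_ker H w" for w k
      using eq[OF that] by (simp add: evaluate_def vec_eq_iff cinner_diff_left)
    ultimately show ?thesis using H unfolding closed_spanning_module_def by blast
  qed
  then show ?thesis by (simp add: vec_eq_iff)
qed

lemma mult_matrix_op:
  fixes \<Theta> :: "complex^'n::finite \<Rightarrow> complex^'p::finite^'q::finite"
    and H :: "('n, 'a::chilbert_space) hilbert_mod"
  assumes \<Theta>: "\<Theta> \<in> multiplier_matrix \<Omega> H" and H: "hilbert_module H"
  shows mult_matrix_op_in: "\<And>f. f \<in> hspace (tensor_module H) \<Longrightarrow>
      mult_matrix_op \<Omega> H \<Theta> f \<in> hspace (tensor_module H)"
    and mult_matrix_op_add: "\<And>f g. f \<in> hspace (tensor_module H) \<Longrightarrow> g \<in> hspace (tensor_module H) \<Longrightarrow>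
      mult_matrix_op \<Omega> H \<Theta> (f + g) = mult_matrix_op \<Omega> H \<Theta> f + mult_matrix_op \<Omega> H \<Theta> g"
    and mult_matrix_op_scaleC: "\<And>f c. f \<in> hspace (tensor_module H) \<Longrightarrow>
      mult_matrix_op \<Omega> H \<Theta> (c *\<^sub>C f) = c *\<^sub>C mult_matrix_op \<Omega> H \<Theta> f"
    and mult_matrix_op_bound: "\<exists>K\<ge>0. \<forall>f\<in>hspace (tensor_module H).
      norm (mult_matrix_op \<Omega> H \<Theta> f) \<le> K * norm f"
    and evaluate_mult_matrix_op: "\<And>f w k. f \<in> hspace (tensor_module H) \<Longrightarrow> w \<in> \<Omega> \<Longrightarrow>
      k \<in> joint_ker H w \<Longrightarrow> evaluate (mult_matrix_op \<Omega> H \<Theta> f) k = \<Theta> w *v evaluate f k"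
proof -
  note S = hilbert_moduleD(1)[OF H]
  define T where "T i j = mult_op \<Omega> H (\<lambda>w. \<Theta> w $ i $ j)" for i j
  have M: "(\<lambda>w. \<Theta> w $ i $ j) \<in> multiplier \<Omega> H" for i j
    using \<Theta> by (simp add: multiplier_matrix_def)
  have T: "bounded_op_on (hspace H) (T i j)" for i j unfolding T_def by (rule mult_op(1)[OF M H])
  have nth: "mult_matrix_op \<Omega> H \<Theta> f $ i = (\<Sum>j\<in>UNIV. T i j (f $ j))" for f i
    by (simp add: mult_matrix_op_def T_def)
  note TD = bounded_op_onD[OF T]
  show "mult_matrix_op \<Omega> H \<Theta> f \<in> hspace (tensor_module H)" if "f \<in> hspace (tensor_module H)" for f
    using that TD(1) by (auto simp: hspace_tensor nth intro!: cvec.subspace_sum[OF S])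
  show "mult_matrix_op \<Omega> H \<Theta> (f + g) = mult_matrix_op \<Omega> H \<Theta> f + mult_matrix_op \<Omega> H \<Theta> g"
    if "f \<in> hspace (tensor_module H)" "g \<in> hspace (tensor_module H)" for f g
    using that by (simp add: vec_eq_iff nth hspace_tensor TD(2) sum.distrib)
  show "mult_matrix_op \<Omega> H \<Theta> (c *\<^sub>C f) = c *\<^sub>C mult_matrix_op \<Omega> H \<Theta> f"
    if "f \<in> hspace (tensor_module H)" for f c
    using that by (simp add: vec_eq_iff nth hspace_tensor TD(3) scaleC_vec_def cvec.scale_sum_right)
  show "evaluate (mult_matrix_op \<Omega> H \<Theta> f) k = \<Theta> w *v evaluate f k"
    if "f \<in> hspace (tensor_module H)" "w \<in> \<Omega>" "k \<in> joint_ker H w" for f w k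
    using that mult_op(2)[OF M H that(2,3)]
    by (simp add: vec_eq_iff evaluate_def nth cinner_sum_left matrix_vector_mult_def T_def hspace_tensor)
  have "\<forall>i j. \<exists>K. K \<ge> 0 \<and> (\<forall>x\<in>hspace H. norm (T i j x) \<le> K * norm x)"
    using bounded_op_on_bound[OF T] by blast
  then obtain K where K: "\<And>i j. K i j \<ge> 0" "\<And>i j x. x \<in> hspace H \<Longrightarrow> norm (T i j x) \<le> K i j * norm x"
    by metis
  have "norm (mult_matrix_op \<Omega> H \<Theta> f) \<le> (\<Sum>i\<in>UNIV. \<Sum>j\<in>UNIV. K i j) * norm f"
    if f: "f \<in> hspace (tensor_module H)" for f
  proof -
    have "norm (mult_matrix_op \<Omega> H \<Theta> f) \<le> (\<Sum>i\<in>UNIV. norm (\<Sum>j\<in>UNIV. T i j (f $ j)))"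
      using norm_vec_le_sum[of "mult_matrix_op \<Omega> H \<Theta> f"] by (simp add: nth)
    also have "\<dots> \<le> (\<Sum>i\<in>UNIV. \<Sum>j\<in>UNIV. K i j * norm f)"
    proof (intro sum_mono order_trans[OF norm_sum])
      fix i j
      have "norm (T i j (f $ j)) \<le> K i j * norm (f $ j)" using f by (intro K) (simp add: hspace_tensor)
      also have "\<dots> \<le> K i j * norm f" by (intro mult_left_mono K Finite_Cartesian_Product.norm_nth_le)
      finally show "norm (T i j (f $ j)) \<le> K i j * norm f" .
    qed
    finally show ?thesis by (simp add: sum_distrib_right)
  qed
  then show "\<exists>K\<ge>0. \<forall>f\<in>hspace (tensor_module H). norm (mult_matrix_op \<Omega> H \<Theta> f) \<le> K * norm f"
    using K(1) by (intro exI[of _ "\<Sum>i\<in>UNIV. \<Sum>j\<in>UNIV. K i j"]) (simp add: sum_nonneg)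
qed

section \<open>The quotient module\<close>

text \<open>
  The range of \<open>M\<^sub>\<Theta>\<close> is the kernel of the idempotent module map \<open>1 - M\<^sub>\<Theta> M\<^sub>\<Psi>\<close>; all identities
  between module maps are checked on evaluations.
\<close>

lemma H_Theta_closed_spanning:
  fixes H :: "('n::finite, 'a::chilbert_space) hilbert_mod"
    and \<Theta> :: "complex^'n \<Rightarrow> complex^'l::finite^'q::finite"
    and \<Psi> :: "complex^'n \<Rightarrow> complex^'q^'l"
  assumes H: "closed_spanning_module \<Omega> H"
    and \<Theta>: "\<Theta> \<in> multiplier_matrix \<Omega> H" and \<Psi>: "\<Psi> \<in> multiplier_matrix \<Omega> H"
    and inv: "\<forall>w\<in>\<Omega>. \<Psi> w ** \<Theta> w = mat 1"
  shows "closed_spanning_module \<Omega> (H_Theta \<Omega> H \<Theta>)"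
    and "joint_ker (H_Theta \<Omega> H \<Theta>) w = joint_ker (tensor_module H) w \<inter>
      orth (hspace (tensor_module H)) (mult_matrix_op \<Omega> H \<Theta> ` hspace (tensor_module H))"
proof -
  have HM: "hilbert_module H" using H by (simp add: closed_spanning_module_def)
  let ?K = "tensor_module H :: ('n, 'a^'q) hilbert_mod" and ?P = "tensor_module H :: ('n, 'a^'l) hilbert_mod"
  let ?T = "mult_matrix_op \<Omega> H \<Theta>" and ?S = "mult_matrix_op \<Omega> H \<Psi>"
  define Q where "Q f = f - ?T (?S f)" for f
  note KM = hilbert_module_tensor[OF HM, where 'q = 'q] and PM = hilbert_module_tensor[OF HM, where 'q = 'l]
  note KS = hilbert_moduleD(1)[OF KM]
  note T = mult_matrix_op[OF \<Theta> HM] and S = mult_matrix_op[OF \<Psi> HM]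
  have TS: "?T (?S f) \<in> hspace ?K" if "f \<in> hspace ?K" for f using T(1)[OF S(1)[OF that]] .
  have Q_in: "Q f \<in> hspace ?K" if "f \<in> hspace ?K" for f
    unfolding Q_def by (rule cvec.subspace_diff[OF KS that TS[OF that]])
  have Q: "bounded_op_on (hspace ?K) Q"
  proof -
    obtain A where A: "A \<ge> 0" "\<forall>f\<in>hspace ?P. norm (?T f) \<le> A * norm f" using T(4) by blast
    obtain B where B: "B \<ge> 0" "\<forall>f\<in>hspace ?K. norm (?S f) \<le> B * norm f" using S(4) by blast
    have "norm (Q f) \<le> (1 + A * B) * norm f" if f: "f \<in> hspace ?K" for f
    proof -
      have "norm (?T (?S f)) \<le> A * norm (?S f)" using A(2) S(1)[OF f] by blast
      also have "\<dots> \<le> A * (B * norm f)" using B(2) f A(1) by (intro mult_left_mono) auto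
      finally show ?thesis
        using norm_triangle_ineq4[of f "?T (?S f)"] by (simp add: Q_def algebra_simps)
    qed
    moreover have "Q (f + g) = Q f + Q g" if "f \<in> hspace ?K" "g \<in> hspace ?K" for f g
      using that by (simp add: Q_def S(2) T(2)[OF S(1) S(1)])
    moreover have "Q (c *\<^sub>C f) = c *\<^sub>C Q f" if "f \<in> hspace ?K" for f c
      using that by (simp add: Q_def S(3) T(3)[OF S(1)] cvec.scale_right_diff_distrib)
    ultimately show ?thesis using Q_in unfolding bounded_op_on_def by blast
  qed
  have evQ: "evaluate (Q f) k = evaluate f k - \<Theta> w *v (\<Psi> w *v evaluate f k)"
    if "f \<in> hspace ?K" "w \<in> \<Omega>" "k \<in> joint_ker H w" for f w k
    using T(5)[OF S(1)[OF that(1)] that(2,3)] S(5)[OF that] by (simp add: Q_def evaluate_diff)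
  have ST: "?S (?T g) = g" if g: "g \<in> hspace ?P" for g
  proof (rule evaluate_eq_imp_eq[OF H S(1)[OF T(1)[OF g]] g])
    show "evaluate (?S (?T g)) k = evaluate g k" if "w \<in> \<Omega>" "k \<in> joint_ker H w" for w k
      using S(5)[OF T(1)[OF g] that] T(5)[OF g that] inv that(1)
      by (simp add: matrix_vector_mul_assoc)
  qed
  have QT: "Q (?T g) = 0" if "g \<in> hspace ?P" for g using ST[OF that] by (simp add: Q_def)
  have R: "?T ` hspace ?P = {x \<in> hspace ?K. Q x = 0}"
  proof (intro equalityI subsetI)
    fix x assume x: "x \<in> {x \<in> hspace ?K. Q x = 0}"
    then have "x = ?T (?S x)" by (simp add: Q_def)
    then show "x \<in> ?T ` hspace ?P" using x S(1) by blast
  qed (use T(1) QT in auto)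
  have idem: "Q (Q f) = Q f" if f: "f \<in> hspace ?K" for f
    using bounded_op_on_diff[OF Q KS f TS[OF f]] QT[OF S(1)[OF f]] by (simp add: Q_def)
  have comm: "Q (hact ?K i f) = hact ?K i (Q f)" if f: "f \<in> hspace ?K" for i f
  proof (rule evaluate_eq_imp_eq[OF H])
    note act = bounded_op_onD(1)[OF hilbert_moduleD(3)[OF KM]]
    show "Q (hact ?K i f) \<in> hspace ?K" "hact ?K i (Q f) \<in> hspace ?K" using act f Q_in by auto
    fix w k assume wk: "w \<in> \<Omega>" "k \<in> joint_ker H w"
    have ev: "evaluate (hact ?K i x) k = (w $ i) *\<^sub>C evaluate x k" if "x \<in> hspace ?K" for x
      using that wk(2) by (simp add: evaluate_def vec_eq_iff hact_tensor hspace_tensor joint_ker_iff[OF HM]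
          scaleC_vec_def scaleC_complex_def)
    show "evaluate (Q (hact ?K i f)) k = evaluate (hact ?K i (Q f)) k"
      by (simp add: evQ[OF act[OF f] wk] ev[OF f] ev[OF Q_in[OF f]] evQ[OF f wk]
          matrix_vector_mult_scaleC cvec.scale_right_diff_distrib)
  qed
  note quot = closed_spanning_quotient[OF closed_spanning_tensor[OF H] Q idem comm R]
  show "closed_spanning_module \<Omega> (H_Theta \<Omega> H \<Theta>)" unfolding H_Theta_def by (rule quot(1))
  show "joint_ker (H_Theta \<Omega> H \<Theta>) w = joint_ker ?K w \<inter> orth (hspace ?K) (?T ` hspace ?P)"
    unfolding H_Theta_def by (rule quot(2))
qed

text \<open>
  A joint eigenvector of the tensor product has the form \<open>k \<otimes> v\<close>, and its pairing with \<open>M\<^sub>\<Theta> g\<close> is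
  that of \<open>v\<close> with \<open>\<Theta>(w)\<close> applied to the value of \<open>g\<close>, where all values occur.
\<close>

lemma joint_ker_H_Theta:
  fixes H :: "('n::finite, 'a::chilbert_space) hilbert_mod"
    and \<Theta> :: "complex^'n \<Rightarrow> complex^'l::finite^'q::finite"
    and \<Psi> :: "complex^'n \<Rightarrow> complex^'q^'l"
  assumes H: "closed_spanning_module \<Omega> H"
    and \<Theta>: "\<Theta> \<in> multiplier_matrix \<Omega> H" and \<Psi>: "\<Psi> \<in> multiplier_matrix \<Omega> H"
    and inv: "\<forall>w\<in>\<Omega>. \<Psi> w ** \<Theta> w = mat 1"
    and w: "w \<in> \<Omega>"
    and k: "k \<noteq> 0" "joint_ker H w = cvec.span {k}"
  shows "joint_ker (H_Theta \<Omega> H \<Theta>) w = tensor k ` orth UNIV (range ((*v) (\<Theta> w)))"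
proof -
  have HM: "hilbert_module H" using H by (simp add: closed_spanning_module_def)
  note T = mult_matrix_op[OF \<Theta> HM]
  have kk: "k \<in> joint_ker H w" using k(2) cvec.span_base by blast
  then have kS: "k \<in> hspace H" by (simp add: joint_ker_def)
  have tS: "tensor k v \<in> hspace (tensor_module H)" for v :: "complex^'m::finite"
    using cvec.subspace_scale[OF hilbert_moduleD(1)[OF HM] kS] by (simp add: hspace_tensor tensor_def)
  have pair: "cinner (mult_matrix_op \<Omega> H \<Theta> g) (tensor k v) = cinner (\<Theta> w *v evaluate g k) v"
    if "g \<in> hspace (tensor_module H)" for g v
    by (simp add: cinner_tensor_evaluate T(5)[OF that w kk])
  show ?thesis
    unfolding H_Theta_closed_spanning(2)[OF H \<Theta> \<Psi> inv]
  proof (intro equalityI subsetI)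
    fix f assume f: "f \<in> joint_ker (tensor_module H) w \<inter>
      orth (hspace (tensor_module H)) (mult_matrix_op \<Omega> H \<Theta> ` hspace (tensor_module H))"
    then have "\<forall>r. \<exists>c. f $ r = c *\<^sub>C k"
      by (auto simp: joint_ker_tensor[OF HM] k(2) cvec.span_singleton)
    then obtain c where c: "\<And>r. f $ r = c r *\<^sub>C k" by metis
    define v where "v = (\<chi> r. c r)"
    have fv: "f = tensor k v" by (simp add: vec_eq_iff tensor_def v_def c)
    have "cinner v (\<Theta> w *v u) = 0" for u
    proof -
      have "cinner (tensor k v) (mult_matrix_op \<Omega> H \<Theta> (tensor k u)) = 0"
        using f tS[of u] by (auto simp: orth_def fv)
      moreover have "evaluate (tensor k u) k = cinner k k *\<^sub>C u"
        by (simp add: evaluate_def tensor_def vec_eq_iff scaleC_vec_def scaleC_complex_def cinner_scaleC_left)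
      ultimately have "cinner k k * cinner (\<Theta> w *v u) v = 0"
        using pair[OF tS, of u v] cinner_eq_0_sym[of "tensor k v"]
        by (simp add: matrix_vector_mult_scaleC cinner_scaleC_left)
      then show ?thesis using k(1) cinner_eq_0_sym[of v] by simp
    qed
    then have "v \<in> orth UNIV (range ((*v) (\<Theta> w)))" by (auto simp: orth_def)
    then show "f \<in> tensor k ` orth UNIV (range ((*v) (\<Theta> w)))" using fv by blast
  next
    fix f assume "f \<in> tensor k ` orth UNIV (range ((*v) (\<Theta> w)))"
    then obtain v where v: "v \<in> orth UNIV (range ((*v) (\<Theta> w)))" "f = tensor k v" by blast
    have "tensor k v \<in> joint_ker (tensor_module H) w"
      using cvec.subspace_scale[OF subspace_joint_ker[OF HM] kk]
      by (simp add: joint_ker_tensor[OF HM]) (simp add: tensor_def)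
    moreover have "cinner (tensor k v) (mult_matrix_op \<Omega> H \<Theta> g) = 0" if "g \<in> hspace (tensor_module H)" for g
      using pair[OF that, of v] v(1) cinner_eq_0_sym[of "tensor k v"] cinner_eq_0_sym[of v]
      by (simp add: orth_def)
    ultimately show "f \<in> joint_ker (tensor_module H) w \<inter>
        orth (hspace (tensor_module H)) (mult_matrix_op \<Omega> H \<Theta> ` hspace (tensor_module H))"
      using tS by (auto simp: v(2) orth_def)
  qed
qed

text \<open>
  A frame of the complement of the range near \<open>w\<^sub>0\<close>: project a fixed vector of the complement at
  \<open>w\<^sub>0\<close> along the antiholomorphic idempotents \<open>1 - \<Psi>\<^sup>* \<Theta>\<^sup>*\<close>.
\<close>

lemma antihol_line_family_cokernel:
  fixes H :: "('n::finite, 'a::chilbert_space) hilbert_mod"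
    and \<Theta> :: "complex^'n \<Rightarrow> complex^'l::finite^'q::finite"
    and \<Psi> :: "complex^'n \<Rightarrow> complex^'q^'l"
  assumes \<Omega>: "open \<Omega>" and H: "hilbert_module H" and E: "antihol_line_family \<Omega> (joint_ker H)"
    and card: "CARD('q) = CARD('l) + 1"
    and \<Theta>: "\<Theta> \<in> multiplier_matrix \<Omega> H" and \<Psi>: "\<Psi> \<in> multiplier_matrix \<Omega> H"
    and inv: "\<forall>w\<in>\<Omega>. \<Psi> w ** \<Theta> w = mat 1"
  shows "antihol_line_family \<Omega> (\<lambda>w. orth UNIV (range ((*v) (\<Theta> w))))"
  unfolding antihol_line_family_def
proof (intro conjI ballI)
  fix w0 assume w0: "w0 \<in> \<Omega>"
  let ?A = "\<lambda>w. conj_transpose (\<Theta> w)" and ?B = "\<lambda>w. conj_transpose (\<Psi> w)"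
  let ?L = "\<lambda>w. orth UNIV (range ((*v) (\<Theta> w)))"
  show line: "\<exists>e. e \<noteq> 0 \<and> ?L w0 = cvec.span {e}" using orth_range_line[OF _ card] inv w0 by blast
  then obtain e0 where e0: "e0 \<noteq> 0" "e0 \<in> ?L w0" using cvec.span_base by blast
  define e where "e w = e0 - ?B w *v (?A w *v e0)" for w
  have entries: "antihol_at (\<lambda>w. ?A w $ i $ j) w" "antihol_at (\<lambda>w. ?B w $ j $ i) w" if "w \<in> \<Omega>" for w i j
    using antihol_onD[OF antihol_on_cnj_multiplier[OF _ H E] that, of "\<lambda>w. \<Theta> w $ j $ i"]
      antihol_onD[OF antihol_on_cnj_multiplier[OF _ H E] that, of "\<lambda>w. \<Psi> w $ i $ j"] \<Theta> \<Psi>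
    by (simp_all add: multiplier_matrix_def conj_transpose_def)
  have "antihol_on \<Omega> e"
  proof (rule antihol_onI, rule antihol_at_vec)
    fix w i assume w: "w \<in> \<Omega>"
    have "(\<lambda>w. e w $ i) = (\<lambda>w. e0 $ i + (\<Sum>j\<in>UNIV. ?B w $ i $ j * (\<Sum>m\<in>UNIV. ?A w $ j $ m * (- e0 $ m))))"
      by (simp add: e_def matrix_vector_mult_def fun_eq_iff sum_negf)
    then show "antihol_at (\<lambda>w. e w $ i) w"
      using entries[OF w]
      by (simp only:) (intro antihol_at_add antihol_at_const antihol_at_sum antihol_at_mult)
  qed
  moreover have "e w \<in> ?L w" if w: "w \<in> \<Omega>" for w
  proof -
    have "?A w *v (?B w *v x) = x" for x
      using inv w by (simp add: matrix_vector_mul_assoc conj_transpose_mult)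
    then show ?thesis by (simp add: mem_orth_range_iff e_def matrix_vector_mult_diff_distrib)
  qed
  moreover have "e w0 = e0" using e0(2) by (simp add: e_def mem_orth_range_iff)
  moreover define U where "U = {w \<in> \<Omega>. cinner (e w) e0 \<noteq> 0}"
  ultimately have "w0 \<in> U" "(U, e) \<in> frames (antihol_subbundle \<Omega> ?L)"
    using w0 e0(1) open_nonzero_pairing[OF \<Omega>, of e e0]
    by (auto simp: antihol_subbundle_def antihol_on_iff)
  then show "\<exists>U s. w0 \<in> U \<and> (U, s) \<in> frames (antihol_subbundle \<Omega> ?L)" by blast
qed

theorem theorem3p1:
  fixes \<Omega> :: "(complex^'n::finite) set"
    and H :: "('n, 'a::chilbert_space) hilbert_mod"
    and \<Theta> :: "complex^'n \<Rightarrow> complex^'l::finite^'q::finite"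
    and \<Psi> :: "complex^'n \<Rightarrow> complex^'q^'l"
  assumes "open \<Omega>" and "connected \<Omega>"
    and "H \<in> B_star 1 \<Omega>"
    and "CARD('q) = CARD('l) + 1"
    and "\<Theta> \<in> multiplier_matrix \<Omega> H"
    and "\<Psi> \<in> multiplier_matrix \<Omega> H"
    and "\<forall>w\<in>\<Omega>. \<Psi> w ** \<Theta> w = mat 1"
  shows "H_Theta \<Omega> H \<Theta> \<in> B_star 1 \<Omega> \<and>
    herm_hol_line_bundle \<Omega> (L_Theta \<Omega> \<Theta>) \<and>
    antihol_bundle_equiv \<Omega> (E_star \<Omega> (H_Theta \<Omega> H \<Theta>))
      (tensor_bundle \<Omega> (E_star \<Omega> H) (L_Theta_star \<Omega> \<Theta>)) \<and>
    (\<forall>w\<in>\<Omega>. \<forall>u v. curvature (E_star \<Omega> (H_Theta \<Omega> H \<Theta>)) w u v - curvature (E_star \<Omega> H) w u v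
      = curvature (L_Theta_star \<Omega> \<Theta>) w u v)"
proof -
  note \<Omega> = assms(1) and card = assms(4) and \<Theta> = assms(5) and \<Psi> = assms(6) and inv = assms(7)
  define L where "L w = orth UNIV (range ((*v) (\<Theta> w)))" for w
  have cs: "closed_spanning_module \<Omega> H" using assms(3) unfolding B_star_1_iff by blast
  then have HM: "hilbert_module H" by (simp add: closed_spanning_module_def)
  have E: "antihol_line_family \<Omega> (joint_ker H)" by (rule antihol_line_family_joint_ker[OF \<Omega> assms(3)])
  have L: "antihol_line_family \<Omega> L"
    unfolding L_def[abs_def] by (rule antihol_line_family_cokernel[OF \<Omega> HM E card \<Theta> \<Psi> inv])
  have line: "\<exists>k v. k \<noteq> 0 \<and> v \<noteq> 0 \<and> joint_ker H w = cvec.span {k} \<and> L w = cvec.span {v}" if "w \<in> \<Omega>" for w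
    using E L that unfolding antihol_line_family_def by blast
  have jk: "joint_ker (H_Theta \<Omega> H \<Theta>) w = tensor_family (joint_ker H) L w" if w: "w \<in> \<Omega>" for w
  proof -
    obtain k v where kv: "k \<noteq> 0" "v \<noteq> 0" "joint_ker H w = cvec.span {k}" "L w = cvec.span {v}"
      using line[OF w] by blast
    have "joint_ker (H_Theta \<Omega> H \<Theta>) w = tensor k ` cvec.span {v}"
      using joint_ker_H_Theta[OF cs \<Theta> \<Psi> inv w kv(1,3)] kv(4) by (simp add: L_def)
    also have "\<dots> = cvec.span {tensor k v}"
      by (simp add: cvec.span_singleton image_image tensor_scaleC_right)
    also have "\<dots> = tensor_family (joint_ker H) L w"
      by (simp add: tensor_family_def kv(3,4) span_tensor_lines)
    finally show ?thesis .
  qed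
  note T = antihol_line_family_tensor[OF E L]
  have fr: "antihol_subbundle \<Omega> (joint_ker (H_Theta \<Omega> H \<Theta>)) = E_star \<Omega> (H_Theta \<Omega> H \<Theta>)"
    by (simp add: E_star_def)
  have tb: "tensor_bundle \<Omega> (E_star \<Omega> H) (L_Theta_star \<Omega> \<Theta>) = antihol_subbundle \<Omega> (tensor_family (joint_ker H) L)"
    by (simp add: tensor_bundle_def E_star_def L_Theta_star_def antihol_subbundle_def sub_space_def
        tensor_family_def[abs_def] L_def)
  have F: "antihol_line_family \<Omega> (joint_ker (H_Theta \<Omega> H \<Theta>))"
  proof -
    have "frames (antihol_subbundle \<Omega> (joint_ker (H_Theta \<Omega> H \<Theta>))) =
        frames (antihol_subbundle \<Omega> (tensor_family (joint_ker H) L))"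
      using jk by (rule frames_antihol_subbundle_cong)
    then show ?thesis using T jk by (simp add: antihol_line_family_def)
  qed
  have "H_Theta \<Omega> H \<Theta> \<in> B_star 1 \<Omega>"
    unfolding B_star_1_iff
    using H_Theta_closed_spanning(1)[OF cs \<Theta> \<Psi> inv] F by (simp add: antihol_line_family_def)
  moreover have "herm_hol_line_bundle \<Omega> (L_Theta \<Omega> \<Theta>)"
    by (rule herm_hol_line_bundle_L_Theta) (use L in \<open>simp add: L_def[abs_def]\<close>)
  moreover have "antihol_bundle_equiv \<Omega> (E_star \<Omega> (H_Theta \<Omega> H \<Theta>))
      (tensor_bundle \<Omega> (E_star \<Omega> H) (L_Theta_star \<Omega> \<Theta>))"
    unfolding tb fr[symmetric] by (rule antihol_subbundle_equiv[OF F jk])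
  moreover have "curvature (E_star \<Omega> (H_Theta \<Omega> H \<Theta>)) w u v - curvature (E_star \<Omega> H) w u v
      = curvature (L_Theta_star \<Omega> \<Theta>) w u v" if w: "w \<in> \<Omega>" for w u v
  proof -
    have "curvature (E_star \<Omega> (H_Theta \<Omega> H \<Theta>)) w u v =
        curvature (antihol_subbundle \<Omega> (tensor_family (joint_ker H) L)) w u v"
      unfolding E_star_def by (rule curvature_antihol_subbundle_cong[OF jk])
    then show ?thesis
      using curvature_tensor[OF E L w] by (simp add: E_star_def L_Theta_star_def L_def[abs_def])
  qed
  ultimately show ?thesis by blast
qed

end
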